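(* Let $N\ge2$, $0<\theta<1$, let $\lambda_\theta$ be the lens map with parameter $\theta$, and let $\Phi\colon\mathbb{D}^N\to\mathbb{D}^N$ be $\Phi(z_1,\dots,z_N)=(\lambda_\theta(z_1),\lambda_\theta(z_1),\dots,\lambda_\theta(z_1))$. Then: (1) if $\theta>1/N$, $C_\Phi$ is not bounded on $H^2(\mathbb{D}^N)$; (2) if $\theta=1/N$, $C_\Phi$ is bounded but not compact on $H^2(\mathbb{D}^N)$; (3) if $\theta<1/N$, $C_\Phi$ is compact on $H^2(\mathbb{D}^N)$ and there are constants $d>0$ depending only on $\theta$ and $N$, and $K>0$, such that $a_n(C_\Phi)\le Ke^{-d\sqrt n}$ for all $n\ge1$.
   Context: The lens map of parameter $\theta\in(0,1)$ is $\lambda_\theta(z)=\dfrac{(1+z)^\theta-(1-z)^\theta}{(1+z)^\theta+(1-z)^\theta}$, $z\in\mathbb{D}$ (principal branches). $H^2(\mathbb{D}^N)$ is the Hardy space of the polydisk: analytic $f=\sum_\alpha a_\alpha z^\alpha$ with $\|f\|^2=\sum_\alpha|a_\alpha|^2<\infty$; $C_\Phi f=f\circ\Phi$. The approximation numbers are $a_n(T)=\inf\{\|T-R\|:\operatorname{rank}R<n\}$. *)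

theory Defs
  imports "HOL-Analysis.Analysis"
begin

text \<open>Points of the polydisk D^N are represented as functions nat => complex;
  only the coordinates 0..N-1 matter (coordinate z_1 of the paper is z 0).\<close>

definition lens :: "real \<Rightarrow> complex \<Rightarrow> complex" where
  "lens \<theta> z = ((1 + z) powr (of_real \<theta>) - (1 - z) powr (of_real \<theta>)) /
                ((1 + z) powr (of_real \<theta>) + (1 - z) powr (of_real \<theta>))"

definition polydisk :: "nat \<Rightarrow> (nat \<Rightarrow> complex) set" where
  "polydisk N = {z. \<forall>i<N. norm (z i) < 1}"

definition multi_idx :: "nat \<Rightarrow> (nat \<Rightarrow> nat) set" where
  "multi_idx N = {\<alpha>. \<forall>i\<ge>N. \<alpha> i = 0}"

definition monom :: "nat \<Rightarrow> (nat \<Rightarrow> complex) \<Rightarrow> (nat \<Rightarrow> nat) \<Rightarrow> complex" where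
  "monom N z \<alpha> = (\<Prod>i<N. z i ^ \<alpha> i)"

definition h2_coeffs :: "nat \<Rightarrow> ((nat \<Rightarrow> complex) \<Rightarrow> complex) \<Rightarrow> ((nat \<Rightarrow> nat) \<Rightarrow> complex) \<Rightarrow> bool" where
  "h2_coeffs N f a \<longleftrightarrow>
     (\<forall>\<alpha>. \<alpha> \<notin> multi_idx N \<longrightarrow> a \<alpha> = 0) \<and>
     (\<lambda>\<alpha>. (norm (a \<alpha>))\<^sup>2) summable_on multi_idx N \<and>
     (\<forall>z\<in>polydisk N. ((\<lambda>\<alpha>. a \<alpha> * monom N z \<alpha>) has_sum f z) (multi_idx N))"

definition H2 :: "nat \<Rightarrow> ((nat \<Rightarrow> complex) \<Rightarrow> complex) set" where
  "H2 N = {f. \<exists>a. h2_coeffs N f a}"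

definition h2_norm :: "nat \<Rightarrow> ((nat \<Rightarrow> complex) \<Rightarrow> complex) \<Rightarrow> real" where
  "h2_norm N f = sqrt (infsum (\<lambda>\<alpha>. (norm ((SOME a. h2_coeffs N f a) \<alpha>))\<^sup>2) (multi_idx N))"

definition comp_op ::
  "((nat \<Rightarrow> complex) \<Rightarrow> (nat \<Rightarrow> complex)) \<Rightarrow> ((nat \<Rightarrow> complex) \<Rightarrow> complex) \<Rightarrow> ((nat \<Rightarrow> complex) \<Rightarrow> complex)" where
  "comp_op \<Phi> f = f \<circ> \<Phi>"

type_synonym op = "((nat \<Rightarrow> complex) \<Rightarrow> complex) \<Rightarrow> ((nat \<Rightarrow> complex) \<Rightarrow> complex)"

definition bounded_on_H2 :: "nat \<Rightarrow> op \<Rightarrow> bool" where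
  "bounded_on_H2 N T \<longleftrightarrow> (\<forall>f\<in>H2 N. T f \<in> H2 N) \<and>
     (\<exists>C. \<forall>f\<in>H2 N. h2_norm N (T f) \<le> C * h2_norm N f)"

text \<open>Compact: maps H2 into H2 and the image of every bounded sequence (norm \<le> 1)
  has a Cauchy (hence convergent, H2 being complete) subsequence.\<close>
definition compact_on_H2 :: "nat \<Rightarrow> op \<Rightarrow> bool" where
  "compact_on_H2 N T \<longleftrightarrow> (\<forall>f\<in>H2 N. T f \<in> H2 N) \<and>
     (\<forall>u. (\<forall>k. u k \<in> H2 N \<and> h2_norm N (u k) \<le> 1) \<longrightarrow>
        (\<exists>r::nat\<Rightarrow>nat. strict_mono r \<and> (\<forall>e::real>0. \<exists>M::nat. \<forall>m\<ge>M. \<forall>n\<ge>M.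
            h2_norm N (\<lambda>z. T (u (r m)) z - T (u (r n)) z) < e)))"

definition op_norm :: "nat \<Rightarrow> op \<Rightarrow> real" where
  "op_norm N T = Sup ((\<lambda>f. h2_norm N (T f)) ` {f \<in> H2 N. h2_norm N f \<le> 1})"

definition linear_on_H2 :: "nat \<Rightarrow> op \<Rightarrow> bool" where
  "linear_on_H2 N R \<longleftrightarrow> (\<forall>f\<in>H2 N. R f \<in> H2 N) \<and>
     (\<forall>f\<in>H2 N. \<forall>g\<in>H2 N. \<forall>a b. \<forall>z\<in>polydisk N.
        R (\<lambda>w. a * f w + b * g w) z = a * R f z + b * R g z)"

definition rank_less :: "nat \<Rightarrow> op \<Rightarrow> nat \<Rightarrow> bool" where
  "rank_less N R n \<longleftrightarrow> (\<exists>m<n. \<exists>g :: nat \<Rightarrow> ((nat \<Rightarrow> complex) \<Rightarrow> complex).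
     (\<forall>k<m. g k \<in> H2 N) \<and>
     (\<forall>f\<in>H2 N. \<exists>c :: nat \<Rightarrow> complex. \<forall>z\<in>polydisk N. R f z = (\<Sum>k<m. c k * g k z)))"

definition approx_num :: "nat \<Rightarrow> op \<Rightarrow> nat \<Rightarrow> real" where
  "approx_num N T n = Inf {op_norm N (\<lambda>f z. T f z - R f z) | R.
      linear_on_H2 N R \<and> bounded_on_H2 N R \<and> rank_less N R n}"

definition lens_diag :: "real \<Rightarrow> (nat \<Rightarrow> complex) \<Rightarrow> (nat \<Rightarrow> complex)" where
  "lens_diag \<theta> z = (\<lambda>i. lens \<theta> (z 0))"

end

theory Submission
  imports Defs "HOL-Complex_Analysis.Complex_Analysis"
begin

text \<open>
  Restricting \<open>f \<in> H2 N\<close> to the diagonal gives a power series whose coefficients \<open>b d\<close> satisfy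
  \<open>\<Sum>d. |b d|\<^sup>2 / (d + 1)^(N - 1) \<le> \<parallel>f\<parallel>\<^sup>2\<close>, so everything reduces to the one-variable operator \<open>g \<mapsto> g \<circ> lens \<theta>\<close>
  into the Hardy space of the disk.

  Lower bounds: test on the normalised reproducing kernels at the points \<open>(lens \<theta> s, \<dots>, lens \<theta> s)\<close>, \<open>s \<rightarrow> 1\<close>, and
  evaluate the image at \<open>s\<close>.

  Boundedness for \<open>\<theta> = 1 / N\<close>: Cauchy-Schwarz gives \<open>|g w|\<^sup>2 \<le> (\<Sum>d. |b d|\<^sup>2 |w|^d) / (1 - |w|)\<close>, while
  \<open>1 - |lens \<theta> z|\<^sup>2 \<ge> c s powr \<theta>\<close> whenever \<open>s \<le> |1 - z\<^sup>2|\<close>; the resulting integrals over circles are at most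
  \<open>C (d + 1)^(1 - N)\<close>.

  For \<open>\<theta> < 1 / N\<close> factor \<open>lens \<theta> = lens (1 / N) \<circ> lens (N \<theta>)\<close>. Composition with the first factor maps into the Hardy
  space, and there \<open>g = (finite rank part) + B h\<close> with \<open>\<parallel>h\<parallel> \<le> \<parallel>g\<parallel>\<close> for a finite Blaschke product \<open>B\<close>. Placing
  zeros of multiplicity \<open>p\<close> at \<open>2p + 1\<close> dyadic scales makes \<open>B \<circ> lens (N \<theta>)\<close> exponentially small in \<open>p\<close> except
  exponentially close to \<open>1\<close> and \<open>-1\<close>, where the size of \<open>h \<circ> lens (N \<theta>)\<close> is integrable; the rank is about \<open>2 p\<^sup>2\<close>.
\<close>

section \<open>Square-summable power series\<close>

lemma abs_summable_on_Cauchy_Schwarz: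
  fixes a b :: "'i \<Rightarrow> 'a::{real_normed_field, banach}"
  assumes a_summable: "(\<lambda>i. (norm (a i))\<^sup>2) summable_on I" and b_summable: "(\<lambda>i. (norm (b i))\<^sup>2) summable_on I"
  shows "(\<lambda>i. norm (a i * b i)) summable_on I"
    and "(norm (\<Sum>\<^sub>\<infinity>i\<in>I. a i * b i))\<^sup>2 \<le> (\<Sum>\<^sub>\<infinity>i\<in>I. (norm (a i))\<^sup>2) * (\<Sum>\<^sub>\<infinity>i\<in>I. (norm (b i))\<^sup>2)"
proof -
  define S where "S = (\<Sum>\<^sub>\<infinity>i\<in>I. (norm (a i))\<^sup>2) * (\<Sum>\<^sub>\<infinity>i\<in>I. (norm (b i))\<^sup>2)"
  have finite_le: "(\<Sum>i\<in>F. norm (a i * b i)) \<le> sqrt S" if F_finite: "finite F" "F \<subseteq> I" for F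
  proof (rule real_le_rsqrt)
    have "(\<Sum>i\<in>F. norm (a i * b i))\<^sup>2 \<le> (\<Sum>i\<in>F. (norm (a i))\<^sup>2) * (\<Sum>i\<in>F. (norm (b i))\<^sup>2)"
      unfolding norm_mult by (rule Cauchy_Schwarz_ineq_sum)
    also have "\<dots> \<le> S"
      unfolding S_def
      by (intro mult_mono finite_sum_le_infsum a_summable b_summable F_finite sum_nonneg infsum_nonneg) auto
    finally show "(\<Sum>i\<in>F. norm (a i * b i))\<^sup>2 \<le> S" .
  qed
  show summable: "(\<lambda>i. norm (a i * b i)) summable_on I"
    using finite_le by (intro nonneg_bdd_above_summable_on bdd_aboveI2[of _ _ "sqrt S"]) auto
  have "norm (\<Sum>\<^sub>\<infinity>i\<in>I. a i * b i) \<le> (\<Sum>\<^sub>\<infinity>i\<in>I. norm (a i * b i))"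
    by (rule norm_infsum_bound[OF summable])
  also have "\<dots> \<le> sqrt S"
    by (rule infsum_le_finite_sums[OF summable finite_le])
  finally have "(norm (\<Sum>\<^sub>\<infinity>i\<in>I. a i * b i))\<^sup>2 \<le> (sqrt S)\<^sup>2"
    by (rule power_mono) simp
  also have "\<dots> = S"
    unfolding S_def by (intro real_sqrt_pow2 mult_nonneg_nonneg infsum_nonneg) auto
  finally show "(norm (\<Sum>\<^sub>\<infinity>i\<in>I. a i * b i))\<^sup>2 \<le> (\<Sum>\<^sub>\<infinity>i\<in>I. (norm (a i))\<^sup>2) * (\<Sum>\<^sub>\<infinity>i\<in>I. (norm (b i))\<^sup>2)"
    unfolding S_def .
qed

lemma cmod_diff_squared_le: "(cmod (x - y))\<^sup>2 \<le> 2 * (cmod x)\<^sup>2 + 2 * (cmod y)\<^sup>2"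
proof -
  have "(cmod (x - y))\<^sup>2 \<le> (cmod x + cmod y)\<^sup>2"
    by (intro power_mono norm_triangle_ineq4) auto
  also have "\<dots> \<le> 2 * (cmod x)\<^sup>2 + 2 * (cmod y)\<^sup>2"
    using sum_squares_bound[of "cmod x" "cmod y"] by (simp add: power2_sum)
  finally show ?thesis .
qed

definition ell2 :: "(nat \<Rightarrow> complex) set" where
  "ell2 = {c. summable (\<lambda>n. (cmod (c n))\<^sup>2)}"

definition ell2_sqnorm :: "(nat \<Rightarrow> complex) \<Rightarrow> real" where
  "ell2_sqnorm c = (\<Sum>n. (cmod (c n))\<^sup>2)"

definition power_series :: "(nat \<Rightarrow> complex) \<Rightarrow> complex \<Rightarrow> complex" where
  "power_series c z = (\<Sum>n. c n * z ^ n)"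

lemma ell2_sums: "c \<in> ell2 \<Longrightarrow> (\<lambda>n. (cmod (c n))\<^sup>2) sums ell2_sqnorm c"
  by (simp add: ell2_def ell2_sqnorm_def summable_sums)

lemma ell2_has_sum: "c \<in> ell2 \<Longrightarrow> ((\<lambda>n. (cmod (c n))\<^sup>2) has_sum ell2_sqnorm c) UNIV"
  by (intro sums_nonneg_imp_has_sum ell2_sums) auto

lemma ell2_sqnorm_nonneg: "c \<in> ell2 \<Longrightarrow> 0 \<le> ell2_sqnorm c"
  by (simp add: ell2_def ell2_sqnorm_def suminf_nonneg)

lemma ell2_if_bounded_partial_sums:
  assumes bound: "\<And>K. (\<Sum>n<K. (cmod (c n))\<^sup>2) \<le> A"
  shows "c \<in> ell2" and "ell2_sqnorm c \<le> A"
proof -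
  show "c \<in> ell2"
    unfolding ell2_def mem_Collect_eq
    by (rule bounded_imp_summable[of _ A]) (use bound[of "Suc _"] in \<open>auto simp: lessThan_Suc_atMost\<close>)
  then show "ell2_sqnorm c \<le> A"
    using bound by (auto simp: ell2_def ell2_sqnorm_def intro: suminf_le_const)
qed

lemma power_series_sums:
  assumes "c \<in> ell2" "cmod z < 1"
  shows "(\<lambda>n. c n * z ^ n) sums power_series c z"
    and "((\<lambda>n. c n * z ^ n) has_sum power_series c z) UNIV"
    and "(cmod (power_series c z))\<^sup>2 \<le> ell2_sqnorm c / (1 - (cmod z)\<^sup>2)"
proof -
  have square_less_1: "norm ((cmod z)\<^sup>2) < 1"
    using assms by (simp add: power_less_one_iff)
  have geometric: "((\<lambda>n. (cmod (z ^ n))\<^sup>2) has_sum (1 / (1 - (cmod z)\<^sup>2))) UNIV"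
    using geometric_sums[OF square_less_1]
    by (intro sums_nonneg_imp_has_sum) (simp_all add: norm_power mult.commute flip: power_mult)
  note coefficients = ell2_has_sum[OF assms(1)]
  note cauchy_schwarz = abs_summable_on_Cauchy_Schwarz[OF has_sum_imp_summable has_sum_imp_summable,
      OF coefficients geometric]
  have has_sum: "((\<lambda>n. c n * z ^ n) has_sum (\<Sum>\<^sub>\<infinity>n. c n * z ^ n)) UNIV"
    by (rule has_sum_infsum[OF abs_summable_summable[OF cauchy_schwarz(1)]])
  have series_eq: "power_series c z = (\<Sum>\<^sub>\<infinity>n. c n * z ^ n)"
    unfolding power_series_def using has_sum_imp_sums[OF has_sum] by (rule sums_unique[symmetric])
  show "((\<lambda>n. c n * z ^ n) has_sum power_series c z) UNIV"
    using has_sum unfolding series_eq .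
  then show "(\<lambda>n. c n * z ^ n) sums power_series c z"
    by (rule has_sum_imp_sums)
  show "(cmod (power_series c z))\<^sup>2 \<le> ell2_sqnorm c / (1 - (cmod z)\<^sup>2)"
    using cauchy_schwarz(2) unfolding series_eq infsumI[OF coefficients] infsumI[OF geometric] by simp
qed

lemma power_series_growth:
  assumes "c \<in> ell2" "ell2_sqnorm c \<le> A" "cmod z < 1"
  shows "(cmod (power_series c z))\<^sup>2 \<le> A / (1 - (cmod z)\<^sup>2)"
proof -
  have "ell2_sqnorm c / (1 - (cmod z)\<^sup>2) \<le> A / (1 - (cmod z)\<^sup>2)"
    using assms by (intro divide_right_mono) (auto simp: abs_square_le_1)
  with power_series_sums(3)[OF assms(1,3)] show ?thesis by linarith
qed

lemma holomorphic_on_power_series: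
  assumes "c \<in> ell2"
  shows "power_series c holomorphic_on ball 0 1"
  by (rule power_series_holomorphic[of 0 1 c]) (use power_series_sums[OF assms] in auto)

lemma power_series_linear:
  assumes "c \<in> ell2" "d \<in> ell2" "cmod z < 1"
  shows "power_series (\<lambda>n. x * c n + y * d n) z = x * power_series c z + y * power_series d z"
proof -
  have "(\<lambda>n. x * (c n * z ^ n) + y * (d n * z ^ n)) sums (x * power_series c z + y * power_series d z)"
    by (intro sums_add sums_mult power_series_sums assms)
  then show ?thesis
    by (simp add: power_series_def sums_iff algebra_simps)
qed

section \<open>Taylor coefficients and the Hardy space of the disk\<close>

definition taylor :: "(complex \<Rightarrow> complex) \<Rightarrow> nat \<Rightarrow> complex" where
  "taylor h n = fps_nth (fps_expansion h 0) n"

lemma taylor_sums: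
  assumes "h holomorphic_on ball 0 1" "cmod z < 1"
  shows "(\<lambda>n. taylor h n * z ^ n) sums h z"
  using holomorphic_power_series[OF assms(1), of z] assms(2) by (simp add: taylor_def fps_expansion_def)

lemma power_series_taylor:
  assumes "h holomorphic_on ball 0 1" "cmod z < 1"
  shows "power_series (taylor h) z = h z"
  using taylor_sums[OF assms] by (simp add: power_series_def sums_iff)

lemma taylor_eqI:
  assumes "\<And>z. cmod z < 1 \<Longrightarrow> (\<lambda>n. c n * z ^ n) sums h z"
  shows "taylor h = c"
proof -
  have "\<forall>\<^sub>F z in nhds 0. cmod z < 1"
    using eventually_nhds_in_open[of "ball 0 1" "0::complex"] by simp
  then have "h has_fps_expansion Abs_fps c"
    by (intro has_fps_expansionI) (auto elim!: eventually_mono intro: assms)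
  from fps_expansion_eqI[OF this] show ?thesis
    by (simp add: taylor_def fun_eq_iff)
qed

lemma taylor_linear:
  assumes "f holomorphic_on ball 0 1" "g holomorphic_on ball 0 1"
  shows "taylor (\<lambda>z. a * f z + b * g z) = (\<lambda>n. a * taylor f n + b * taylor g n)"
proof (rule taylor_eqI)
  fix z :: complex assume z_disk: "cmod z < 1"
  have "(\<lambda>n. a * (taylor f n * z ^ n) + b * (taylor g n * z ^ n)) sums (a * f z + b * g z)"
    by (intro sums_add sums_mult taylor_sums assms z_disk)
  then show "(\<lambda>n. (a * taylor f n + b * taylor g n) * z ^ n) sums (a * f z + b * g z)"
    by (simp add: algebra_simps)
qed

lemma has_integral_cis_int_multiple:
  "((\<lambda>t. cis (2 * pi * of_int k * t)) has_integral (if k = 0 then 1 else 0)) {0..1}"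
proof (cases "k = 0")
  case True
  then show ?thesis
    using has_integral_const_real[of "1::complex" 0 1] by simp
next
  case False
  define w where "w = 2 * pi * of_int k"
  have w_period: "w \<noteq> 0" "cis w = 1"
    using False cis_multiple_2pi[of "of_int k"] by (auto simp: w_def)
  have "((\<lambda>t. cis (w * t)) has_integral cis (w * 1) / (\<i> * w) - cis (w * 0) / (\<i> * w)) {0..1}"
  proof (rule fundamental_theorem_of_calculus)
    fix t
    have "((\<lambda>z. exp (\<i> * w * z) / (\<i> * w)) has_field_derivative cis (w * t)) (at (of_real t))"
      using w_period by (auto intro!: derivative_eq_intros simp: cis_conv_exp mult.assoc)
    from has_vector_derivative_real_field[OF this]
    show "((\<lambda>t. cis (w * t) / (\<i> * w)) has_vector_derivative cis (w * t)) (at t within {0..1})"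
      by (simp add: cis_conv_exp mult.assoc)
  qed simp
  then show ?thesis
    using False w_period by (simp add: w_def)
qed

lemma parseval_polynomial:
  "((\<lambda>t. (cmod (\<Sum>n<K. c n * (of_real r * cis (2 * pi * t)) ^ n))\<^sup>2)
    has_integral (\<Sum>n<K. (cmod (c n) * r ^ n)\<^sup>2)) {0..1}"
proof -
  define d where "d n = c n * of_real (r ^ n)" for n
  have term_eq: "c n * (of_real r * cis (2 * pi * t)) ^ n = d n * cis (2 * pi * n * t)" for n t
    by (simp add: d_def power_mult_distrib Complex.DeMoivre mult_ac)
  have expand: "complex_of_real ((cmod (\<Sum>n<K. c n * (of_real r * cis (2 * pi * t)) ^ n))\<^sup>2) =
      (\<Sum>m<K. \<Sum>n<K. d m * cnj (d n) * cis (2 * pi * of_int (int m - int n) * t))" for t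
    unfolding term_eq complex_norm_square cnj_sum sum_product
    by (intro sum.cong) (simp_all add: cis_cnj cis_mult algebra_simps)
  have "((\<lambda>t. \<Sum>m<K. \<Sum>n<K. d m * cnj (d n) * cis (2 * pi * of_int (int m - int n) * t)) has_integral
      (\<Sum>m<K. \<Sum>n<K. d m * cnj (d n) * (if int m - int n = 0 then 1 else 0))) {0..1}"
    by (intro has_integral_sum has_integral_mult_right has_integral_cis_int_multiple) auto
  also have "(\<Sum>m<K. \<Sum>n<K. d m * cnj (d n) * (if int m - int n = 0 then 1 else 0)) =
      (\<Sum>n<K. complex_of_real ((cmod (d n))\<^sup>2))"
    by (simp add: if_distrib[of "\<lambda>x. _ * x"] complex_norm_square del: of_real_power cong: if_cong)
  finally have "((\<lambda>t. complex_of_real ((cmod (\<Sum>n<K. c n * (of_real r * cis (2 * pi * t)) ^ n))\<^sup>2))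
      has_integral complex_of_real (\<Sum>n<K. (cmod (d n))\<^sup>2)) {0..1}"
    unfolding expand by simp
  from has_integral_linear[OF this bounded_linear_Re] show ?thesis
    by (simp add: comp_def d_def norm_mult norm_power power_mult_distrib flip: power_abs)
qed

lemma parseval_power_series:
  assumes r_nonneg: "0 \<le> r" and summable: "summable (\<lambda>n. cmod (c n) * r ^ n)"
  defines "mean \<equiv> \<lambda>t. (cmod (power_series c (of_real r * cis (2 * pi * t))))\<^sup>2"
  shows "mean integrable_on {0..1}" and "(\<lambda>n. (cmod (c n) * r ^ n)\<^sup>2) sums integral {0..1} mean"
proof -
  define p where "p K t = (\<Sum>n<K. c n * (of_real r * cis (2 * pi * t)) ^ n)" for K :: nat and t
  define M where "M = (\<Sum>n. cmod (c n) * r ^ n)"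
  have norm_term: "cmod (c n * (of_real r * cis (2 * pi * t)) ^ n) = cmod (c n) * r ^ n" for n t
    using r_nonneg by (simp add: norm_mult norm_power)
  have "cmod (p K t) \<le> M" for K t
  proof -
    have "cmod (p K t) \<le> (\<Sum>n<K. cmod (c n) * r ^ n)"
      unfolding p_def by (intro sum_norm_le) (simp add: norm_term)
    also have "\<dots> \<le> M"
      unfolding M_def using r_nonneg by (intro sum_le_suminf summable) auto
    finally show ?thesis .
  qed
  then have bound: "norm ((cmod (p K t))\<^sup>2) \<le> M\<^sup>2" for K t
    by (simp add: power_mono)
  have limit: "(\<lambda>K. (cmod (p K t))\<^sup>2) \<longlonglongrightarrow> mean t" for t
  proof -
    have "summable (\<lambda>n. c n * (of_real r * cis (2 * pi * t)) ^ n)"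
      by (rule summable_norm_cancel) (simp only: norm_term summable)
    then show ?thesis
      unfolding mean_def p_def power_series_def by (intro tendsto_power tendsto_norm summable_LIMSEQ)
  qed
  have integral: "((\<lambda>t. (cmod (p K t))\<^sup>2) has_integral (\<Sum>n<K. (cmod (c n) * r ^ n)\<^sup>2)) {0..1}" for K
    unfolding p_def by (rule parseval_polynomial)
  note convergence = dominated_convergence[where f = "\<lambda>K t. (cmod (p K t))\<^sup>2" and h = "\<lambda>_. M\<^sup>2" and g = mean,
      OF has_integral_integrable[OF integral] integrable_const_ivl bound limit]
  show "mean integrable_on {0..1}"
    by (rule convergence)
  show "(\<lambda>n. (cmod (c n) * r ^ n)\<^sup>2) sums integral {0..1} mean"
    using convergence(2) unfolding integral_unique[OF integral] sums_def .
qed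

lemma parseval_holomorphic:
  assumes h_holomorphic: "h holomorphic_on ball 0 1" and r_bounds: "0 \<le> r" "r < 1"
  defines "mean \<equiv> \<lambda>t. (cmod (h (of_real r * cis (2 * pi * t))))\<^sup>2"
  shows "mean integrable_on {0..1}" and "(\<lambda>n. (cmod (taylor h n) * r ^ n)\<^sup>2) sums integral {0..1} mean"
proof -
  have "summable (\<lambda>n. taylor h n * of_real ((1 + r) / 2) ^ n)"
    using taylor_sums[OF h_holomorphic, of "of_real ((1 + r) / 2)"] r_bounds
    by (simp only: norm_of_real) (auto simp: sums_iff)
  from powser_insidea[OF this, of "of_real r"] r_bounds
  have "summable (\<lambda>n. cmod (taylor h n) * r ^ n)"
    by (simp only: norm_of_real) (simp add: norm_mult norm_power)
  moreover have "mean = (\<lambda>t. (cmod (power_series (taylor h) (of_real r * cis (2 * pi * t))))\<^sup>2)"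
    unfolding mean_def using r_bounds by (simp add: power_series_taylor[OF h_holomorphic] norm_mult)
  ultimately show "mean integrable_on {0..1}"
    and "(\<lambda>n. (cmod (taylor h n) * r ^ n)\<^sup>2) sums integral {0..1} mean"
    using parseval_power_series[OF r_bounds(1)] by simp_all
qed

lemma sin_pi_mult_ge:
  assumes "0 \<le> s" "s \<le> 1/2"
  shows "2 * s \<le> sin (pi * s)"
proof -
  have "convex_on {0..pi/2} (\<lambda>x. - sin x)"
    by (rule f''_ge0_imp_convex[where f' = "\<lambda>x. - cos x" and f'' = sin])
       (auto intro!: derivative_eq_intros sin_ge_zero)
  from convex_onD_Icc[OF this, of "2 * s"] assms show ?thesis
    by (simp add: mult.commute)
qed

lemma has_integral_fold:
  fixes f :: "real \<Rightarrow> 'a::banach"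
  assumes f_integral: "(f has_integral I) {0..a}" and a_nonneg: "0 \<le> a"
  shows "((\<lambda>t. f (min t (2 * a - t))) has_integral I + I) {0..2 * a}"
proof (rule has_integral_combine[of 0 a])
  show "((\<lambda>t. f (min t (2 * a - t))) has_integral I) {0..a}"
    using f_integral by (rule has_integral_eq[rotated]) (simp add: min_def)
  have "((\<lambda>t. f (2 * a - t)) has_integral I) {a..2 * a}"
    using has_integral_affinity[of f I 0 a "-1" "2 * a"] f_integral
    by (simp add: image_iff)
  then show "((\<lambda>t. f (min t (2 * a - t))) has_integral I) {a..2 * a}"
    by (rule has_integral_eq[rotated]) (auto simp: min_def dest: antisym)
qed (use a_nonneg in auto)

text \<open>Folding \<open>{0..2 ^ k}\<close> repeatedly onto \<open>{0..1}\<close> sends each point to its distance from the nearest even integer,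
  that is, from the nearest zero of \<open>\<lambda>t. sin (pi / 2 * t)\<close>.\<close>

lemma has_integral_below_abs_sin:
  fixes \<phi> :: "real \<Rightarrow> real"
  assumes \<phi>_integral: "(\<phi> has_integral I) {0..1}"
  shows "\<exists>\<delta> S. ((\<lambda>t. \<phi> (\<delta> t)) has_integral 2 ^ k * I) {0..2 ^ k} \<and> finite S \<and>
    (\<forall>t\<in>{0..2 ^ k} - S. 0 < \<delta> t \<and> \<delta> t \<le> 1 \<and> \<delta> t \<le> \<bar>sin (pi / 2 * t)\<bar>)"
proof (induction k)
  case 0
  show ?case
  proof (intro exI conjI ballI)
    show "((\<lambda>t. \<phi> t) has_integral 2 ^ 0 * I) {0..2 ^ 0}" "finite {0::real}"
      using \<phi>_integral by simp_all
    fix t :: real assume "t \<in> {0..2 ^ 0} - {0}"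
    then show "0 < t" "t \<le> 1" "t \<le> \<bar>sin (pi / 2 * t)\<bar>"
      using sin_pi_mult_ge[of "t / 2"] by auto
  qed
next
  case (Suc k)
  let ?a = "2 ^ k :: real"
  from Suc obtain \<delta> S where \<delta>_integral: "((\<lambda>t. \<phi> (\<delta> t)) has_integral ?a * I) {0..?a}" and S_finite: "finite S"
    and below: "\<And>t. t \<in> {0..?a} - S \<Longrightarrow> 0 < \<delta> t \<and> \<delta> t \<le> 1 \<and> \<delta> t \<le> \<bar>sin (pi / 2 * t)\<bar>"
    by blast
  let ?m = "\<lambda>t. min t (2 * ?a - t)"
  have sin_fold: "\<bar>sin (pi / 2 * ?m t)\<bar> = \<bar>sin (pi / 2 * t)\<bar>" for t
  proof -
    have "pi / 2 * (2 * ?a - t) = of_nat (2 ^ k) * pi - pi / 2 * t"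
      by (simp add: algebra_simps)
    then have "\<bar>sin (pi / 2 * (2 * ?a - t))\<bar> = \<bar>sin (pi / 2 * t)\<bar>"
      by (simp only: sin_diff) (simp add: cos_npi sin_npi abs_mult power_abs del: of_nat_power)
    then show ?thesis by (simp add: min_def)
  qed
  show ?case
  proof (intro exI conjI ballI)
    show "((\<lambda>t. \<phi> (\<delta> (?m t))) has_integral 2 ^ Suc k * I) {0..2 ^ Suc k}"
      using has_integral_fold[OF \<delta>_integral] by (simp add: mult_ac)
    show "finite (S \<union> (\<lambda>t. 2 * ?a - t) ` S)"
      using S_finite by simp
    fix t assume t_generic: "t \<in> {0..2 ^ Suc k} - (S \<union> (\<lambda>t. 2 * ?a - t) ` S)"
    then have "?m t \<in> {0..?a} - S"
      by (auto simp: min_def image_iff)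
    from below[OF this] show "0 < \<delta> (?m t)" "\<delta> (?m t) \<le> 1" "\<delta> (?m t) \<le> \<bar>sin (pi / 2 * t)\<bar>"
      unfolding sin_fold by auto
  qed
qed

lemma abs_sin_le_cmod_one_minus: "\<bar>sin y\<bar> \<le> cmod (1 - of_real r * cis y)"
proof -
  have "1 - of_real r * cis y = cis y * (cis (- y) - of_real r)"
    by (simp add: algebra_simps cis_mult)
  then have "cmod (1 - of_real r * cis y) = cmod (cis (- y) - of_real r)"
    by (simp add: norm_mult)
  with abs_Im_le_cmod[of "cis (- y) - of_real r"] show ?thesis
    by simp
qed

lemma ell2_if_bounded_circle_means:
  assumes bound: "\<And>r K. 0 < r \<Longrightarrow> r < 1 \<Longrightarrow> (\<Sum>n<K. (cmod (c n) * r ^ n)\<^sup>2) \<le> A"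
  shows "c \<in> ell2" and "ell2_sqnorm c \<le> A"
proof -
  have "(\<Sum>n<K. (cmod (c n))\<^sup>2) \<le> A" for K
  proof (rule tendsto_upperbound)
    have "((\<lambda>r. \<Sum>n<K. (cmod (c n) * r ^ n)\<^sup>2) \<longlongrightarrow> (\<Sum>n<K. (cmod (c n) * 1 ^ n)\<^sup>2)) (at_left 1)"
      by (intro tendsto_intros)
    then show "((\<lambda>r. \<Sum>n<K. (cmod (c n) * r ^ n)\<^sup>2) \<longlongrightarrow> (\<Sum>n<K. (cmod (c n))\<^sup>2)) (at_left 1)"
      by simp
    show "\<forall>\<^sub>F r in at_left 1. (\<Sum>n<K. (cmod (c n) * r ^ n)\<^sup>2) \<le> A"
      by (rule eventually_at_leftI[of 0]) (auto intro: bound)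
  qed simp
  from ell2_if_bounded_partial_sums[OF this] show "c \<in> ell2" and "ell2_sqnorm c \<le> A" .
qed

lemma taylor_ell2_if_bounded_by_boundary_distance:
  assumes h_holomorphic: "h holomorphic_on ball 0 1"
    and \<phi>_integral: "(\<phi> has_integral I) {0..1::real}"
    and bound: "\<And>z s. cmod z < 1 \<Longrightarrow> 0 < s \<Longrightarrow> s \<le> 1 \<Longrightarrow> s \<le> cmod (1 - z\<^sup>2) \<Longrightarrow> (cmod (h z))\<^sup>2 \<le> \<phi> s"
  shows "taylor h \<in> ell2" and "ell2_sqnorm (taylor h) \<le> I"
proof -
  obtain \<delta> S where \<delta>_integral: "((\<lambda>t. \<phi> (\<delta> t)) has_integral 8 * I) {0..8}" and S_finite: "finite S"
    and below: "\<And>t. t \<in> {0..8} - S \<Longrightarrow> 0 < \<delta> t \<and> \<delta> t \<le> 1 \<and> \<delta> t \<le> \<bar>sin (pi / 2 * t)\<bar>"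
    using has_integral_below_abs_sin[OF \<phi>_integral, of 3] by auto
  have rescaled: "((\<lambda>t. \<phi> (\<delta> (8 * t))) has_integral I) {0..1}"
    using has_integral_affinity'[of "\<lambda>t. \<phi> (\<delta> t)" "8 * I" 0 8 8 0] \<delta>_integral by simp
  have "(\<Sum>n<K. (cmod (taylor h n) * r ^ n)\<^sup>2) \<le> I" if r_bounds: "0 < r" "r < 1" for r K
  proof -
    define circle where "circle t = of_real r * cis (2 * pi * t)" for t
    note parseval = parseval_holomorphic[OF h_holomorphic less_imp_le[OF r_bounds(1)] r_bounds(2), folded circle_def]
    let ?mean = "\<lambda>t. (cmod (h (circle t)))\<^sup>2"
    have mean_le: "?mean t \<le> \<phi> (\<delta> (8 * t))" if t_generic: "t \<in> {0..1}" "t \<notin> (\<lambda>x. x / 8) ` S" for t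
    proof -
      have "8 * t \<in> {0..8} - S"
        using t_generic by (auto simp: image_iff mult.commute)
      note \<delta>_bounds = below[OF this]
      have "(circle t)\<^sup>2 = of_real (r\<^sup>2) * cis (4 * pi * t)"
        by (simp add: circle_def power_mult_distrib Complex.DeMoivre mult_ac)
      then have "\<bar>sin (4 * pi * t)\<bar> \<le> cmod (1 - (circle t)\<^sup>2)"
        using abs_sin_le_cmod_one_minus[of "4 * pi * t" "r\<^sup>2"] by simp
      then show ?thesis
        using \<delta>_bounds r_bounds by (intro bound) (auto simp: circle_def norm_mult mult_ac)
    qed
    have "(\<Sum>n<K. (cmod (taylor h n) * r ^ n)\<^sup>2) \<le> integral {0..1} ?mean"
      using sum_le_suminf[OF sums_summable[OF parseval(2)], of "{..<K}"] sums_unique[OF parseval(2)] by simp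
    also have "\<dots> \<le> I"
    proof (rule has_integral_le[OF integrable_integral[OF parseval(1)]])
      show "((\<lambda>t. if t \<in> (\<lambda>x. x / 8) ` S then ?mean t else \<phi> (\<delta> (8 * t))) has_integral I) {0..1}"
        by (rule has_integral_spike_finite[OF _ _ rescaled, of "(\<lambda>x. x / 8) ` S"]) (use S_finite in auto)
    qed (use mean_le in auto)
    finally show ?thesis .
  qed
  from ell2_if_bounded_circle_means[OF this]
  show "taylor h \<in> ell2" and "ell2_sqnorm (taylor h) \<le> I" by auto
qed

section \<open>Power series in several variables\<close>

lemma multi_idx_0: "multi_idx 0 = {\<lambda>_. 0}"
  by (auto simp: multi_idx_def)

lemma multi_idx_Suc_bij:
  "bij_betw (\<lambda>(n, \<alpha>). \<alpha>(N := n)) (UNIV \<times> multi_idx N) (multi_idx (Suc N))"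
  by (rule bij_betw_byWitness[where f' = "\<lambda>\<alpha>. (\<alpha> N, \<alpha>(N := 0))"])
     (auto simp: multi_idx_def fun_eq_iff)

lemma has_sum_multi_idx_Suc:
  "(f has_sum S) (multi_idx (Suc N)) \<longleftrightarrow> ((\<lambda>(n, \<alpha>). f (\<alpha>(N := n))) has_sum S) (UNIV \<times> multi_idx N)"
  using has_sum_reindex_bij_betw[OF multi_idx_Suc_bij[of N], of f S] by (simp add: case_prod_beta')

lemma monom_Suc: "monom (Suc N) (z(N := w)) (\<alpha>(N := n)) = w ^ n * monom N z \<alpha>"
  by (simp add: monom_def)

lemma has_sum_power_series_zero:
  fixes G :: "nat \<Rightarrow> 'i \<Rightarrow> complex"
  assumes G_has_sum: "\<And>w. cmod w < 1 \<Longrightarrow> ((\<lambda>(n, i). G n i * w ^ n) has_sum 0) (UNIV \<times> I)"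
  shows "(G n has_sum 0) I"
proof -
  have "G n summable_on I" for n
  proof -
    have "(\<lambda>i. G n i * (1/2) ^ n) summable_on I"
      using summable_on_SigmaD1[OF has_sum_imp_summable[OF G_has_sum[of "1/2"]], of n] by simp
    from summable_on_cmult_left[OF this, of "2 ^ n"] show ?thesis
      by (simp add: power_divide)
  qed
  then have slice: "(G n has_sum infsum (G n) I) I" for n
    by (rule has_sum_infsum)
  have "(\<lambda>n. infsum (G n) I * w ^ n) sums 0" if w_disk: "cmod w < 1" for w
  proof (rule has_sum_imp_sums, rule has_sum_Sigma'[OF G_has_sum[OF w_disk]])
    show "((\<lambda>i. case (n, i) of (n, i) \<Rightarrow> G n i * w ^ n) has_sum infsum (G n) I * w ^ n) I" for n
      using has_sum_cmult_left[OF slice] by simp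
  qed
  then have "taylor (\<lambda>_. 0) = (\<lambda>n. infsum (G n) I)"
    by (intro taylor_eqI)
  moreover have "taylor (\<lambda>_. 0) = (\<lambda>_. 0)"
    by (rule taylor_eqI) simp
  ultimately show ?thesis
    using slice by metis
qed

lemma multi_power_series_zero:
  assumes "\<And>z. z \<in> polydisk N \<Longrightarrow> ((\<lambda>\<alpha>. a \<alpha> * monom N z \<alpha>) has_sum 0) (multi_idx N)"
    and "\<alpha> \<in> multi_idx N"
  shows "a \<alpha> = 0"
  using assms
proof (induction N arbitrary: a \<alpha>)
  case 0
  then show ?case
    using "0"(1)[of undefined]
    by (simp add: multi_idx_0 polydisk_def Defs.monom_def has_sum_finite_iff)
next
  case (Suc N)
  have "a (\<beta>(N := n)) = 0" if \<beta>_multi_idx: "\<beta> \<in> multi_idx N" for n \<beta>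
  proof (rule Suc.IH[of "\<lambda>\<beta>. a (\<beta>(N := n))", OF _ \<beta>_multi_idx])
    fix z assume z_polydisk: "z \<in> polydisk N"
    show "((\<lambda>\<beta>. a (\<beta>(N := n)) * monom N z \<beta>) has_sum 0) (multi_idx N)"
    proof (rule has_sum_power_series_zero[where G = "\<lambda>n \<beta>. a (\<beta>(N := n)) * monom N z \<beta>" and n = n])
      fix w :: complex assume "cmod w < 1"
      then have "z(N := w) \<in> polydisk (Suc N)"
        using z_polydisk by (auto simp: polydisk_def less_Suc_eq)
      from Suc.prems(1)[OF this]
      show "((\<lambda>(n, \<beta>). a (\<beta>(N := n)) * monom N z \<beta> * w ^ n) has_sum 0) (UNIV \<times> multi_idx N)"
        unfolding has_sum_multi_idx_Suc monom_Suc by (simp add: mult_ac)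
    qed
  qed
  from this[of "\<alpha>(N := 0)" "\<alpha> N"] Suc.prems(2) show ?case
    by (simp add: multi_idx_def)
qed

lemma has_sum_prod_multi_idx:
  fixes g :: "nat \<Rightarrow> nat \<Rightarrow> 'a :: {real_normed_field, banach}"
  assumes "\<And>i. i < N \<Longrightarrow> (g i has_sum S i) UNIV" "\<And>i. i < N \<Longrightarrow> (\<lambda>n. norm (g i n)) summable_on UNIV"
  shows "((\<lambda>\<alpha>. \<Prod>i<N. g i (\<alpha> i)) has_sum (\<Prod>i<N. S i)) (multi_idx N) \<and>
    (\<lambda>\<alpha>. norm (\<Prod>i<N. g i (\<alpha> i))) summable_on multi_idx N"
  using assms
proof (induction N)
  case 0
  then show ?case by (simp add: multi_idx_0 has_sum_finite_iff)
next
  case (Suc N)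
  let ?G = "\<lambda>\<alpha>. \<Prod>i<N. g i (\<alpha> i)"
  from Suc have G_sums: "(?G has_sum (\<Prod>i<N. S i)) (multi_idx N)" "(\<lambda>\<alpha>. norm (?G \<alpha>)) summable_on multi_idx N"
    by auto
  have split: "(\<Prod>i<Suc N. g i ((\<alpha>(N := n)) i)) = g N n * ?G \<alpha>" for n \<alpha>
    by simp
  have abs_summable: "(\<lambda>(n, \<alpha>). norm (g N n * ?G \<alpha>)) summable_on UNIV \<times> multi_idx N"
  proof (rule summable_on_SigmaI)
    show "((\<lambda>\<alpha>. case (n, \<alpha>) of (n, \<alpha>) \<Rightarrow> norm (g N n * ?G \<alpha>)) has_sum
        norm (g N n) * infsum (\<lambda>\<alpha>. norm (?G \<alpha>)) (multi_idx N)) (multi_idx N)" for n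
      using has_sum_cmult_right[OF has_sum_infsum[OF G_sums(2)], of "norm (g N n)"] by (simp add: norm_mult)
    show "(\<lambda>n. norm (g N n) * infsum (\<lambda>\<alpha>. norm (?G \<alpha>)) (multi_idx N)) summable_on UNIV"
      by (intro summable_on_cmult_left Suc.prems) auto
  qed auto
  have "((\<lambda>(n, \<alpha>). g N n * ?G \<alpha>) has_sum (S N * (\<Prod>i<N. S i))) (UNIV \<times> multi_idx N)"
  proof (rule has_sum_SigmaI)
    show "((\<lambda>\<alpha>. case (n, \<alpha>) of (n, \<alpha>) \<Rightarrow> g N n * ?G \<alpha>) has_sum g N n * (\<Prod>i<N. S i)) (multi_idx N)" for n
      using has_sum_cmult_right[OF G_sums(1)] by simp
    show "((\<lambda>n. g N n * (\<Prod>i<N. S i)) has_sum (S N * (\<Prod>i<N. S i))) UNIV"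
      by (intro has_sum_cmult_left Suc.prems) auto
    show "(\<lambda>(n, \<alpha>). g N n * ?G \<alpha>) summable_on UNIV \<times> multi_idx N"
      by (rule abs_summable_summable) (use abs_summable in \<open>simp add: case_prod_beta'\<close>)
  qed
  moreover have "(\<lambda>\<alpha>. norm (\<Prod>i<Suc N. g i (\<alpha> i))) summable_on multi_idx (Suc N)"
    by (rule has_sum_imp_summable, unfold has_sum_multi_idx_Suc split) (rule has_sum_infsum[OF abs_summable])
  ultimately show ?case
    by (simp add: has_sum_multi_idx_Suc split mult.commute)
qed

lemma geometric_has_sum:
  fixes x :: "'a :: {real_normed_field, banach}"
  assumes "norm x < 1"
  shows "((\<lambda>n. x ^ n) has_sum 1 / (1 - x)) UNIV" and "(\<lambda>n. norm (x ^ n)) summable_on UNIV"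
proof -
  have summable: "summable (\<lambda>n. norm (x ^ n))"
    using assms by (simp add: norm_power)
  then show "((\<lambda>n. x ^ n) has_sum 1 / (1 - x)) UNIV"
    using geometric_sums[OF assms] by (rule norm_summable_imp_has_sum)
  show "(\<lambda>n. norm (x ^ n)) summable_on UNIV"
    using summable by (rule summable_nonneg_imp_summable_on) simp
qed

section \<open>The Hardy space of the polydisk\<close>

lemma h2_coeffs_unique:
  assumes a_coeffs: "h2_coeffs N f a" and b_coeffs: "h2_coeffs N f b"
  shows "a = b"
proof
  fix \<alpha>
  show "a \<alpha> = b \<alpha>"
  proof (cases "\<alpha> \<in> multi_idx N")
    case True
    have "((\<lambda>\<alpha>. (a \<alpha> - b \<alpha>) * monom N z \<alpha>) has_sum 0) (multi_idx N)" if "z \<in> polydisk N" for z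
      using has_sum_add[of "\<lambda>\<alpha>. a \<alpha> * monom N z \<alpha>" _ "f z" "\<lambda>\<alpha>. - (b \<alpha> * monom N z \<alpha>)" "- f z"] a_coeffs b_coeffs that
      by (simp add: h2_coeffs_def algebra_simps has_sum_uminus)
    from multi_power_series_zero[OF this True] show ?thesis by simp
  next
    case False
    then show ?thesis using a_coeffs b_coeffs by (simp add: h2_coeffs_def)
  qed
qed

lemma h2_norm_nonneg: "0 \<le> h2_norm N f"
  by (simp add: h2_norm_def infsum_nonneg)

lemma h2_coeffs_has_sum_norm:
  assumes "h2_coeffs N f a"
  shows "((\<lambda>\<alpha>. (cmod (a \<alpha>))\<^sup>2) has_sum (h2_norm N f)\<^sup>2) (multi_idx N)"
proof -
  have "(SOME a. h2_coeffs N f a) = a"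
    using assms h2_coeffs_unique by blast
  then have "(h2_norm N f)\<^sup>2 = (\<Sum>\<^sub>\<infinity>\<alpha>\<in>multi_idx N. (cmod (a \<alpha>))\<^sup>2)"
    by (simp add: h2_norm_def infsum_nonneg)
  then show ?thesis
    using assms by (simp add: h2_coeffs_def)
qed

lemma h2_norm_scale:
  assumes f_H2: "f \<in> H2 N"
  shows "(\<lambda>z. x * f z) \<in> H2 N" and "h2_norm N (\<lambda>z. x * f z) = cmod x * h2_norm N f"
proof -
  obtain a where a_coeffs: "h2_coeffs N f a"
    using f_H2 by (auto simp: H2_def)
  have coeffs_square_has_sum: "((\<lambda>\<alpha>. (cmod (x * a \<alpha>))\<^sup>2) has_sum (cmod x * h2_norm N f)\<^sup>2) (multi_idx N)"
    unfolding norm_mult power_mult_distrib by (intro has_sum_cmult_right h2_coeffs_has_sum_norm a_coeffs)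
  have "((\<lambda>\<alpha>. x * a \<alpha> * monom N z \<alpha>) has_sum x * f z) (multi_idx N)" if "z \<in> polydisk N" for z
    unfolding mult.assoc using a_coeffs that by (intro has_sum_cmult_right) (auto simp: h2_coeffs_def)
  then have scaled_coeffs: "h2_coeffs N (\<lambda>z. x * f z) (\<lambda>\<alpha>. x * a \<alpha>)"
    using a_coeffs has_sum_imp_summable[OF coeffs_square_has_sum] by (auto simp: h2_coeffs_def)
  then show "(\<lambda>z. x * f z) \<in> H2 N"
    by (auto simp: H2_def)
  have "(h2_norm N (\<lambda>z. x * f z))\<^sup>2 = (cmod x * h2_norm N f)\<^sup>2"
    using h2_coeffs_has_sum_norm[OF scaled_coeffs] coeffs_square_has_sum by (rule has_sum_unique)
  then show "h2_norm N (\<lambda>z. x * f z) = cmod x * h2_norm N f"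
    by (simp add: power2_eq_iff_nonneg h2_norm_nonneg)
qed

lemma h2_norm_triangle:
  assumes f_H2: "f \<in> H2 N" and g_H2: "g \<in> H2 N"
  shows "(\<lambda>z. f z + g z) \<in> H2 N" and "h2_norm N (\<lambda>z. f z + g z) \<le> h2_norm N f + h2_norm N g"
proof -
  obtain a b where a_coeffs: "h2_coeffs N f a" and b_coeffs: "h2_coeffs N g b"
    using f_H2 g_H2 by (auto simp: H2_def)
  let ?ab = "\<lambda>\<alpha>. a \<alpha> + b \<alpha>"
  have L2_le: "L2_set (\<lambda>\<alpha>. cmod (e \<alpha>)) F \<le> h2_norm N h" if "h2_coeffs N h e" "finite F" "F \<subseteq> multi_idx N" for h e F
    unfolding L2_set_def using that
    by (intro real_le_lsqrt h2_norm_nonneg finite_sum_le_has_sum[OF h2_coeffs_has_sum_norm]) auto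
  have finite_le: "(\<Sum>\<alpha>\<in>F. (cmod (?ab \<alpha>))\<^sup>2) \<le> (h2_norm N f + h2_norm N g)\<^sup>2"
    if F_finite: "finite F" "F \<subseteq> multi_idx N" for F
  proof -
    have "L2_set (\<lambda>\<alpha>. cmod (?ab \<alpha>)) F \<le> L2_set (\<lambda>\<alpha>. cmod (a \<alpha>) + cmod (b \<alpha>)) F"
      by (intro L2_set_mono norm_triangle_ineq) auto
    also have "\<dots> \<le> L2_set (\<lambda>\<alpha>. cmod (a \<alpha>)) F + L2_set (\<lambda>\<alpha>. cmod (b \<alpha>)) F"
      by (rule L2_set_triangle_ineq)
    also have "\<dots> \<le> h2_norm N f + h2_norm N g"
      by (intro add_mono L2_le a_coeffs b_coeffs F_finite)
    finally show ?thesis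
      unfolding L2_set_def by (rule sqrt_le_D)
  qed
  have summable: "(\<lambda>\<alpha>. (cmod (?ab \<alpha>))\<^sup>2) summable_on multi_idx N"
    using finite_le by (intro nonneg_bdd_above_summable_on bdd_aboveI2) auto
  have "((\<lambda>\<alpha>. ?ab \<alpha> * monom N z \<alpha>) has_sum f z + g z) (multi_idx N)" if "z \<in> polydisk N" for z
    unfolding distrib_right using a_coeffs b_coeffs that by (intro has_sum_add) (auto simp: h2_coeffs_def)
  then have sum_coeffs: "h2_coeffs N (\<lambda>z. f z + g z) ?ab"
    using a_coeffs b_coeffs summable by (auto simp: h2_coeffs_def)
  then show "(\<lambda>z. f z + g z) \<in> H2 N"
    by (auto simp: H2_def)
  have "(h2_norm N (\<lambda>z. f z + g z))\<^sup>2 \<le> (h2_norm N f + h2_norm N g)\<^sup>2"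
    unfolding infsumI[OF h2_coeffs_has_sum_norm[OF sum_coeffs], symmetric]
    by (rule infsum_le_finite_sums[OF summable finite_le])
  then show "h2_norm N (\<lambda>z. f z + g z) \<le> h2_norm N f + h2_norm N g"
    by (rule power2_le_imp_le) (simp add: h2_norm_nonneg)
qed

lemma h2_norm_triangle_diff:
  assumes "f \<in> H2 N" "g \<in> H2 N"
  shows "(\<lambda>z. f z - g z) \<in> H2 N" and "h2_norm N (\<lambda>z. f z - g z) \<le> h2_norm N f + h2_norm N g"
  using h2_norm_triangle[OF assms(1) h2_norm_scale(1)[OF assms(2), of "-1"]] h2_norm_scale(2)[OF assms(2), of "-1"]
  by simp_all

definition szego_kernel :: "nat \<Rightarrow> (nat \<Rightarrow> complex) \<Rightarrow> (nat \<Rightarrow> complex) \<Rightarrow> complex" where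
  "szego_kernel N w z = (\<Prod>i<N. 1 / (1 - cnj (w i) * z i))"

lemma monom_square_has_sum:
  assumes "w \<in> polydisk N"
  shows "((\<lambda>\<alpha>. (cmod (monom N w \<alpha>))\<^sup>2) has_sum (\<Prod>i<N. 1 / (1 - (cmod (w i))\<^sup>2))) (multi_idx N)"
proof -
  have "norm ((cmod (w i))\<^sup>2) < 1" if "i < N" for i
    using assms that by (simp add: polydisk_def power_less_one_iff)
  then have "((\<lambda>\<alpha>. \<Prod>i<N. ((cmod (w i))\<^sup>2) ^ \<alpha> i) has_sum (\<Prod>i<N. 1 / (1 - (cmod (w i))\<^sup>2))) (multi_idx N)"
    by (intro has_sum_prod_multi_idx[THEN conjunct1] geometric_has_sum)
  then show ?thesis
    by (simp add: monom_def norm_power prod_power_distrib mult.commute flip: prod_norm power_mult)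
qed

lemma szego_kernel_h2:
  assumes w_polydisk: "w \<in> polydisk N"
  shows "szego_kernel N w \<in> H2 N" and "(h2_norm N (szego_kernel N w))\<^sup>2 = (\<Prod>i<N. 1 / (1 - (cmod (w i))\<^sup>2))"
proof -
  define k where "k \<alpha> = (if \<alpha> \<in> multi_idx N then cnj (monom N w \<alpha>) else 0)" for \<alpha>
  have coeffs_square_has_sum: "((\<lambda>\<alpha>. (cmod (k \<alpha>))\<^sup>2) has_sum (\<Prod>i<N. 1 / (1 - (cmod (w i))\<^sup>2))) (multi_idx N)"
    using monom_square_has_sum[OF w_polydisk] by (simp add: k_def cong: has_sum_cong)
  have k_coeffs: "h2_coeffs N (szego_kernel N w) k"
    unfolding h2_coeffs_def
  proof (intro conjI ballI)
    show "(\<lambda>\<alpha>. (cmod (k \<alpha>))\<^sup>2) summable_on multi_idx N"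
      using coeffs_square_has_sum by (rule has_sum_imp_summable)
    fix z assume z_polydisk: "z \<in> polydisk N"
    have "cmod (cnj (w i) * z i) < 1" if "i < N" for i
      using w_polydisk z_polydisk that norm_mult_less[of "cnj (w i)" 1 "z i" 1] by (simp add: polydisk_def)
    then have "((\<lambda>\<alpha>. \<Prod>i<N. (cnj (w i) * z i) ^ \<alpha> i) has_sum szego_kernel N w z) (multi_idx N)"
      unfolding szego_kernel_def by (intro has_sum_prod_multi_idx[THEN conjunct1] geometric_has_sum)
    then show "((\<lambda>\<alpha>. k \<alpha> * monom N z \<alpha>) has_sum szego_kernel N w z) (multi_idx N)"
      by (simp add: k_def monom_def power_mult_distrib prod.distrib cong: has_sum_cong)
  qed (simp add: k_def)
  then show "szego_kernel N w \<in> H2 N"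
    by (auto simp: H2_def)
  show "(h2_norm N (szego_kernel N w))\<^sup>2 = (\<Prod>i<N. 1 / (1 - (cmod (w i))\<^sup>2))"
    using h2_coeffs_has_sum_norm[OF k_coeffs] coeffs_square_has_sum by (rule has_sum_unique)
qed

lemma h2_pointwise_bound:
  assumes f_H2: "f \<in> H2 N" and z_polydisk: "z \<in> polydisk N"
  shows "(cmod (f z))\<^sup>2 \<le> (h2_norm N f)\<^sup>2 * (\<Prod>i<N. 1 / (1 - (cmod (z i))\<^sup>2))"
proof -
  obtain a where a_coeffs: "h2_coeffs N f a"
    using f_H2 by (auto simp: H2_def)
  have "f z = (\<Sum>\<^sub>\<infinity>\<alpha>\<in>multi_idx N. a \<alpha> * monom N z \<alpha>)"
    using a_coeffs z_polydisk by (intro infsumI[symmetric]) (simp add: h2_coeffs_def)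
  then show ?thesis
    using abs_summable_on_Cauchy_Schwarz(2)[OF has_sum_imp_summable has_sum_imp_summable,
        OF h2_coeffs_has_sum_norm[OF a_coeffs] monom_square_has_sum[OF z_polydisk]]
    by (simp add: infsumI[OF h2_coeffs_has_sum_norm[OF a_coeffs]] infsumI[OF monom_square_has_sum[OF z_polydisk]])
qed

definition first_axis :: "'a \<Rightarrow> nat \<Rightarrow> 'a::zero" where
  "first_axis x = (\<lambda>_. 0)(0 := x)"

lemma inj_first_axis: "inj first_axis"
  by (rule injI) (auto simp: first_axis_def fun_eq_iff split: if_splits)

lemma first_axis_multi_idx: "1 \<le> N \<Longrightarrow> first_axis n \<in> multi_idx N"
  by (auto simp: first_axis_def multi_idx_def)

lemma has_sum_first_axis:
  fixes f :: "(nat \<Rightarrow> nat) \<Rightarrow> 'a::{topological_comm_monoid_add,t2_space}"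
  assumes N_ge_1: "1 \<le> N" and f_has_sum: "((\<lambda>n. f (first_axis n)) has_sum S) UNIV"
    and off_axis: "\<And>\<alpha>. \<alpha> \<notin> range first_axis \<Longrightarrow> f \<alpha> = 0"
  shows "(f has_sum S) (multi_idx N)"
proof -
  have "(f has_sum S) (range first_axis)"
    using f_has_sum has_sum_reindex[OF inj_first_axis, of f S] by (simp add: comp_def)
  then show ?thesis
    by (rule has_sum_cong_neutral[THEN iffD1, rotated -1]) (use off_axis first_axis_multi_idx[OF N_ge_1] in auto)
qed

lemma monom_first_axis:
  assumes "1 \<le> N"
  shows "monom N z (first_axis n) = z 0 ^ n"
proof -
  have "monom N z (first_axis n) = (\<Prod>i<N. if i = 0 then z 0 ^ n else 1)"
    unfolding monom_def first_axis_def by (rule prod.cong) auto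
  then show ?thesis
    using assms by (simp add: prod.delta)
qed

lemma first_axis_polydisk: "cmod x < 1 \<Longrightarrow> first_axis x \<in> polydisk N"
  by (simp add: first_axis_def polydisk_def)

lemma prod_first_axis_one_minus_square:
  assumes "1 \<le> N"
  shows "(\<Prod>i<N. 1 / (1 - (cmod (first_axis x i))\<^sup>2)) = 1 / (1 - (cmod x)\<^sup>2)"
proof -
  have "(\<Prod>i<N. 1 / (1 - (cmod (first_axis x i))\<^sup>2)) = (\<Prod>i<N. if i = 0 then 1 / (1 - (cmod x)\<^sup>2) else 1)"
    by (intro prod.cong) (auto simp: first_axis_def)
  then show ?thesis
    using assms by (simp add: prod.delta)
qed

lemma h2_first_variable:
  assumes N_ge_1: "1 \<le> N" and c_ell2: "c \<in> ell2"
    and F_eq: "\<And>z. z \<in> polydisk N \<Longrightarrow> F z = power_series c (z 0)"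
  shows "F \<in> H2 N" and "(h2_norm N F)\<^sup>2 = ell2_sqnorm c"
proof -
  define a where "a \<alpha> = (if \<alpha> \<in> range first_axis then c (\<alpha> 0) else 0)" for \<alpha>
  have a_first_axis: "a (first_axis n) = c n" for n
    by (simp add: a_def) (simp add: first_axis_def)
  have coeffs_square_has_sum: "((\<lambda>\<alpha>. (cmod (a \<alpha>))\<^sup>2) has_sum ell2_sqnorm c) (multi_idx N)"
    using ell2_has_sum[OF c_ell2] by (intro has_sum_first_axis[OF N_ge_1]) (simp_all add: a_first_axis, simp add: a_def)
  have coeffs: "h2_coeffs N F a"
    unfolding h2_coeffs_def
  proof (intro conjI ballI allI impI)
    show "a \<alpha> = 0" if "\<alpha> \<notin> multi_idx N" for \<alpha>
      using that first_axis_multi_idx[OF N_ge_1] by (auto simp: a_def)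
    show "(\<lambda>\<alpha>. (cmod (a \<alpha>))\<^sup>2) summable_on multi_idx N"
      using coeffs_square_has_sum by (rule has_sum_imp_summable)
    fix z assume z_polydisk: "z \<in> polydisk N"
    then have "((\<lambda>n. c n * z 0 ^ n) has_sum F z) UNIV"
      using N_ge_1 by (simp add: F_eq power_series_sums(2)[OF c_ell2] polydisk_def)
    then show "((\<lambda>\<alpha>. a \<alpha> * monom N z \<alpha>) has_sum F z) (multi_idx N)"
      by (intro has_sum_first_axis[OF N_ge_1]) (simp_all add: a_first_axis monom_first_axis[OF N_ge_1], simp add: a_def)
  qed
  then show "F \<in> H2 N"
    by (auto simp: H2_def)
  show "(h2_norm N F)\<^sup>2 = ell2_sqnorm c"
    using h2_coeffs_has_sum_norm[OF coeffs] coeffs_square_has_sum by (rule has_sum_unique)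
qed

section \<open>Operators on the Hardy space of the polydisk\<close>

lemma zero_in_H2: "(\<lambda>_. 0) \<in> H2 N" "h2_norm N (\<lambda>_. 0) = 0"
  using h2_norm_scale[of "szego_kernel N (\<lambda>_. 0)" N 0] szego_kernel_h2(1)[of "\<lambda>_. 0" N]
  by (simp_all add: polydisk_def)

lemma bounded_on_H2_if_sq_bound:
  assumes "\<And>f. f \<in> H2 N \<Longrightarrow> T f \<in> H2 N"
    and "\<And>f. f \<in> H2 N \<Longrightarrow> (h2_norm N (T f))\<^sup>2 \<le> C * (h2_norm N f)\<^sup>2"
  shows "bounded_on_H2 N T"
proof -
  have "h2_norm N (T f) \<le> sqrt C * h2_norm N f" if "f \<in> H2 N" for f
    using real_le_rsqrt[OF assms(2)[OF that]] h2_norm_nonneg[of N f] by (simp add: real_sqrt_mult)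
  with assms(1) show ?thesis
    unfolding bounded_on_H2_def by blast
qed

lemma bounded_on_H2_diff:
  assumes T_bounded: "bounded_on_H2 N T" and R_bounded: "bounded_on_H2 N R"
  shows "bounded_on_H2 N (\<lambda>f z. T f z - R f z)"
proof -
  obtain C D where C_bound: "\<And>f. f \<in> H2 N \<Longrightarrow> h2_norm N (T f) \<le> C * h2_norm N f"
    and D_bound: "\<And>f. f \<in> H2 N \<Longrightarrow> h2_norm N (R f) \<le> D * h2_norm N f"
    using T_bounded R_bounded unfolding bounded_on_H2_def by blast
  have images_H2: "T f \<in> H2 N" "R f \<in> H2 N" if "f \<in> H2 N" for f
    using that T_bounded R_bounded unfolding bounded_on_H2_def by blast+
  have "h2_norm N (\<lambda>z. T f z - R f z) \<le> (C + D) * h2_norm N f" if "f \<in> H2 N" for f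
    using h2_norm_triangle_diff(2)[OF images_H2[OF that]] C_bound[OF that] D_bound[OF that] by (simp add: distrib_right)
  moreover have "(\<lambda>z. T f z - R f z) \<in> H2 N" if "f \<in> H2 N" for f
    by (rule h2_norm_triangle_diff(1)[OF images_H2[OF that]])
  ultimately show ?thesis
    unfolding bounded_on_H2_def by blast
qed

lemma op_norm_nonneg:
  assumes "bounded_on_H2 N T"
  shows "0 \<le> op_norm N T"
proof -
  obtain C where C_bound: "\<And>f. f \<in> H2 N \<Longrightarrow> h2_norm N (T f) \<le> C * h2_norm N f"
    using assms unfolding bounded_on_H2_def by blast
  have "bdd_above ((\<lambda>f. h2_norm N (T f)) ` {f \<in> H2 N. h2_norm N f \<le> 1})"
  proof (rule bdd_aboveI2)
    fix f assume "f \<in> {f \<in> H2 N. h2_norm N f \<le> 1}"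
    then have "C * h2_norm N f \<le> \<bar>C\<bar> * 1" "h2_norm N (T f) \<le> C * h2_norm N f"
      using C_bound h2_norm_nonneg[of N f] by (auto intro!: mult_mono simp del: mult_1_right)
    then show "h2_norm N (T f) \<le> \<bar>C\<bar>" by linarith
  qed
  then show ?thesis
    unfolding op_norm_def
    by (rule cSup_upper2[rotated 2, OF _ imageI[of "\<lambda>_. 0"]]) (simp_all add: zero_in_H2 h2_norm_nonneg)
qed

lemma approx_num_le:
  assumes T_bounded: "bounded_on_H2 N T"
    and R_finite_rank: "linear_on_H2 N R" "bounded_on_H2 N R" "rank_less N R n"
    and error_le: "\<And>f. f \<in> H2 N \<Longrightarrow> h2_norm N f \<le> 1 \<Longrightarrow> h2_norm N (\<lambda>z. T f z - R f z) \<le> e"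
  shows "approx_num N T n \<le> e"
proof -
  have "approx_num N T n \<le> op_norm N (\<lambda>f z. T f z - R f z)"
    unfolding approx_num_def
  proof (rule cInf_lower)
    show "bdd_below {op_norm N (\<lambda>f z. T f z - R f z) |R. linear_on_H2 N R \<and> bounded_on_H2 N R \<and> rank_less N R n}"
      by (rule bdd_belowI[of _ 0]) (auto intro!: op_norm_nonneg bounded_on_H2_diff T_bounded)
  qed (use R_finite_rank in blast)
  also have "\<dots> \<le> e"
    unfolding op_norm_def by (rule cSup_least) (use error_le zero_in_H2 in \<open>auto intro!: exI[of _ "\<lambda>_. 0"]\<close>)
  finally show ?thesis .
qed

lemma compact_on_H2_eventually_small:
  assumes T_compact: "compact_on_H2 N T"
    and u_unit_ball: "\<And>k. u k \<in> H2 N" "\<And>k. h2_norm N (u k) \<le> 1"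
    and null: "\<And>z. z \<in> polydisk N \<Longrightarrow> (\<lambda>k. T (u k) z) \<longlonglongrightarrow> 0"
    and e_pos: "0 < e"
  shows "\<exists>m. \<forall>z\<in>polydisk N. (cmod (T (u m) z))\<^sup>2 \<le> e\<^sup>2 * (\<Prod>i<N. 1 / (1 - (cmod (z i))\<^sup>2))"
proof -
  obtain \<rho> :: "nat \<Rightarrow> nat" and M where \<rho>_mono: "strict_mono \<rho>"
    and Cauchy: "\<And>m n. m \<ge> M \<Longrightarrow> n \<ge> M \<Longrightarrow> h2_norm N (\<lambda>z. T (u (\<rho> m)) z - T (u (\<rho> n)) z) < e"
    using T_compact u_unit_ball e_pos unfolding compact_on_H2_def by meson
  have Tu_H2: "T (u k) \<in> H2 N" for k
    using T_compact u_unit_ball unfolding compact_on_H2_def by blast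
  show ?thesis
  proof (intro exI ballI)
    fix z assume z_polydisk: "z \<in> polydisk N"
    let ?P = "\<Prod>i<N. 1 / (1 - (cmod (z i))\<^sup>2)"
    have P_nonneg: "0 \<le> ?P"
      using z_polydisk by (intro prod_nonneg) (auto simp: polydisk_def abs_square_le_1 less_imp_le)
    have "(cmod (T (u (\<rho> M)) z - T (u (\<rho> n)) z))\<^sup>2 \<le> e\<^sup>2 * ?P" if "n \<ge> M" for n
    proof -
      have "(cmod (T (u (\<rho> M)) z - T (u (\<rho> n)) z))\<^sup>2 \<le> (h2_norm N (\<lambda>z. T (u (\<rho> M)) z - T (u (\<rho> n)) z))\<^sup>2 * ?P"
        by (rule h2_pointwise_bound[OF h2_norm_triangle_diff(1)[OF Tu_H2 Tu_H2] z_polydisk])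
      also have "\<dots> \<le> e\<^sup>2 * ?P"
        using Cauchy[of M n] that P_nonneg by (intro mult_right_mono power_mono h2_norm_nonneg) auto
      finally show ?thesis .
    qed
    moreover have "(\<lambda>n. (cmod (T (u (\<rho> M)) z - T (u (\<rho> n)) z))\<^sup>2) \<longlonglongrightarrow> (cmod (T (u (\<rho> M)) z - 0))\<^sup>2"
      using LIMSEQ_subseq_LIMSEQ[OF null[OF z_polydisk] \<rho>_mono] by (intro tendsto_intros) (simp add: comp_def)
    ultimately show "(cmod (T (u (\<rho> M)) z))\<^sup>2 \<le> e\<^sup>2 * ?P"
      by (intro LIMSEQ_le_const2[of _ "(cmod (T (u (\<rho> M)) z))\<^sup>2"]) auto
  qed
qed

section \<open>The Cayley transform and the lens map\<close>

definition cayley :: "complex \<Rightarrow> complex" where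
  "cayley z = (1 + z) / (1 - z)"

lemma disk_Re_pos:
  assumes "cmod z < 1"
  shows "0 < Re (1 + z)" "0 < Re (1 - z)"
  using abs_Re_le_cmod[of z] assms by auto

lemma cayley_Re_pos:
  assumes z_disk: "cmod z < 1"
  shows "0 < Re (cayley z)"
proof -
  have nonzero: "1 - z \<noteq> 0" using z_disk by auto
  then have "cayley z = (1 + z) * cnj (1 - z) / of_real ((cmod (1 - z))\<^sup>2)"
    by (simp add: cayley_def complex_norm_square del: of_real_power)
  then have "Re (cayley z) = Re ((1 + z) * cnj (1 - z)) / (cmod (1 - z))\<^sup>2"
    by (simp only: Re_divide_of_real)
  also have "Re ((1 + z) * cnj (1 - z)) = 1 - (cmod z)\<^sup>2"
    unfolding cmod_power2 by (simp add: power2_eq_square algebra_simps)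
  finally show ?thesis
    using z_disk nonzero by (simp add: power_less_one_iff abs_square_less_1)
qed

lemma cayley_inverse:
  assumes "W \<noteq> - 1"
  shows "cayley ((W - 1) / (W + 1)) = W"
proof -
  have "W + 1 \<noteq> 0" using assms by (simp add: add_eq_0_iff2)
  then have "1 + (W - 1) / (W + 1) = 2 * W / (W + 1)" "1 - (W - 1) / (W + 1) = 2 / (W + 1)"
    by (simp_all add: field_simps)
  with \<open>W + 1 \<noteq> 0\<close> show ?thesis by (simp add: cayley_def)
qed

lemma one_minus_cmod_cayley_inverse_square:
  assumes "W \<noteq> - 1"
  shows "1 - (cmod ((W - 1) / (W + 1)))\<^sup>2 = 4 * Re W / (cmod (W + 1))\<^sup>2"
proof -
  have "W + 1 \<noteq> 0" using assms by (simp add: add_eq_0_iff2)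
  then have "1 - (cmod ((W - 1) / (W + 1)))\<^sup>2 = ((cmod (W + 1))\<^sup>2 - (cmod (W - 1))\<^sup>2) / (cmod (W + 1))\<^sup>2"
    unfolding norm_divide power_divide by (simp add: divide_simps)
  also have "(cmod (W + 1))\<^sup>2 - (cmod (W - 1))\<^sup>2 = 4 * Re W"
    unfolding cmod_power2 by (simp add: power2_eq_square algebra_simps)
  finally show ?thesis .
qed

lemma cmod_cayley_ge:
  assumes z_disk: "cmod z < 1"
  shows "cmod (1 - z\<^sup>2) / 4 \<le> cmod (cayley z)" and "cmod (1 - z\<^sup>2) / 4 \<le> 1 / cmod (cayley z)"
proof -
  have factor: "cmod (1 - z\<^sup>2) = cmod (1 - z) * cmod (1 + z)"
    by (simp add: norm_mult[symmetric] power2_eq_square algebra_simps)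
  have "cmod (1 - z) \<le> 2" "cmod (1 + z) \<le> 2"
    using z_disk norm_triangle_ineq4[of 1 z] norm_triangle_ineq[of 1 z] by auto
  then have squares: "(cmod (1 - z))\<^sup>2 \<le> 4" "(cmod (1 + z))\<^sup>2 \<le> 4"
    using power_mono[of "cmod (1 - z)" 2 2] power_mono[of "cmod (1 + z)" 2 2] by simp_all
  have factors_pos: "0 < cmod (1 - z)" "0 < cmod (1 + z)"
    using disk_Re_pos[OF z_disk] by (auto simp: complex_eq_iff)
  have "cmod (1 + z) * (cmod (1 - z))\<^sup>2 \<le> cmod (1 + z) * 4" "cmod (1 - z) * (cmod (1 + z))\<^sup>2 \<le> cmod (1 - z) * 4"
    using squares by (intro mult_left_mono; simp)+
  with factors_pos show "cmod (1 - z\<^sup>2) / 4 \<le> cmod (cayley z)" "cmod (1 - z\<^sup>2) / 4 \<le> 1 / cmod (cayley z)"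
    unfolding factor by (simp_all add: cayley_def norm_divide pos_le_divide_eq power2_eq_square mult_ac)
qed

lemma cos_half_pi_mult_pos: "0 < \<theta> \<Longrightarrow> \<theta> < 1 \<Longrightarrow> 0 < cos (pi * \<theta> / 2)"
  by (intro cos_gt_zero_pi) (auto simp: field_simps intro: order.strict_trans[of _ 0])

lemma cmod_powr_of_real: "cmod (z powr of_real \<theta>) = cmod z powr \<theta>"
  by (simp add: powr_def)

context
  fixes Z :: complex and \<theta> :: real
  assumes Z_right: "0 < Re Z" and \<theta>_bounds: "0 < \<theta>" "\<theta> < 1"
begin

lemma Re_powr_right_half_plane_ge: "cos (pi * \<theta> / 2) * cmod (Z powr of_real \<theta>) \<le> Re (Z powr of_real \<theta>)"
proof -
  have "Re (Z powr of_real \<theta>) = cmod Z powr \<theta> * cos (\<theta> * Im (Ln Z))"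
    using Z_right by (auto simp: powr_def Re_exp)
  moreover have "cos (pi * \<theta> / 2) \<le> cos \<bar>\<theta> * Im (Ln Z)\<bar>"
  proof (rule cos_monotone_0_pi_le)
    show "\<bar>\<theta> * Im (Ln Z)\<bar> \<le> pi * \<theta> / 2"
      using Re_Ln_pos_lt_imp[OF Z_right] \<theta>_bounds by (simp add: abs_mult field_simps)
    show "pi * \<theta> / 2 \<le> pi"
      using \<theta>_bounds by (simp add: field_simps)
  qed simp
  ultimately show ?thesis
    by (simp add: cmod_powr_of_real mult.commute mult_left_mono)
qed

lemma Re_powr_right_half_plane_pos: "0 < Re (Z powr of_real \<theta>)"
proof (rule less_le_trans[OF _ Re_powr_right_half_plane_ge])
  have "Z \<noteq> 0"
    using Z_right by auto
  then show "0 < cos (pi * \<theta> / 2) * cmod (Z powr of_real \<theta>)"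
    using cos_half_pi_mult_pos[OF \<theta>_bounds] by simp
qed

lemma powr_powr_right_half_plane: "(Z powr of_real \<theta>) powr of_real \<eta> = Z powr of_real (\<theta> * \<eta>)"
proof -
  have "\<bar>\<theta> * Im (Ln Z)\<bar> \<le> \<bar>Im (Ln Z)\<bar>"
    using \<theta>_bounds by (simp add: abs_mult mult_left_le_one_le)
  then have "Ln (exp (of_real \<theta> * Ln Z)) = of_real \<theta> * Ln Z"
    using Re_Ln_pos_lt_imp[OF Z_right] pi_gt_zero by (intro Ln_exp) auto
  then show ?thesis
    using Z_right by (auto simp: powr_def mult_ac)
qed

end

lemma one_minus_cmod_cayley_inverse_square_ge:
  assumes sector: "0 < k" "k * cmod W \<le> Re W" and m_bounds: "0 < m" "m \<le> cmod W" "m \<le> 1 / cmod W"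
  shows "k * m \<le> 1 - (cmod ((W - 1) / (W + 1)))\<^sup>2"
proof -
  define u where "u = cmod W"
  have u_bounds: "0 < u" "m \<le> u"
    unfolding u_def using m_bounds by linarith+
  have "0 < Re W"
    using sector u_bounds mult_pos_pos[of k u] unfolding u_def by linarith
  then have W_neq: "W \<noteq> - 1" "0 < cmod (W + 1)"
    by (auto simp: complex_eq_iff)
  have "m * u \<le> 1"
    using m_bounds(3) u_bounds(1) by (simp add: u_def pos_le_divide_eq)
  moreover have "m * m \<le> m * u"
    using u_bounds m_bounds(1) by (intro mult_left_mono) auto
  ultimately have "m\<^sup>2 \<le> 1"
    by (simp add: power2_eq_square)
  then have "m \<le> 1"
    by (simp add: power_le_one_iff abs_square_le_1)
  have "m * (1 + u)\<^sup>2 = m + 2 * (m * u) + (m * u) * u"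
    by (simp add: power2_eq_square algebra_simps)
  also have "\<dots> \<le> u + 2 * (1 * u) + 1 * u"
    using u_bounds \<open>m * u \<le> 1\<close> \<open>m \<le> 1\<close> by (intro add_mono mult_left_mono mult_right_mono) auto
  finally have m_le: "m * (1 + u)\<^sup>2 \<le> 4 * u" by simp
  have "k * m * (cmod (W + 1))\<^sup>2 \<le> k * (m * (1 + u)\<^sup>2)"
    using norm_triangle_ineq[of W 1] sector m_bounds unfolding mult.assoc
    by (intro mult_left_mono power_mono) (auto simp: u_def add.commute)
  also have "\<dots> \<le> k * (4 * u)"
    using m_le sector by (intro mult_left_mono) auto
  also have "\<dots> \<le> 4 * Re W"
    using sector by (simp add: u_def)
  finally show ?thesis
    unfolding one_minus_cmod_cayley_inverse_square[OF W_neq(1)] using W_neq(2) by (simp add: pos_le_divide_eq)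
qed

lemma lens_cayley:
  assumes z_disk: "cmod z < 1"
  shows "lens \<theta> z = (cayley z powr of_real \<theta> - 1) / (cayley z powr of_real \<theta> + 1)"
proof -
  have nonzero: "1 + z \<noteq> 0" "1 - z \<noteq> 0" "cayley z \<noteq> 0"
    using disk_Re_pos[OF z_disk] cayley_Re_pos[OF z_disk] by (auto simp: complex_eq_iff)
  have "\<bar>Im (Ln (cayley z))\<bar> < pi / 2" "\<bar>Im (Ln (1 - z))\<bar> < pi / 2"
    using disk_Re_pos[OF z_disk] cayley_Re_pos[OF z_disk] Re_Ln_pos_lt_imp by blast+
  then have "Ln (cayley z * (1 - z)) = Ln (cayley z) + Ln (1 - z)"
    using nonzero by (intro Ln_times_simple) auto
  moreover have "cayley z * (1 - z) = 1 + z"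
    using nonzero by (simp add: cayley_def)
  ultimately have "(1 + z) powr of_real \<theta> = cayley z powr of_real \<theta> * (1 - z) powr of_real \<theta>"
    using nonzero by (simp add: powr_def exp_add[symmetric] distrib_left)
  then have "lens \<theta> z = ((cayley z powr of_real \<theta> - 1) * (1 - z) powr of_real \<theta>) /
      ((cayley z powr of_real \<theta> + 1) * (1 - z) powr of_real \<theta>)"
    unfolding lens_def by (simp add: algebra_simps)
  then show ?thesis
    using nonzero by simp
qed

definition lens_gap :: "real \<Rightarrow> real" where
  "lens_gap \<theta> = cos (pi * \<theta> / 2) / 4"

context
  fixes \<theta> :: real
  assumes \<theta>_bounds: "0 < \<theta>" "\<theta> < 1"
begin

lemma lens_gap_pos: "0 < lens_gap \<theta>"
  using cos_half_pi_mult_pos[OF \<theta>_bounds] by (simp add: lens_gap_def)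

lemma cayley_powr_neq:
  assumes z_disk: "cmod z < 1"
  shows "cayley z powr of_real \<theta> \<noteq> - 1"
  using Re_powr_right_half_plane_pos[OF cayley_Re_pos[OF z_disk] \<theta>_bounds] by auto

lemma cayley_lens:
  assumes z_disk: "cmod z < 1"
  shows "cayley (lens \<theta> z) = cayley z powr of_real \<theta>"
  unfolding lens_cayley[OF z_disk] by (rule cayley_inverse cayley_powr_neq z_disk)+

lemma cmod_cayley_lens:
  assumes z_disk: "cmod z < 1"
  shows "cmod (cayley (lens \<theta> z)) = cmod (cayley z) powr \<theta>"
  by (simp add: cayley_lens[OF z_disk] cmod_powr_of_real)

lemma cmod_cayley_lens_ge:
  assumes z_disk: "cmod z < 1" and s_bounds: "0 < s" "s \<le> cmod (1 - z\<^sup>2)"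
  shows "(s / 4) powr \<theta> \<le> cmod (cayley (lens \<theta> z))" and "(s / 4) powr \<theta> \<le> 1 / cmod (cayley (lens \<theta> z))"
proof -
  have quarter_le: "s / 4 \<le> cmod (cayley z)" "s / 4 \<le> 1 / cmod (cayley z)"
    using cmod_cayley_ge[OF z_disk] s_bounds by linarith+
  show "(s / 4) powr \<theta> \<le> cmod (cayley (lens \<theta> z))"
    unfolding cmod_cayley_lens[OF z_disk] using quarter_le s_bounds \<theta>_bounds by (intro powr_mono2) auto
  have "(s / 4) powr \<theta> \<le> (1 / cmod (cayley z)) powr \<theta>"
    using quarter_le s_bounds \<theta>_bounds by (intro powr_mono2) auto
  then show "(s / 4) powr \<theta> \<le> 1 / cmod (cayley (lens \<theta> z))"
    unfolding cmod_cayley_lens[OF z_disk] by (simp add: powr_divide)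
qed

lemma lens_gap_le:
  assumes z_disk: "cmod z < 1" and s_bounds: "0 < s" "s \<le> cmod (1 - z\<^sup>2)"
  shows "lens_gap \<theta> * s powr \<theta> \<le> 1 - (cmod (lens \<theta> z))\<^sup>2"
proof -
  let ?k = "cos (pi * \<theta> / 2)"
  note k = cos_half_pi_mult_pos[OF \<theta>_bounds]
  have "4 powr \<theta> \<le> (4::real) powr 1"
    using \<theta>_bounds by (intro powr_mono) auto
  then have "s powr \<theta> / 4 \<le> s powr \<theta> / 4 powr \<theta>"
    by (intro divide_left_mono) auto
  then have "lens_gap \<theta> * s powr \<theta> \<le> ?k * (s / 4) powr \<theta>"
    using k s_bounds mult_left_mono[of "s powr \<theta> / 4" "s powr \<theta> / 4 powr \<theta>" ?k]
    by (simp add: lens_gap_def powr_divide)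
  also have "\<dots> \<le> 1 - (cmod (lens \<theta> z))\<^sup>2"
    unfolding lens_cayley[OF z_disk]
    by (rule one_minus_cmod_cayley_inverse_square_ge[OF k
          Re_powr_right_half_plane_ge[OF cayley_Re_pos[OF z_disk] \<theta>_bounds] _
          cmod_cayley_lens_ge[OF z_disk s_bounds, unfolded cayley_lens[OF z_disk]]])
       (use s_bounds in simp)
  finally show ?thesis .
qed

lemma lens_in_disk:
  assumes z_disk: "cmod z < 1"
  shows "cmod (lens \<theta> z) < 1"
proof -
  have "1 - (cmod (lens \<theta> z))\<^sup>2 = 4 * Re (cayley z powr of_real \<theta>) / (cmod (cayley z powr of_real \<theta> + 1))\<^sup>2"
    unfolding lens_cayley[OF z_disk] by (rule one_minus_cmod_cayley_inverse_square[OF cayley_powr_neq[OF z_disk]])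
  also have "\<dots> > 0"
    using Re_powr_right_half_plane_pos[OF cayley_Re_pos[OF z_disk] \<theta>_bounds] cayley_powr_neq[OF z_disk]
    by (auto simp: add_eq_0_iff2)
  finally show ?thesis
    by (simp add: abs_square_less_1)
qed

lemma lens_lens:
  assumes z_disk: "cmod z < 1"
  shows "lens \<eta> (lens \<theta> z) = lens (\<theta> * \<eta>) z"
  unfolding lens_cayley[OF lens_in_disk[OF z_disk]] cayley_lens[OF z_disk]
    powr_powr_right_half_plane[OF cayley_Re_pos[OF z_disk] \<theta>_bounds] by (rule lens_cayley[OF z_disk, symmetric])

lemma lens_holomorphic: "lens \<theta> holomorphic_on ball 0 1"
proof -
  have "(\<lambda>z. (cayley z powr of_real \<theta> - 1) / (cayley z powr of_real \<theta> + 1)) holomorphic_on ball 0 1"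
  proof (intro holomorphic_intros)
    show "cayley holomorphic_on ball 0 1" "cayley holomorphic_on ball 0 1"
      unfolding cayley_def[abs_def] by (intro holomorphic_intros; auto)+
    show "cayley z \<notin> \<real>\<^sub>\<le>\<^sub>0" if "z \<in> ball 0 1" for z
      using cayley_Re_pos[of z] that by (auto simp: complex_nonpos_Reals_iff)
    then show "cayley z \<notin> \<real>\<^sub>\<le>\<^sub>0" if "z \<in> ball 0 1" for z
      using that .
    show "cayley z powr of_real \<theta> + 1 \<noteq> 0" if "z \<in> ball 0 1" for z
      using cayley_powr_neq[of z] that by (auto simp: add_eq_0_iff2)
  qed
  then show ?thesis
    by (rule holomorphic_transform) (simp add: lens_cayley)
qed

lemma holomorphic_compose_lens:
  assumes "g holomorphic_on ball 0 1"
  shows "(\<lambda>z. g (lens \<theta> z)) holomorphic_on ball 0 1"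
proof -
  have "lens \<theta> ` ball 0 1 \<subseteq> ball 0 1"
    using lens_in_disk by auto
  then show ?thesis
    using holomorphic_on_compose_gen[OF lens_holomorphic assms] by (simp add: comp_def)
qed

lemma lens_of_real:
  assumes s_bounds: "0 \<le> s" "s < 1"
  obtains r where "lens \<theta> (of_real s) = of_real r" "0 \<le> r" "r < 1" "1 - r\<^sup>2 \<le> 4 * (1 - s\<^sup>2) powr \<theta>"
proof -
  define x where "x = (1 + s) / (1 - s)"
  define u where "u = x powr \<theta>"
  define r where "r = (u - 1) / (u + 1)"
  have x_ge_1: "1 \<le> x"
    using s_bounds by (simp add: x_def)
  then have u_ge_1: "1 \<le> u"
    using \<theta>_bounds by (simp add: u_def ge_one_powr_ge_zero)
  have "cayley (of_real s) = of_real x"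
    by (simp add: cayley_def x_def)
  then have "cayley (of_real s) powr of_real \<theta> = of_real u"
    using x_ge_1 by (simp add: u_def powr_of_real)
  then have lens_eq: "lens \<theta> (of_real s) = of_real r"
    using s_bounds by (simp add: lens_cayley r_def)
  have "1 - r\<^sup>2 = 4 * u / (u + 1)\<^sup>2"
    using u_ge_1 by (simp add: r_def power_divide divide_simps) (simp add: power2_eq_square algebra_simps)
  also have "\<dots> \<le> 4 * u / u\<^sup>2"
    using u_ge_1 by (intro divide_left_mono power_mono mult_pos_pos) auto
  also have "\<dots> = 4 * (1 / x) powr \<theta>"
    using u_ge_1 x_ge_1 by (simp add: u_def power2_eq_square powr_divide)
  also have "\<dots> \<le> 4 * (1 - s\<^sup>2) powr \<theta>"
  proof -
    have "1 * (1 - s) \<le> (1 + s) * (1 + s) * (1 - s)"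
      using s_bounds by (intro mult_right_mono) (auto simp: algebra_simps)
    then have "1 - s \<le> (1 - s\<^sup>2) * (1 + s)"
      by (simp add: power2_eq_square algebra_simps)
    then have "1 / x \<le> 1 - s\<^sup>2"
      using s_bounds by (simp add: x_def pos_divide_le_eq)
    then show ?thesis
      using x_ge_1 \<theta>_bounds by (intro mult_left_mono powr_mono2) auto
  qed
  finally show ?thesis
    using lens_eq u_ge_1 that[of r] by (simp add: r_def)
qed

end

section \<open>Restriction to the diagonal\<close>

definition level :: "nat \<Rightarrow> nat \<Rightarrow> (nat \<Rightarrow> nat) set" where
  "level N d = {\<alpha> \<in> multi_idx N. (\<Sum>i<N. \<alpha> i) = d}"

lemma finite_level_card_le:
  assumes N_ge_1: "N \<ge> 1"
  shows "finite (level N d)" and "card (level N d) \<le> (d + 1) ^ (N - 1)"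
proof -
  obtain M where N_eq: "N = Suc M" using N_ge_1 by (cases N) auto
  let ?P = "PiE {..<M} (\<lambda>_. {..d})" and ?r = "\<lambda>\<alpha>. restrict \<alpha> {..<M}"
  have restrict_inj: "inj_on ?r (level N d)"
  proof (rule inj_onI)
    fix \<alpha> \<beta> assume \<alpha>_level: "\<alpha> \<in> level N d" and \<beta>_level: "\<beta> \<in> level N d" and restrict_eq: "?r \<alpha> = ?r \<beta>"
    have agree_below: "\<alpha> i = \<beta> i" if "i < M" for i
      using fun_cong[OF restrict_eq, of i] that by simp
    then have "(\<Sum>i<M. \<alpha> i) = (\<Sum>i<M. \<beta> i)" by (intro sum.cong) auto
    then have "\<alpha> M = \<beta> M" using \<alpha>_level \<beta>_level by (auto simp: level_def N_eq)
    moreover have "\<alpha> i = \<beta> i" if "i > M" for i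
      using that \<alpha>_level \<beta>_level by (auto simp: level_def multi_idx_def N_eq)
    ultimately show "\<alpha> = \<beta>" using agree_below by (metis ext linorder_neqE_nat)
  qed
  have restrict_subset: "?r ` level N d \<subseteq> ?P"
  proof (intro image_subsetI restrict_PiE_iff[THEN iffD2] ballI)
    fix \<alpha> i assume "\<alpha> \<in> level N d" "i \<in> {..<M}"
    then show "\<alpha> i \<in> {..d}"
      using member_le_sum[of i "{..<N}" \<alpha>] by (auto simp: level_def N_eq)
  qed
  have finite_PiE: "finite ?P" by (intro finite_PiE) auto
  show "finite (level N d)"
    by (rule inj_on_finite[OF restrict_inj restrict_subset finite_PiE])
  have "card (level N d) \<le> card ?P"
    by (rule card_inj_on_le[OF restrict_inj restrict_subset finite_PiE])
  then show "card (level N d) \<le> (d + 1) ^ (N - 1)"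
    by (simp add: card_PiE N_eq)
qed

lemma has_sum_levels:
  fixes f :: "(nat \<Rightarrow> nat) \<Rightarrow> 'a :: banach"
  assumes N_ge_1: "N \<ge> 1" and f_has_sum: "(f has_sum S) (multi_idx N)"
  shows "(\<lambda>d. \<Sum>\<alpha>\<in>level N d. f \<alpha>) sums S"
proof (rule has_sum_imp_sums, rule has_sum_SigmaD)
  have "bij_betw snd (Sigma UNIV (level N)) (multi_idx N)"
    by (rule bij_betw_byWitness[where f' = "\<lambda>\<alpha>. (\<Sum>i<N. \<alpha> i, \<alpha>)"]) (auto simp: level_def)
  from has_sum_reindex_bij_betw[OF this, of f S] f_has_sum
  show "((\<lambda>x. f (snd x)) has_sum S) (Sigma UNIV (level N))" by simp
  show "((\<lambda>y. f (snd (d, y))) has_sum (\<Sum>\<alpha>\<in>level N d. f \<alpha>)) (level N d)" for d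
    using finite_level_card_le(1)[OF N_ge_1] by (simp add: has_sum_finite)
qed

lemma monom_diag: "\<alpha> \<in> level N d \<Longrightarrow> monom N (\<lambda>_. w) \<alpha> = w ^ d"
  by (auto simp: monom_def level_def power_sum)

lemma h2_diagonal_power_series:
  assumes N_ge_1: "N \<ge> 1" and f_H2: "f \<in> H2 N"
  obtains b :: "nat \<Rightarrow> complex" where
    "\<And>w. cmod w < 1 \<Longrightarrow> (\<lambda>d. b d * w ^ d) sums f (\<lambda>_. w)"
    "summable (\<lambda>d. (cmod (b d))\<^sup>2 / real (d + 1) ^ (N - 1))"
    "(\<Sum>d. (cmod (b d))\<^sup>2 / real (d + 1) ^ (N - 1)) \<le> (h2_norm N f)\<^sup>2"
proof -
  obtain a where a_coeffs: "h2_coeffs N f a"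
    using f_H2 by (auto simp: H2_def)
  define b where "b d = (\<Sum>\<alpha>\<in>level N d. a \<alpha>)" for d
  define A where "A d = (\<Sum>\<alpha>\<in>level N d. (cmod (a \<alpha>))\<^sup>2)" for d
  have A_sums: "A sums (h2_norm N f)\<^sup>2"
    unfolding A_def by (rule has_sum_levels[OF N_ge_1 h2_coeffs_has_sum_norm[OF a_coeffs]])
  have level_le: "(cmod (b d))\<^sup>2 / real (d + 1) ^ (N - 1) \<le> A d" for d
  proof -
    have "(cmod (b d))\<^sup>2 \<le> (\<Sum>\<alpha>\<in>level N d. 1 * cmod (a \<alpha>))\<^sup>2"
      unfolding b_def using norm_sum[of a "level N d"] by (intro power_mono) auto
    also have "\<dots> \<le> (\<Sum>\<alpha>\<in>level N d. 1\<^sup>2) * A d"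
      unfolding A_def by (rule Cauchy_Schwarz_ineq_sum)
    also have "\<dots> \<le> real ((d + 1) ^ (N - 1)) * A d"
      unfolding A_def using of_nat_mono[OF finite_level_card_le(2)[OF N_ge_1, of d], where 'a = real]
      by (intro mult_right_mono sum_nonneg) auto
    finally show ?thesis
      by (simp add: pos_divide_le_eq mult.commute)
  qed
  show ?thesis
  proof
    show summable: "summable (\<lambda>d. (cmod (b d))\<^sup>2 / real (d + 1) ^ (N - 1))"
      by (rule summable_comparison_test'[OF sums_summable[OF A_sums]]) (use level_le in auto)
    show "(\<Sum>d. (cmod (b d))\<^sup>2 / real (d + 1) ^ (N - 1)) \<le> (h2_norm N f)\<^sup>2"
      using suminf_le[OF level_le summable sums_summable[OF A_sums]] sums_unique[OF A_sums] by simp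
    show "(\<lambda>d. b d * w ^ d) sums f (\<lambda>_. w)" if w_disk: "cmod w < 1" for w
    proof -
      have "(\<lambda>_. w) \<in> polydisk N"
        using w_disk by (auto simp: polydisk_def)
      then have "((\<lambda>\<alpha>. a \<alpha> * monom N (\<lambda>_. w) \<alpha>) has_sum f (\<lambda>_. w)) (multi_idx N)"
        using a_coeffs by (auto simp: h2_coeffs_def)
      from has_sum_levels[OF N_ge_1 this] show ?thesis
        by (simp add: b_def sum_distrib_right monom_diag)
    qed
  qed
qed

section \<open>Boundedness at the critical parameter\<close>

definition critical_weight :: "nat \<Rightarrow> real \<Rightarrow> real \<Rightarrow> real" where
  "critical_weight N a s = s powr (- 1 / real N) / (1 + a * s powr (1 / real N)) ^ N"

lemma critical_weight_nonneg: "0 \<le> a \<Longrightarrow> 0 \<le> critical_weight N a s"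
  by (simp add: critical_weight_def)

lemma critical_weight_antiderivative:
  assumes N_ge_2: "N \<ge> 2" and a_pos: "0 < a" and s_pos: "0 < s"
  shows "((\<lambda>s. real N / real (N - 1) * (s powr (1 / real N) / (1 + a * s powr (1 / real N))) ^ (N - 1))
    has_real_derivative critical_weight N a s) (at s)"
proof -
  define u where "u s = s powr (1 / real N)" for s
  define v where "v s = u s / (1 + a * u s)" for s
  obtain M where N_eq: "N = Suc (Suc M)"
    using N_ge_2 by (metis Suc_le_D numeral_2_eq_2 Suc_le_mono)
  have u_pos: "0 < u s"
    using s_pos by (simp add: u_def)
  then have denominator_pos: "0 < 1 + a * u s"
    using a_pos by (simp add: add_pos_pos)
  have "(u has_real_derivative (1 / real N * s powr (1 / real N - 1))) (at s)"
    unfolding u_def[abs_def] using s_pos by (auto intro!: derivative_eq_intros)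
  then have v_deriv: "(v has_real_derivative (1 / real N * s powr (1 / real N - 1) / (1 + a * u s)\<^sup>2)) (at s)"
    unfolding v_def[abs_def] using denominator_pos
    by (auto intro!: derivative_eq_intros simp: power2_eq_square algebra_simps diff_divide_distrib[symmetric])
  have "((\<lambda>s. real N / real (N - 1) * v s ^ (N - 1)) has_real_derivative (real N / real (N - 1) *
      (real (N - 1) * (1 / real N * s powr (1 / real N - 1) / (1 + a * u s)\<^sup>2) * v s ^ (N - 1 - 1)))) (at s)"
    by (auto intro!: derivative_eq_intros v_deriv)
  also have "real N / real (N - 1) *
      (real (N - 1) * (1 / real N * s powr (1 / real N - 1) / (1 + a * u s)\<^sup>2) * v s ^ (N - 1 - 1))
      = (s powr (1 / real N - 1) * u s ^ M) / ((1 + a * u s)\<^sup>2 * (1 + a * u s) ^ M)"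
    using N_eq by (simp add: v_def power_divide)
  also have "(1 + a * u s)\<^sup>2 * (1 + a * u s) ^ M = (1 + a * u s) ^ N"
    by (simp add: N_eq power2_eq_square)
  also have "s powr (1 / real N - 1) * u s ^ M = s powr (- 1 / real N)"
  proof -
    have "u s ^ M = s powr (real M * (1 / real N))"
      using u_pos by (simp add: u_def powr_powr flip: powr_realpow)
    moreover have "1 / real N - 1 + (real N - 2) * (1 / real N) = - 1 / real N"
      using N_ge_2 by (simp add: field_simps)
    moreover have "real M = real N - 2"
      using N_eq by simp
    ultimately show ?thesis
      by (simp only: powr_add[symmetric])
  qed
  finally show ?thesis
    by (simp add: v_def u_def critical_weight_def)
qed

lemma has_integral_critical_weight:
  assumes N_ge_2: "N \<ge> 2" and a_pos: "0 < a"
  obtains J where "(critical_weight N a has_integral J) {0..1}" and "J \<le> 2 / a ^ (N - 1)"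
proof
  define u where "u s = s powr (1 / real N)" for s
  define v where "v s = u s / (1 + a * u s)" for s
  define P where "P s = real N / real (N - 1) * v s ^ (N - 1)" for s
  have denominator_pos: "0 < 1 + a * u s" for s
    using a_pos by (simp add: u_def add_pos_nonneg)
  have "continuous_on {0..1} u"
    unfolding u_def[abs_def] using N_ge_2 by (intro continuous_on_powr' continuous_on_id continuous_on_const) auto
  then have "continuous_on {0..1} P"
    unfolding P_def[abs_def] v_def
    by (intro continuous_intros) (use denominator_pos in \<open>auto simp: less_imp_neq[THEN not_sym]\<close>)
  moreover have "(P has_vector_derivative critical_weight N a s) (at s)" if "s \<in> {0<..<1}" for s
    unfolding has_real_derivative_iff_has_vector_derivative[symmetric] P_def[abs_def] v_def u_def
    using that by (intro critical_weight_antiderivative N_ge_2 a_pos) simp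
  ultimately show "(critical_weight N a has_integral P 1 - P 0) {0..1}"
    by (intro fundamental_theorem_of_calculus_interior) simp_all
  have "0 \<le> v 1" "v 1 \<le> 1 / a"
    using a_pos by (simp_all add: v_def u_def field_simps)
  moreover have "real N / real (N - 1) \<le> 2"
    using N_ge_2 by (simp add: pos_divide_le_eq of_nat_diff)
  ultimately have "P 1 \<le> 2 * (1 / a) ^ (N - 1)"
    unfolding P_def by (intro mult_mono power_mono) auto
  moreover have "P 0 = 0"
    using N_ge_2 by (simp add: P_def v_def u_def)
  ultimately show "P 1 - P 0 \<le> 2 / a ^ (N - 1)"
    by (simp add: power_one_over)
qed

lemma critical_weight_le:
  assumes N_ge_1: "N \<ge> 1" and a_pos: "0 < a" and s_nonneg: "0 \<le> s"
  shows "critical_weight N a s \<le> 1 / (a ^ (N - 1) * s)"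
proof (cases "s = 0")
  case False
  define u where "u = s powr (1 / real N)"
  have u_pos: "0 < u"
    using s_nonneg False by (simp add: u_def)
  have "(a * u) ^ (N - 1) \<le> (1 + a * u) ^ (N - 1)"
    using a_pos u_pos by (intro power_mono) auto
  also have "\<dots> \<le> (1 + a * u) ^ N"
    using a_pos u_pos by (intro power_increasing) auto
  finally have "critical_weight N a s \<le> s powr (- 1 / real N) / (a * u) ^ (N - 1)"
    unfolding critical_weight_def u_def[symmetric] using a_pos u_pos s_nonneg
    by (intro divide_left_mono mult_pos_pos zero_less_power add_pos_pos) auto
  also have "\<dots> = 1 / (a ^ (N - 1) * (u ^ (N - 1) * u))"
    by (simp add: u_def power_mult_distrib powr_minus_divide)
  also have "u ^ (N - 1) * u = s"
    by (subst power_minus_mult) (use N_ge_1 s_nonneg False in \<open>simp_all add: u_def powr_powr flip: powr_realpow\<close>)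
  finally show ?thesis .
qed (simp add: critical_weight_def)

lemma has_integral_suminf_nonneg:
  fixes f :: "nat \<Rightarrow> 'a::euclidean_space \<Rightarrow> real"
  assumes f_integral: "\<And>d. (f d has_integral J d) S" and nonneg: "\<And>d s. s \<in> S \<Longrightarrow> 0 \<le> f d s"
    and summable_f: "\<And>s. s \<in> S \<Longrightarrow> summable (\<lambda>d. f d s)" and summable_J: "summable J"
  shows "((\<lambda>s. \<Sum>d. f d s) has_integral (\<Sum>d. J d)) S"
proof (rule has_integral_monotone_convergence_increasing)
  show "((\<lambda>s. \<Sum>d<D. f d s) has_integral (\<Sum>d<D. J d)) S" for D
    by (intro has_integral_sum f_integral) auto
  show "(\<Sum>d<D. f d s) \<le> (\<Sum>d<Suc D. f d s)" if "s \<in> S" for D s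
    using nonneg[OF that] by simp
  show "(\<lambda>D. \<Sum>d<D. f d s) \<longlonglongrightarrow> (\<Sum>d. f d s)" if "s \<in> S" for s
    by (rule summable_LIMSEQ[OF summable_f[OF that]])
  show "(\<lambda>D. \<Sum>d<D. J d) \<longlonglongrightarrow> (\<Sum>d. J d)"
    by (rule summable_LIMSEQ[OF summable_J])
qed

lemma has_integral_critical_weight_series:
  fixes \<beta> :: "nat \<Rightarrow> real"
  assumes N_ge_2: "N \<ge> 2" and a_pos: "0 < a" and \<beta>_nonneg: "\<And>d. 0 \<le> \<beta> d"
    and summable: "summable (\<lambda>d. \<beta> d / real (d + 1) ^ (N - 1))"
  obtains I where "\<And>s. 0 \<le> s \<Longrightarrow> summable (\<lambda>d. \<beta> d * critical_weight N (a * real (d + 1)) s)"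
    and "((\<lambda>s. \<Sum>d. \<beta> d * critical_weight N (a * real (d + 1)) s) has_integral I) {0..1}"
    and "I \<le> 2 / a ^ (N - 1) * (\<Sum>d. \<beta> d / real (d + 1) ^ (N - 1))"
proof -
  let ?W = "\<lambda>d. critical_weight N (a * real (d + 1))"
  have rate_pos: "0 < a * real (d + 1)" for d
    using a_pos by simp
  then have W_nonneg: "0 \<le> ?W d s" for d s
    by (intro critical_weight_nonneg less_imp_le)
  have "\<exists>J. (?W d has_integral J) {0..1} \<and> J \<le> 2 / (a * real (d + 1)) ^ (N - 1)" for d
    using has_integral_critical_weight[OF N_ge_2 rate_pos] by metis
  then obtain J where J_integral: "\<And>d. (?W d has_integral J d) {0..1}" "\<And>d. J d \<le> 2 / (a * real (d + 1)) ^ (N - 1)"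
    by metis
  have J_nonneg: "0 \<le> J d" for d
    by (rule has_integral_nonneg[OF J_integral(1) W_nonneg])
  have J_le: "\<beta> d * J d \<le> 2 / a ^ (N - 1) * (\<beta> d / real (d + 1) ^ (N - 1))" for d
    using mult_left_mono[OF J_integral(2)[of d] \<beta>_nonneg[of d]] unfolding power_mult_distrib by (simp add: mult_ac)
  have summable_J: "summable (\<lambda>d. \<beta> d * J d)"
    by (rule summable_comparison_test'[OF summable_mult[OF summable, of "2 / a ^ (N - 1)"]])
       (use J_le J_nonneg \<beta>_nonneg in auto)
  have summable_W: "summable (\<lambda>d. \<beta> d * ?W d s)" if s_nonneg: "0 \<le> s" for s
  proof (rule summable_comparison_test'[OF summable_mult[OF summable, of "1 / (a ^ (N - 1) * s)"]])
    fix d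
    have "?W d s \<le> 1 / ((a * real (d + 1)) ^ (N - 1) * s)"
      using N_ge_2 by (intro critical_weight_le rate_pos s_nonneg) auto
    from mult_left_mono[OF this \<beta>_nonneg[of d]]
    show "norm (\<beta> d * ?W d s) \<le> 1 / (a ^ (N - 1) * s) * (\<beta> d / real (d + 1) ^ (N - 1))"
      using \<beta>_nonneg[of d] W_nonneg by (simp add: power_mult_distrib mult_ac)
  qed
  have "((\<lambda>s. \<Sum>d. \<beta> d * ?W d s) has_integral (\<Sum>d. \<beta> d * J d)) {0..1}"
    by (intro has_integral_suminf_nonneg has_integral_mult_right J_integral mult_nonneg_nonneg \<beta>_nonneg W_nonneg
        summable_W summable_J) auto
  moreover have "(\<Sum>d. \<beta> d * J d) \<le> 2 / a ^ (N - 1) * (\<Sum>d. \<beta> d / real (d + 1) ^ (N - 1))"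
    unfolding suminf_mult[OF summable, symmetric] by (intro suminf_le J_le summable_J summable_mult summable)
  ultimately show ?thesis
    using that summable_W by blast
qed

lemma exp_neg_le_inverse_power:
  assumes "y \<ge> 0" "N \<ge> 1"
  shows "exp (- y) \<le> 1 / (1 + y / real N) ^ N"
proof -
  have "(1 + y / real N) ^ N \<le> exp (y / real N) ^ N"
    using assms by (intro power_mono) (auto intro: exp_ge_add_one_self)
  also have "\<dots> = exp y" using assms by (simp add: exp_of_nat_mult[symmetric])
  finally have "1 / exp y \<le> 1 / (1 + y / real N) ^ N"
    using assms by (intro divide_left_mono mult_pos_pos zero_less_power) (auto intro: add_pos_nonneg)
  then show ?thesis by (simp add: exp_minus field_simps)
qed

lemma power_div_one_minus_le_critical_weight:
  assumes N_ge_1: "N \<ge> 1" and k_bounds: "0 < k" "k \<le> 1" and s_bounds: "0 < s" "s \<le> 1" and x_bounds: "0 \<le> x" "x < 1"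
    and gap: "k * s powr (1 / real N) \<le> 1 - x\<^sup>2"
  shows "x ^ d / (1 - x) \<le> 6 / k * critical_weight N (k / (2 * real N) * real (d + 1)) s"
proof -
  define u where "u = s powr (1 / real N)"
  have u_bounds: "0 < u" "u \<le> 1"
    using s_bounds N_ge_1 by (auto simp: u_def powr_le1)
  have "1 - x\<^sup>2 \<le> 2 * (1 - x)"
    using x_bounds mult_right_mono[of "1 + x" 2 "1 - x"] by (simp add: power2_eq_square algebra_simps)
  then have gap_half: "k * u / 2 \<le> 1 - x"
    using gap by (simp add: u_def)
  then have "x \<le> exp (- (k * u / 2))"
    using exp_ge_add_one_self[of "- (k * u / 2)"] by linarith
  then have "x ^ d \<le> exp (- (k * u / 2)) ^ d"
    using x_bounds by (intro power_mono) auto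
  also have "\<dots> = exp (k * u / 2) * exp (- (k * real (d + 1) * u / 2))"
    by (simp add: exp_of_nat_mult[symmetric] exp_add[symmetric]) (simp add: field_simps)
  also have "\<dots> \<le> 3 * (1 / (1 + (k * real (d + 1) * u / 2) / real N) ^ N)"
  proof (intro mult_mono exp_neg_le_inverse_power)
    have "k * u \<le> 1"
      using k_bounds u_bounds by (intro mult_le_one) auto
    then have "exp (k * u / 2) \<le> exp 1" by simp
    then show "exp (k * u / 2) \<le> 3" using exp_le by linarith
  qed (use k_bounds u_bounds N_ge_1 in auto)
  finally have "x ^ d \<le> 3 / (1 + (k / (2 * real N) * real (d + 1)) * u) ^ N"
    by (simp add: mult_ac)
  then have "x ^ d / (1 - x) \<le> (3 / (1 + (k / (2 * real N) * real (d + 1)) * u) ^ N) / (k * u / 2)"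
    using gap_half k_bounds u_bounds x_bounds by (intro frac_le) auto
  also have "\<dots> = 6 / k * (1 / u / (1 + (k / (2 * real N) * real (d + 1)) * u) ^ N)"
    by (simp add: field_simps)
  also have "1 / u = s powr (- 1 / real N)"
    by (simp add: u_def powr_minus_divide)
  finally show ?thesis by (simp add: u_def critical_weight_def)
qed

lemma power_series_square_le:
  assumes b_sums: "(\<lambda>d. b d * w ^ d) sums g" and w_disk: "cmod w < 1"
    and summable: "summable (\<lambda>d. (cmod (b d))\<^sup>2 * cmod w ^ d)"
  shows "(cmod g)\<^sup>2 \<le> (\<Sum>d. (cmod (b d))\<^sup>2 * cmod w ^ d) / (1 - cmod w)"
proof -
  define c where "c d = b d * csqrt w ^ d" for d
  have "(sqrt (cmod w) ^ d)\<^sup>2 = cmod w ^ d" for d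
    by (metis mult.commute norm_ge_zero power_mult real_sqrt_pow2)
  then have c_sq: "(cmod (c d))\<^sup>2 = (cmod (b d))\<^sup>2 * cmod w ^ d" for d
    by (simp add: c_def norm_mult norm_power power_mult_distrib)
  then have c_ell2: "c \<in> ell2"
    using summable by (simp add: ell2_def)
  have "c d * csqrt w ^ d = b d * (csqrt w * csqrt w) ^ d" for d
    by (simp add: c_def power_mult_distrib mult.assoc)
  then have "c d * csqrt w ^ d = b d * w ^ d" for d
    by (simp flip: power2_eq_square)
  then have "power_series c (csqrt w) = g"
    using b_sums by (simp add: power_series_def sums_iff)
  moreover have "cmod (csqrt w) < 1"
    using w_disk by simp
  ultimately show ?thesis
    using power_series_sums(3)[OF c_ell2, of "csqrt w"] by (simp add: ell2_sqnorm_def c_sq)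
qed

definition critical_rate :: "nat \<Rightarrow> real" where
  "critical_rate N = lens_gap (1 / real N) / (2 * real N)"

definition critical_const :: "nat \<Rightarrow> real" where
  "critical_const N = 12 / (lens_gap (1 / real N) * critical_rate N ^ (N - 1))"

lemma compose_critical_lens_square_le:
  assumes N_ge_2: "N \<ge> 2"
    and b_sums: "\<And>w. cmod w < 1 \<Longrightarrow> (\<lambda>d. b d * w ^ d) sums g w"
    and z_disk: "cmod z < 1" and s_bounds: "0 < s" "s \<le> 1" "s \<le> cmod (1 - z\<^sup>2)"
    and summable: "summable (\<lambda>d. (cmod (b d))\<^sup>2 * critical_weight N (critical_rate N * real (d + 1)) s)"
  shows "(cmod (g (lens (1 / real N) z)))\<^sup>2
    \<le> 6 / lens_gap (1 / real N) * (\<Sum>d. (cmod (b d))\<^sup>2 * critical_weight N (critical_rate N * real (d + 1)) s)"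
proof -
  let ?\<theta> = "1 / real N" and ?W = "\<lambda>d. critical_weight N (critical_rate N * real (d + 1)) s"
  define k where "k = lens_gap ?\<theta>"
  define x where "x = cmod (lens ?\<theta> z)"
  have \<theta>_bounds: "0 < ?\<theta>" "?\<theta> < 1" and N_pos: "1 \<le> N"
    using N_ge_2 by auto
  have k_bounds: "0 < k" "k \<le> 1"
    using lens_gap_pos[OF \<theta>_bounds] by (auto simp: k_def lens_gap_def intro: order_trans[OF cos_le_one])
  have x_bounds: "0 \<le> x" "x < 1"
    using lens_in_disk[OF \<theta>_bounds z_disk] by (auto simp: x_def)
  have gap: "k * s powr ?\<theta> \<le> 1 - x\<^sup>2"
    unfolding k_def x_def by (rule lens_gap_le[OF \<theta>_bounds z_disk s_bounds(1,3)])
  have term_le: "(cmod (b d))\<^sup>2 * (x ^ d / (1 - x)) \<le> 6 / k * ((cmod (b d))\<^sup>2 * ?W d)" for d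
    using mult_left_mono[OF power_div_one_minus_le_critical_weight[OF N_pos k_bounds s_bounds(1,2) x_bounds gap, of d],
        of "(cmod (b d))\<^sup>2"]
    by (simp add: critical_rate_def k_def mult_ac)
  have summable_div: "summable (\<lambda>d. (cmod (b d))\<^sup>2 * (x ^ d / (1 - x)))"
    by (rule summable_comparison_test'[OF summable_mult[OF summable, of "6 / k"]]) (use term_le x_bounds in auto)
  then have summable_x: "summable (\<lambda>d. (cmod (b d))\<^sup>2 * x ^ d)"
    using summable_mult2[OF summable_div, of "1 - x"] x_bounds by simp
  have "(cmod (g (lens ?\<theta> z)))\<^sup>2 \<le> (\<Sum>d. (cmod (b d))\<^sup>2 * x ^ d) / (1 - x)"
    unfolding x_def by (rule power_series_square_le[OF b_sums]) (use x_bounds summable_x in \<open>simp_all add: x_def\<close>)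
  also have "\<dots> = (\<Sum>d. (cmod (b d))\<^sup>2 * (x ^ d / (1 - x)))"
    using suminf_divide[OF summable_x, of "1 - x"] by simp
  also have "\<dots> \<le> (\<Sum>d. 6 / k * ((cmod (b d))\<^sup>2 * ?W d))"
    by (intro suminf_le term_le summable_div summable_mult summable)
  also have "\<dots> = 6 / k * (\<Sum>d. (cmod (b d))\<^sup>2 * ?W d)"
    by (rule suminf_mult[OF summable])
  finally show ?thesis
    by (simp only: k_def)
qed

lemma bergman_compose_critical_lens:
  assumes N_ge_2: "N \<ge> 2"
    and b_sums: "\<And>w. cmod w < 1 \<Longrightarrow> (\<lambda>d. b d * w ^ d) sums g w"
    and summable: "summable (\<lambda>d. (cmod (b d))\<^sup>2 / real (d + 1) ^ (N - 1))"
  shows "taylor (\<lambda>z. g (lens (1 / real N) z)) \<in> ell2"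
    and "ell2_sqnorm (taylor (\<lambda>z. g (lens (1 / real N) z)))
      \<le> critical_const N * (\<Sum>d. (cmod (b d))\<^sup>2 / real (d + 1) ^ (N - 1))"
proof -
  let ?\<theta> = "1 / real N" and ?S = "\<Sum>d. (cmod (b d))\<^sup>2 / real (d + 1) ^ (N - 1)"
  have \<theta>_bounds: "0 < ?\<theta>" "?\<theta> < 1"
    using N_ge_2 by auto
  have rate: "0 < critical_rate N"
    using N_ge_2 lens_gap_pos[OF \<theta>_bounds] by (simp add: critical_rate_def)
  obtain I where weights_summable:
      "\<And>s. 0 \<le> s \<Longrightarrow> summable (\<lambda>d. (cmod (b d))\<^sup>2 * critical_weight N (critical_rate N * real (d + 1)) s)"
    and I_integral: "((\<lambda>s. \<Sum>d. (cmod (b d))\<^sup>2 * critical_weight N (critical_rate N * real (d + 1)) s) has_integral I) {0..1}"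
    and I_le: "I \<le> 2 / critical_rate N ^ (N - 1) * ?S"
    by (rule has_integral_critical_weight_series[OF N_ge_2 rate zero_le_power2 summable]) blast
  have "g holomorphic_on ball 0 1"
    by (rule power_series_holomorphic[of 0 1 b]) (use b_sums in auto)
  note composite = taylor_ell2_if_bounded_by_boundary_distance[OF holomorphic_compose_lens[OF \<theta>_bounds this]
      has_integral_mult_right[OF I_integral, of "6 / lens_gap ?\<theta>"]
      compose_critical_lens_square_le[OF N_ge_2 b_sums _ _ _ _ weights_summable]]
  show "taylor (\<lambda>z. g (lens ?\<theta> z)) \<in> ell2"
    by (rule composite) auto
  have "ell2_sqnorm (taylor (\<lambda>z. g (lens ?\<theta> z))) \<le> 6 / lens_gap ?\<theta> * I"
    by (rule composite) auto
  also have "\<dots> \<le> 6 / lens_gap ?\<theta> * (2 / critical_rate N ^ (N - 1) * ?S)"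
    using lens_gap_pos[OF \<theta>_bounds] I_le by (intro mult_left_mono) auto
  finally show "ell2_sqnorm (taylor (\<lambda>z. g (lens ?\<theta> z))) \<le> critical_const N * ?S"
    by (simp add: critical_const_def)
qed

definition critical_coeffs :: "nat \<Rightarrow> ((nat \<Rightarrow> complex) \<Rightarrow> complex) \<Rightarrow> nat \<Rightarrow> complex" where
  "critical_coeffs N f = taylor (\<lambda>w. f (\<lambda>_. lens (1 / real N) w))"

context
  fixes N :: nat
  assumes N_ge_2: "N \<ge> 2"
begin

lemma critical_const_pos: "0 < critical_const N"
  using N_ge_2 lens_gap_pos[of "1 / real N"] by (simp add: critical_const_def critical_rate_def)

lemma critical_coeffs_ell2:
  assumes f_H2: "f \<in> H2 N"
  shows "critical_coeffs N f \<in> ell2"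
    and "ell2_sqnorm (critical_coeffs N f) \<le> critical_const N * (h2_norm N f)\<^sup>2"
proof -
  obtain b where b_sums: "\<And>w. cmod w < 1 \<Longrightarrow> (\<lambda>d. b d * w ^ d) sums f (\<lambda>_. w)"
    and summable: "summable (\<lambda>d. (cmod (b d))\<^sup>2 / real (d + 1) ^ (N - 1))"
    and weighted_sum_le: "(\<Sum>d. (cmod (b d))\<^sup>2 / real (d + 1) ^ (N - 1)) \<le> (h2_norm N f)\<^sup>2"
    by (rule h2_diagonal_power_series[OF _ f_H2]) (use N_ge_2 in auto)
  note bergman = bergman_compose_critical_lens[OF N_ge_2, where g = "\<lambda>w. f (\<lambda>_. w)",
      OF b_sums summable, folded critical_coeffs_def]
  show "critical_coeffs N f \<in> ell2"
    by (rule bergman)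
  show "ell2_sqnorm (critical_coeffs N f) \<le> critical_const N * (h2_norm N f)\<^sup>2"
    using bergman(2) mult_left_mono[OF weighted_sum_le less_imp_le[OF critical_const_pos]] by linarith
qed

lemma diagonal_critical_lens_holomorphic:
  assumes f_H2: "f \<in> H2 N"
  shows "(\<lambda>w. f (\<lambda>_. lens (1 / real N) w)) holomorphic_on ball 0 1"
proof -
  obtain b where b_sums: "\<And>w. cmod w < 1 \<Longrightarrow> (\<lambda>d. b d * w ^ d) sums f (\<lambda>_. w)"
    by (rule h2_diagonal_power_series[OF _ f_H2]) (use N_ge_2 in auto)
  have "(\<lambda>w. f (\<lambda>_. w)) holomorphic_on ball 0 1"
    by (rule power_series_holomorphic[of 0 1 b]) (use b_sums in auto)
  then show ?thesis
    using N_ge_2 by (intro holomorphic_compose_lens) auto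
qed

lemma power_series_critical_coeffs:
  assumes "f \<in> H2 N" "cmod w < 1"
  shows "power_series (critical_coeffs N f) w = f (\<lambda>_. lens (1 / real N) w)"
  unfolding critical_coeffs_def by (rule power_series_taylor[OF diagonal_critical_lens_holomorphic[OF assms(1)] assms(2)])

lemma critical_coeffs_linear:
  assumes "f \<in> H2 N" "g \<in> H2 N"
  shows "critical_coeffs N (\<lambda>z. a * f z + b * g z) = (\<lambda>n. a * critical_coeffs N f n + b * critical_coeffs N g n)"
  unfolding critical_coeffs_def
  by (rule taylor_linear[OF diagonal_critical_lens_holomorphic[OF assms(1)]
      diagonal_critical_lens_holomorphic[OF assms(2)]])

end

lemma comp_op_lens_diag: "comp_op (lens_diag \<theta>) f z = f (\<lambda>_. lens \<theta> (z 0))"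
  by (simp add: comp_op_def lens_diag_def)

theorem comp_op_lens_diag_bounded_critical:
  assumes N_ge_2: "N \<ge> 2"
  shows "bounded_on_H2 N (comp_op (lens_diag (1 / real N)))"
proof (rule bounded_on_H2_if_sq_bound)
  fix f assume f_H2: "f \<in> H2 N"
  let ?T = "comp_op (lens_diag (1 / real N))"
  have "?T f z = power_series (critical_coeffs N f) (z 0)" if "z \<in> polydisk N" for z
    using that N_ge_2 by (simp add: comp_op_lens_diag power_series_critical_coeffs[OF N_ge_2 f_H2] polydisk_def)
  note T = h2_first_variable[where F = "?T f", OF _ critical_coeffs_ell2(1)[OF N_ge_2 f_H2] this]
  show "?T f \<in> H2 N"
    using N_ge_2 by (intro T) auto
  show "(h2_norm N (?T f))\<^sup>2 \<le> critical_const N * (h2_norm N f)\<^sup>2"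
    using N_ge_2 critical_coeffs_ell2(2)[OF N_ge_2 f_H2] T(2) by simp
qed

section \<open>Lower bounds from reproducing kernels\<close>

abbreviation diag_kernel :: "nat \<Rightarrow> real \<Rightarrow> (nat \<Rightarrow> complex) \<Rightarrow> complex" where
  "diag_kernel N r \<equiv> szego_kernel N (\<lambda>_. of_real r)"

lemma diag_kernel_h2:
  assumes "0 \<le> r" "r < 1"
  shows "diag_kernel N r \<in> H2 N" and "(h2_norm N (diag_kernel N r))\<^sup>2 = 1 / (1 - r\<^sup>2) ^ N"
  using szego_kernel_h2[of "\<lambda>_. of_real r" N] assms by (simp_all add: polydisk_def power_one_over)

definition unit_kernel :: "nat \<Rightarrow> real \<Rightarrow> (nat \<Rightarrow> complex) \<Rightarrow> complex" where
  "unit_kernel N r z = of_real (sqrt ((1 - r\<^sup>2) ^ N)) * diag_kernel N r z"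

lemma unit_kernel_h2:
  assumes r_bounds: "0 \<le> r" "r < 1"
  shows "unit_kernel N r \<in> H2 N" and "h2_norm N (unit_kernel N r) = 1"
proof -
  have gap_pos: "0 < 1 - r\<^sup>2"
    using r_bounds by (simp add: abs_square_less_1)
  note kernel = h2_norm_scale[OF diag_kernel_h2(1)[OF r_bounds, of N], of "of_real (sqrt ((1 - r\<^sup>2) ^ N))",
      folded unit_kernel_def]
  show "unit_kernel N r \<in> H2 N"
    by (rule kernel)
  have "(h2_norm N (unit_kernel N r))\<^sup>2 = 1"
    using gap_pos unfolding kernel(2) power_mult_distrib diag_kernel_h2(2)[OF r_bounds] by (simp add: norm_of_real)
  then show "h2_norm N (unit_kernel N r) = 1"
    using h2_norm_nonneg[of N "unit_kernel N r"] by (simp add: power2_eq_1_iff)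
qed

lemma cmod_unit_kernel_diag_square:
  assumes "0 \<le> r" "r < 1"
  shows "(cmod (unit_kernel N r (\<lambda>_. w)))\<^sup>2 = (1 - r\<^sup>2) ^ N / (cmod (1 - of_real r * w))\<^sup>2 ^ N"
proof -
  have "0 < 1 - r\<^sup>2"
    using assms by (simp add: abs_square_less_1)
  then show ?thesis
    by (simp add: unit_kernel_def szego_kernel_def norm_mult norm_power norm_divide power_mult_distrib power_divide
        mult.commute flip: power_mult)
qed

lemma unit_kernel_lower_bound:
  assumes \<theta>_bounds: "0 < \<theta>" "\<theta> < 1" and v_bounds: "0 < v" "v \<le> 1"
  obtains r where "0 \<le> r" "r < 1" "(1 - r\<^sup>2) ^ N \<le> 4 ^ N * v powr (real N * \<theta>)"
    "v powr (1 - real N * \<theta>)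
      \<le> 4 ^ N * (v * (cmod (comp_op (lens_diag \<theta>) (unit_kernel N r) (first_axis (of_real (sqrt (1 - v))))))\<^sup>2)"
proof -
  have sqrt_bounds: "0 \<le> sqrt (1 - v)" "sqrt (1 - v) < 1"
    using v_bounds by auto
  obtain r where r_lens: "lens \<theta> (of_real (sqrt (1 - v))) = of_real r" "0 \<le> r" "r < 1" "1 - r\<^sup>2 \<le> 4 * v powr \<theta>"
    using lens_of_real[OF \<theta>_bounds sqrt_bounds] v_bounds by (auto simp: real_sqrt_pow2)
  have gap_pos: "0 < 1 - r\<^sup>2"
    using r_lens by (simp add: abs_square_less_1)
  have "cmod (1 - of_real r * of_real r) = 1 - r\<^sup>2"
    using gap_pos norm_of_real[of "1 - r\<^sup>2", where 'a = complex] by (simp add: power2_eq_square)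
  then have eval: "(cmod (comp_op (lens_diag \<theta>) (unit_kernel N r) (first_axis (of_real (sqrt (1 - v))))))\<^sup>2
      = 1 / (1 - r\<^sup>2) ^ N"
    using gap_pos r_lens(1) cmod_unit_kernel_diag_square[OF r_lens(2,3), of N "of_real r"]
    by (simp add: comp_op_lens_diag first_axis_def power2_eq_square power_mult_distrib)
  have "(1 - r\<^sup>2) ^ N \<le> (4 * v powr \<theta>) ^ N"
    using r_lens(4) gap_pos by (intro power_mono) auto
  also have "\<dots> = 4 ^ N * v powr (real N * \<theta>)"
    using v_bounds by (simp add: power_mult_distrib powr_powr mult.commute flip: powr_realpow)
  finally have small: "(1 - r\<^sup>2) ^ N \<le> 4 ^ N * v powr (real N * \<theta>)" .
  have "v powr (1 - real N * \<theta>) * (1 - r\<^sup>2) ^ N \<le> v powr (1 - real N * \<theta>) * (4 ^ N * v powr (real N * \<theta>))"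
    using small by (intro mult_left_mono) auto
  also have "\<dots> = 4 ^ N * v"
    using v_bounds by (simp add: mult.left_commute flip: powr_add)
  finally have "v powr (1 - real N * \<theta>) \<le> 4 ^ N * (v * (1 / (1 - r\<^sup>2) ^ N))"
    using gap_pos by (simp add: pos_le_divide_eq)
  then show ?thesis
    using that[OF r_lens(2,3) small] unfolding eval by simp
qed

lemma first_axis_sqrt:
  assumes "N \<ge> 1" "0 < v" "v \<le> 1"
  defines "x \<equiv> first_axis (complex_of_real (sqrt (1 - v)))"
  shows "x \<in> polydisk N" and "(\<Prod>i<N. 1 / (1 - (cmod (x i))\<^sup>2)) = 1 / v"
  unfolding x_def prod_first_axis_one_minus_square[OF assms(1)]
  by (use assms(2,3) in \<open>auto intro!: first_axis_polydisk\<close>)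

theorem comp_op_lens_diag_unbounded_supercritical:
  assumes N_ge_1: "N \<ge> 1" and \<theta>_bounds: "0 < \<theta>" "\<theta> < 1" and super: "\<theta> > 1 / real N"
  shows "\<not> bounded_on_H2 N (comp_op (lens_diag \<theta>))"
proof
  let ?T = "comp_op (lens_diag \<theta>)"
  assume "bounded_on_H2 N ?T"
  then obtain C where T_H2: "\<And>f. f \<in> H2 N \<Longrightarrow> ?T f \<in> H2 N"
    and C_bound: "\<And>f. f \<in> H2 N \<Longrightarrow> h2_norm N (?T f) \<le> C * h2_norm N f"
    unfolding bounded_on_H2_def by blast
  define p where "p = real N * \<theta> - 1"
  define M where "M = 4 ^ N * C\<^sup>2 + 1"
  define v where "v = M powr (- 1 / p)"
  have p_pos: "p > 0"
    using super N_ge_1 by (simp add: p_def field_simps)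
  have M_ge_1: "M \<ge> 1"
    by (simp add: M_def)
  have v_bounds: "0 < v" "v \<le> 1"
    using M_ge_1 p_pos powr_mono[of "- 1 / p" 0 M] by (auto simp: v_def)
  obtain r where r_bounds: "0 \<le> r" "r < 1" and lower: "v powr (1 - real N * \<theta>)
      \<le> 4 ^ N * (v * (cmod (?T (unit_kernel N r) (first_axis (of_real (sqrt (1 - v))))))\<^sup>2)"
    using unit_kernel_lower_bound[OF \<theta>_bounds v_bounds] by blast
  note kernel = unit_kernel_h2[OF r_bounds, of N]
  have "1 - real N * \<theta> = - p"
    by (simp add: p_def)
  then have "M = v powr (1 - real N * \<theta>)"
    using M_ge_1 p_pos by (simp add: v_def powr_powr)
  also note lower
  also have "v * (cmod (?T (unit_kernel N r) (first_axis (of_real (sqrt (1 - v))))))\<^sup>2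
      \<le> (h2_norm N (?T (unit_kernel N r)))\<^sup>2"
    using h2_pointwise_bound[OF T_H2[OF kernel(1)] first_axis_sqrt(1)[OF N_ge_1 v_bounds]] v_bounds
    unfolding first_axis_sqrt(2)[OF N_ge_1 v_bounds] by (simp add: pos_le_divide_eq mult.commute)
  also have "\<dots> \<le> C\<^sup>2"
    using C_bound[OF kernel(1)] by (intro power_mono h2_norm_nonneg) (simp add: kernel(2))
  finally show False
    by (simp add: M_def)
qed

lemma cmod_unit_kernel_diag_square_le:
  assumes r_bounds: "0 \<le> r" "r < 1" and w_disk: "cmod w < 1"
  shows "(cmod (unit_kernel N r (\<lambda>_. w)))\<^sup>2 \<le> (1 - r\<^sup>2) ^ N / (1 - cmod w)\<^sup>2 ^ N"
proof -
  have "cmod (of_real r * w) \<le> cmod w"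
    using r_bounds by (simp add: norm_mult mult_left_le_one_le)
  then have "1 - cmod w \<le> cmod (1 - of_real r * w)"
    using norm_triangle_ineq2[of 1 "of_real r * w"] by simp
  then have "(1 - cmod w)\<^sup>2 ^ N \<le> (cmod (1 - of_real r * w))\<^sup>2 ^ N" "0 < cmod (1 - of_real r * w)"
    using w_disk by (auto intro!: power_mono)
  then show ?thesis
    unfolding cmod_unit_kernel_diag_square[OF r_bounds] using r_bounds w_disk
    by (intro divide_left_mono) (auto simp: abs_square_le_1)
qed

lemma comp_op_lens_diag_unit_kernel_tendsto_0:
  assumes N_ge_1: "N \<ge> 1" and \<theta>_bounds: "0 < \<theta>" "\<theta> < 1" and r_bounds: "\<And>n. 0 \<le> r n" "\<And>n. r n < 1"
    and r_limit: "(\<lambda>n. (1 - (r n)\<^sup>2) ^ N) \<longlonglongrightarrow> 0" and z_polydisk: "z \<in> polydisk N"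
  shows "(\<lambda>n. comp_op (lens_diag \<theta>) (unit_kernel N (r n)) z) \<longlonglongrightarrow> 0"
proof -
  let ?w = "lens \<theta> (z 0)"
  have w_disk: "cmod ?w < 1"
    using z_polydisk N_ge_1 by (intro lens_in_disk \<theta>_bounds) (auto simp: polydisk_def)
  have "(\<lambda>n. (cmod (comp_op (lens_diag \<theta>) (unit_kernel N (r n)) z))\<^sup>2) \<longlonglongrightarrow> 0"
    by (rule tendsto_sandwich[OF _ _ tendsto_const tendsto_divide_zero[OF r_limit, of "(1 - cmod ?w)\<^sup>2 ^ N"]])
       (simp_all add: comp_op_lens_diag cmod_unit_kernel_diag_square_le[OF r_bounds w_disk])
  then show ?thesis
    by (simp add: tendsto_norm_zero_iff)
qed

theorem comp_op_lens_diag_noncompact_critical: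
  assumes N_ge_2: "N \<ge> 2"
  shows "\<not> compact_on_H2 N (comp_op (lens_diag (1 / real N)))"
proof
  let ?T = "comp_op (lens_diag (1 / real N))" and ?x = "\<lambda>v. first_axis (complex_of_real (sqrt (1 - v)))"
  assume compact: "compact_on_H2 N ?T"
  have \<theta>_bounds: "0 < 1 / real N" "1 / real N < 1" and N_pos: "1 \<le> N" and exponent: "real N * (1 / real N) = 1"
    using N_ge_2 by auto
  define v where "v n = 1 / (real n + 1)" for n
  have v_bounds: "0 < v n" "v n \<le> 1" for n
    by (auto simp: v_def)
  have "\<exists>r. 0 \<le> r \<and> r < 1 \<and> (1 - r\<^sup>2) ^ N \<le> 4 ^ N * v n \<and>
      1 \<le> 4 ^ N * (v n * (cmod (?T (unit_kernel N r) (?x (v n))))\<^sup>2)" for n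
    by (rule unit_kernel_lower_bound[OF \<theta>_bounds v_bounds, of N n, unfolded exponent], intro exI conjI, assumption)
       (use v_bounds[of n] in simp_all)
  then obtain r where r_bounds: "\<And>n. 0 \<le> r n" "\<And>n. r n < 1"
    and small: "\<And>n. (1 - (r n)\<^sup>2) ^ N \<le> 4 ^ N * v n"
    and large: "\<And>n. 1 \<le> 4 ^ N * (v n * (cmod (?T (unit_kernel N (r n)) (?x (v n))))\<^sup>2)"
    by metis
  note kernel = unit_kernel_h2[OF r_bounds, of N]
  have "(\<lambda>n. 4 ^ N * v n) \<longlonglongrightarrow> 0"
    unfolding v_def using tendsto_mult_right_zero[OF LIMSEQ_inverse_real_of_nat, of "4 ^ N"]
    by (simp add: inverse_eq_divide add.commute)
  then have "(\<lambda>n. (1 - (r n)\<^sup>2) ^ N) \<longlonglongrightarrow> 0"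
    by (rule tendsto_sandwich[OF _ _ tendsto_const, rotated 2])
       (use small r_bounds in \<open>simp_all add: abs_square_le_1 less_imp_le\<close>)
  note null = comp_op_lens_diag_unit_kernel_tendsto_0[OF N_pos \<theta>_bounds r_bounds this]
  define e where "e = sqrt (1 / (2 * 4 ^ N))"
  have "0 < e"
    by (simp add: e_def)
  obtain m where image_small:
      "\<forall>z\<in>polydisk N. (cmod (?T (unit_kernel N (r m)) z))\<^sup>2 \<le> e\<^sup>2 * (\<Prod>i<N. 1 / (1 - (cmod (z i))\<^sup>2))"
    using compact_on_H2_eventually_small[where u = "\<lambda>n. unit_kernel N (r n)",
        OF compact kernel(1) eq_refl[OF kernel(2)] null \<open>0 < e\<close>] by blast
  have "1 \<le> 4 ^ N * (v m * (cmod (?T (unit_kernel N (r m)) (?x (v m))))\<^sup>2)"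
    by (rule large)
  also have "v m * (cmod (?T (unit_kernel N (r m)) (?x (v m))))\<^sup>2 \<le> e\<^sup>2"
    using bspec[OF image_small first_axis_sqrt(1)[OF N_pos v_bounds[of m]]] v_bounds[of m]
    unfolding first_axis_sqrt(2)[OF N_pos v_bounds] by (simp add: pos_le_divide_eq mult.commute)
  finally show False
    by (simp add: e_def)
qed

section \<open>Blaschke division\<close>

lemma one_minus_cnj_mult_bound:
  assumes "cmod a < 1" "cmod w < 1"
  shows "1 - cmod a \<le> cmod (1 - cnj a * w)" and "1 - cnj a * w \<noteq> 0"
proof -
  have "cmod (cnj a * w) \<le> cmod a"
    using assms mult_left_mono[of "cmod w" 1 "cmod a"] by (simp add: norm_mult)
  then show "1 - cmod a \<le> cmod (1 - cnj a * w)"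
    using norm_triangle_ineq2[of 1 "cnj a * w"] by simp
  with assms show "1 - cnj a * w \<noteq> 0" by auto
qed

text \<open>If \<open>g\<close> has the coefficients \<open>c\<close>, then \<open>blaschke_quot a c\<close> are those of the quotient of
  \<open>g w - (1 - \<bar>a\<bar>\<^sup>2) * g a / (1 - cnj a * w)\<close> by \<open>Moebius_function 0 a w\<close>. Working with tail sums avoids the
  removable singularity at \<open>a\<close>, and contractivity becomes a telescoping identity.\<close>

definition tail_sum :: "complex \<Rightarrow> (nat \<Rightarrow> complex) \<Rightarrow> nat \<Rightarrow> complex" where
  "tail_sum a c n = power_series (\<lambda>j. c (n + j)) a"

definition blaschke_quot :: "complex \<Rightarrow> (nat \<Rightarrow> complex) \<Rightarrow> nat \<Rightarrow> complex" where
  "blaschke_quot a c n = tail_sum a c (Suc n) - cnj a * tail_sum a c n"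

lemma shift_ell2: "c \<in> ell2 \<Longrightarrow> (\<lambda>j. c (n + j)) \<in> ell2"
  using summable_iff_shift[of "\<lambda>j. (cmod (c j))\<^sup>2" n] by (simp add: ell2_def add.commute)

context
  fixes a :: complex and c :: "nat \<Rightarrow> complex"
  assumes a_disk: "cmod a < 1" and c_ell2: "c \<in> ell2"
begin

lemma tail_sum_Suc: "c n = tail_sum a c n - a * tail_sum a c (Suc n)"
proof -
  have "(\<lambda>j. a * (c (Suc n + j) * a ^ j)) sums (a * tail_sum a c (Suc n))"
    unfolding tail_sum_def by (intro sums_mult power_series_sums shift_ell2 c_ell2 a_disk)
  then have "(\<lambda>j. c (n + Suc j) * a ^ Suc j) sums (a * tail_sum a c (Suc n))"
    by (simp add: mult_ac)
  then have "(\<lambda>j. c (n + j) * a ^ j) sums (a * tail_sum a c (Suc n) + c (n + 0) * a ^ 0)"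
    by (rule sums_Suc)
  from sums_unique2[OF this power_series_sums(1)[OF shift_ell2[OF c_ell2] a_disk]] show ?thesis
    by (simp add: tail_sum_def algebra_simps)
qed

lemma tail_sum_tendsto_0: "tail_sum a c \<longlonglongrightarrow> 0"
proof -
  have "(\<lambda>n. ell2_sqnorm (\<lambda>j. c (n + j))) \<longlonglongrightarrow> 0"
    using suminf_exist_split2[of "\<lambda>j. (cmod (c j))\<^sup>2"] c_ell2 by (simp add: ell2_sqnorm_def ell2_def add.commute)
  then have majorant_limit: "(\<lambda>n. ell2_sqnorm (\<lambda>j. c (n + j)) / (1 - (cmod a)\<^sup>2)) \<longlonglongrightarrow> 0"
    by (rule tendsto_divide_zero)
  have "(\<lambda>n. (cmod (tail_sum a c n))\<^sup>2) \<longlonglongrightarrow> 0"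
    by (rule tendsto_sandwich[OF _ _ tendsto_const majorant_limit])
       (simp_all add: tail_sum_def power_series_sums(3)[OF shift_ell2[OF c_ell2] a_disk])
  then show ?thesis
    by (simp add: tendsto_norm_zero_iff)
qed

lemma blaschke_quot_telescope:
  "(\<Sum>n<M. (cmod (blaschke_quot a c n))\<^sup>2) = (\<Sum>n<M. (cmod (c n))\<^sup>2)
    + (1 - (cmod a)\<^sup>2) * ((cmod (tail_sum a c M))\<^sup>2 - (cmod (tail_sum a c 0))\<^sup>2)"
proof (induction M)
  case (Suc M)
  have "(cmod (y - cnj a * x))\<^sup>2 - (cmod (x - a * y))\<^sup>2 = (1 - (cmod a)\<^sup>2) * ((cmod y)\<^sup>2 - (cmod x)\<^sup>2)" for x y
    unfolding cmod_power2 by (simp add: power2_eq_square algebra_simps)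
  from this[of "tail_sum a c (Suc M)" "tail_sum a c M"]
  have "(cmod (blaschke_quot a c M))\<^sup>2 - (cmod (c M))\<^sup>2 =
     (1 - (cmod a)\<^sup>2) * ((cmod (tail_sum a c (Suc M)))\<^sup>2 - (cmod (tail_sum a c M))\<^sup>2)"
    by (simp add: blaschke_quot_def flip: tail_sum_Suc)
  with Suc show ?case by (simp add: algebra_simps)
qed simp

lemma blaschke_quot_ell2:
  shows "blaschke_quot a c \<in> ell2" and "ell2_sqnorm (blaschke_quot a c) \<le> ell2_sqnorm c"
proof -
  have "(\<lambda>M. \<Sum>n<M. (cmod (blaschke_quot a c n))\<^sup>2) \<longlonglongrightarrow>
    ell2_sqnorm c + (1 - (cmod a)\<^sup>2) * ((cmod 0)\<^sup>2 - (cmod (tail_sum a c 0))\<^sup>2)"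
    unfolding blaschke_quot_telescope
    by (intro tendsto_intros tail_sum_tendsto_0 ell2_sums[OF c_ell2, unfolded sums_def])
  then have sums: "(\<lambda>n. (cmod (blaschke_quot a c n))\<^sup>2) sums
      (ell2_sqnorm c - (1 - (cmod a)\<^sup>2) * (cmod (tail_sum a c 0))\<^sup>2)"
    by (simp add: sums_def)
  then show "blaschke_quot a c \<in> ell2"
    by (auto simp: ell2_def intro: sums_summable)
  have "(1 - (cmod a)\<^sup>2) * (cmod (tail_sum a c 0))\<^sup>2 \<ge> 0"
    using a_disk by (intro mult_nonneg_nonneg) (auto simp: abs_square_le_1)
  with sums show "ell2_sqnorm (blaschke_quot a c) \<le> ell2_sqnorm c"
    by (simp add: ell2_sqnorm_def[of "blaschke_quot a c"] sums_iff)
qed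

lemma tail_sum_generating_series:
  assumes w_disk: "cmod w < 1"
  obtains S where "(\<lambda>n. tail_sum a c (Suc n) * w ^ n) sums S"
    and "(\<lambda>n. tail_sum a c n * w ^ n) sums (w * S + tail_sum a c 0)"
proof -
  obtain B where tail_bound: "\<And>n. cmod (tail_sum a c n) \<le> B"
    using convergent_imp_Bseq[OF convergentI[OF tail_sum_tendsto_0]] unfolding Bseq_def by blast
  have "summable (\<lambda>n. tail_sum a c (Suc n) * w ^ n)"
  proof (rule summable_comparison_test')
    show "summable (\<lambda>n. B * cmod w ^ n)"
      using w_disk by (intro summable_mult summable_geometric) auto
    show "norm (tail_sum a c (Suc n) * w ^ n) \<le> B * cmod w ^ n" for n
      using tail_bound by (simp add: norm_mult norm_power mult_right_mono)
  qed
  then obtain S where S_sums: "(\<lambda>n. tail_sum a c (Suc n) * w ^ n) sums S"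
    by (auto simp: summable_def)
  have "(\<lambda>n. tail_sum a c (Suc n) * w ^ Suc n) sums (w * S)"
    using sums_mult[OF S_sums, of w] by (simp add: mult_ac)
  from sums_Suc[OF this] S_sums that show ?thesis by simp
qed

lemma blaschke_division:
  assumes w_disk: "cmod w < 1"
  shows "power_series c w = (1 - (cmod a)\<^sup>2) / (1 - cnj a * w) * power_series c a
    + Moebius_function 0 a w * power_series (blaschke_quot a c) w"
proof -
  let ?E = "tail_sum a c"
  obtain S where S_sums: "(\<lambda>n. ?E (Suc n) * w ^ n) sums S" and E_sums: "(\<lambda>n. ?E n * w ^ n) sums (w * S + ?E 0)"
    by (rule tail_sum_generating_series[OF w_disk])
  have "(\<lambda>n. ?E n * w ^ n - a * (?E (Suc n) * w ^ n)) sums (w * S + ?E 0 - a * S)"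
    by (intro sums_diff sums_mult E_sums S_sums)
  also have "(\<lambda>n. ?E n * w ^ n - a * (?E (Suc n) * w ^ n)) = (\<lambda>n. c n * w ^ n)"
    by (subst tail_sum_Suc) (simp add: algebra_simps)
  finally have series: "power_series c w = w * S + ?E 0 - a * S"
    by (simp add: power_series_def sums_iff)
  have "(\<lambda>n. ?E (Suc n) * w ^ n - cnj a * (?E n * w ^ n)) sums (S - cnj a * (w * S + ?E 0))"
    by (intro sums_diff sums_mult E_sums S_sums)
  then have quotient: "power_series (blaschke_quot a c) w = S - cnj a * (w * S + ?E 0)"
    by (simp add: power_series_def sums_iff blaschke_quot_def algebra_simps)
  have "(1 - a * cnj a) * ?E 0 + (w - a) * (S - cnj a * (w * S + ?E 0))
      = (w * S + ?E 0 - a * S) * (1 - cnj a * w)"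
    by (simp add: algebra_simps)
  moreover have "?E 0 = power_series c a"
    by (simp add: tail_sum_def)
  ultimately show ?thesis
    unfolding series quotient Moebius_function_simple using one_minus_cnj_mult_bound(2)[OF a_disk w_disk]
    by (simp add: complex_norm_square eq_divide_eq add_divide_distrib[symmetric] del: of_real_power)
qed

end

lemma blaschke_quot_linear:
  assumes "cmod a < 1" "c \<in> ell2" "d \<in> ell2"
  shows "blaschke_quot a (\<lambda>n. x * c n + y * d n) = (\<lambda>n. x * blaschke_quot a c n + y * blaschke_quot a d n)"
proof -
  have "tail_sum a (\<lambda>n. x * c n + y * d n) n = x * tail_sum a c n + y * tail_sum a d n" for n
    unfolding tail_sum_def by (intro power_series_linear shift_ell2 assms)
  then show ?thesis
    by (simp add: blaschke_quot_def fun_eq_iff algebra_simps)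
qed

section \<open>Takenaka-Malmquist decomposition\<close>

definition blaschke :: "complex list \<Rightarrow> complex \<Rightarrow> complex" where
  "blaschke as w = (\<Prod>a\<leftarrow>as. Moebius_function 0 a w)"

definition tm_basis :: "complex list \<Rightarrow> nat \<Rightarrow> complex \<Rightarrow> complex" where
  "tm_basis as k w = (1 - (cmod (as ! k))\<^sup>2) / (1 - cnj (as ! k) * w) * blaschke (take k as) w"

definition tm_coeff :: "complex list \<Rightarrow> (nat \<Rightarrow> complex) \<Rightarrow> nat \<Rightarrow> complex" where
  "tm_coeff as c k = power_series (fold blaschke_quot (take k as) c) (as ! k)"

lemma blaschke_append: "blaschke (as @ bs) w = blaschke as w * blaschke bs w"
  by (simp add: blaschke_def)

lemma fold_blaschke_quot_ell2:
  assumes "\<forall>a\<in>set as. cmod a < 1" "c \<in> ell2"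
  shows "fold blaschke_quot as c \<in> ell2 \<and> ell2_sqnorm (fold blaschke_quot as c) \<le> ell2_sqnorm c"
  using assms
proof (induction as arbitrary: c)
  case (Cons a as)
  then have "blaschke_quot a c \<in> ell2" "ell2_sqnorm (blaschke_quot a c) \<le> ell2_sqnorm c"
    by (simp_all add: blaschke_quot_ell2)
  with Cons.IH[of "blaschke_quot a c"] Cons.prems(1) show ?case
    by simp
qed simp

lemma fold_blaschke_quot_linear:
  assumes "\<forall>a\<in>set as. cmod a < 1" "c \<in> ell2" "d \<in> ell2"
  shows "fold blaschke_quot as (\<lambda>n. x * c n + y * d n) =
    (\<lambda>n. x * fold blaschke_quot as c n + y * fold blaschke_quot as d n)"
  using assms by (induction as arbitrary: c d) (simp_all add: blaschke_quot_linear blaschke_quot_ell2)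

lemma takenaka_malmquist_decomposition:
  assumes "\<forall>a\<in>set as. cmod a < 1" and c_ell2: "c \<in> ell2" and w_disk: "cmod w < 1"
  shows "power_series c w = (\<Sum>k<length as. tm_coeff as c k * tm_basis as k w)
    + blaschke as w * power_series (fold blaschke_quot as c) w"
  using assms(1)
proof (induction as rule: rev_induct)
  case Nil
  then show ?case by (simp add: blaschke_def)
next
  case (snoc a as)
  let ?h = "fold blaschke_quot as c"
  have h_ell2: "?h \<in> ell2"
    using snoc.prems fold_blaschke_quot_ell2[OF _ c_ell2] by simp
  have "power_series ?h w = (1 - (cmod a)\<^sup>2) / (1 - cnj a * w) * power_series ?h a
      + Moebius_function 0 a w * power_series (blaschke_quot a ?h) w"
    using snoc.prems by (intro blaschke_division h_ell2 w_disk) simp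
  then have "blaschke as w * power_series ?h w = tm_coeff (as @ [a]) c (length as) * tm_basis (as @ [a]) (length as) w
      + blaschke (as @ [a]) w * power_series (fold blaschke_quot (as @ [a]) c) w"
    by (simp add: tm_coeff_def tm_basis_def blaschke_append blaschke_def[of "[a]"] algebra_simps)
  moreover have "(\<Sum>k<length as. tm_coeff (as @ [a]) c k * tm_basis (as @ [a]) k w) =
      (\<Sum>k<length as. tm_coeff as c k * tm_basis as k w)"
    by (simp add: tm_coeff_def tm_basis_def nth_append)
  ultimately show ?case
    using snoc by simp
qed

lemma tm_coeff_linear:
  assumes "\<forall>a\<in>set as. cmod a < 1" "c \<in> ell2" "d \<in> ell2" "k < length as"
  shows "tm_coeff as (\<lambda>n. x * c n + y * d n) k = x * tm_coeff as c k + y * tm_coeff as d k"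
proof -
  have zeros: "\<forall>a\<in>set (take k as). cmod a < 1"
    using assms(1) by (auto dest: in_set_takeD)
  show ?thesis
    unfolding tm_coeff_def fold_blaschke_quot_linear[OF zeros assms(2,3)]
    by (rule power_series_linear)
       (use assms(1,4) fold_blaschke_quot_ell2[OF zeros assms(2)] fold_blaschke_quot_ell2[OF zeros assms(3)] in simp_all)
qed

lemma blaschke_holomorphic:
  assumes "\<forall>a\<in>set as. cmod a < 1"
  shows "blaschke as holomorphic_on ball 0 1"
  using assms unfolding blaschke_def
  by (induction as) (auto intro!: holomorphic_intros Moebius_function_holomorphic)

lemma blaschke_le_1:
  assumes "\<forall>a\<in>set as. cmod a < 1" "cmod w < 1"
  shows "cmod (blaschke as w) \<le> 1"
  using assms unfolding blaschke_def
  by (induction as) (auto simp: norm_mult intro!: mult_le_one less_imp_le[OF Moebius_function_norm_lt_1])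

context
  fixes as :: "complex list" and k :: nat
  assumes zeros_in_disk: "\<forall>a\<in>set as. cmod a < 1" and k_index: "k < length as"
begin

lemma tm_zeros_in_disk: "cmod (as ! k) < 1" "\<forall>a\<in>set (take k as). cmod a < 1"
  using zeros_in_disk k_index set_take_subset[of k as] by auto

lemma tm_basis_holomorphic: "tm_basis as k holomorphic_on ball 0 1"
  unfolding tm_basis_def[abs_def]
  by (intro holomorphic_intros blaschke_holomorphic tm_zeros_in_disk)
     (use one_minus_cnj_mult_bound(2)[OF tm_zeros_in_disk(1)] in auto)

lemma tm_basis_le_2:
  assumes w_disk: "cmod w < 1"
  shows "cmod (tm_basis as k w) \<le> 2"
proof -
  let ?a = "cmod (as ! k)"
  have "(1 - ?a\<^sup>2) / cmod (1 - cnj (as ! k) * w) \<le> (1 - ?a\<^sup>2) / (1 - ?a)"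
    using one_minus_cnj_mult_bound[OF tm_zeros_in_disk(1) w_disk] tm_zeros_in_disk(1)
    by (intro divide_left_mono mult_pos_pos) (auto simp: abs_square_le_1)
  also have "\<dots> = 1 + ?a"
    using tm_zeros_in_disk(1) by (simp add: field_simps power2_eq_square)
  also have "\<dots> \<le> 2"
    using tm_zeros_in_disk(1) by simp
  finally have "cmod ((1 - of_real (?a\<^sup>2)) / (1 - cnj (as ! k) * w)) \<le> 2"
    using tm_zeros_in_disk(1) norm_of_real[of "1 - ?a\<^sup>2", where 'a = complex]
    by (simp add: norm_divide abs_square_le_1 del: of_real_power)
  then have "cmod (tm_basis as k w) \<le> 2 * 1"
    unfolding tm_basis_def norm_mult by (intro mult_mono blaschke_le_1 tm_zeros_in_disk w_disk) auto
  then show ?thesis by simp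
qed

end

section \<open>Blaschke products with zeros at dyadic scales\<close>

lemma Moebius_function_cayley_inverse:
  assumes b_pos: "b > 0" and w_disk: "cmod w < 1"
  shows "Moebius_function 0 (of_real ((b - 1) / (b + 1))) w = (cayley w - of_real b) / (cayley w + of_real b)"
proof -
  let ?b = "complex_of_real b"
  have "?b + 1 = of_real (b + 1)" by simp
  then have nonzero: "1 - w \<noteq> 0" "?b + 1 \<noteq> 0"
    using b_pos w_disk by (simp_all only: of_real_eq_0_iff) auto
  have "Moebius_function 0 (of_real ((b - 1) / (b + 1))) w
     = ((w - (?b - 1) / (?b + 1)) * (?b + 1)) / ((1 - (?b - 1) / (?b + 1) * w) * (?b + 1))"
    using nonzero(2) by (simp add: Moebius_function_simple)
  also have "\<dots> = ((1 + w) - ?b * (1 - w)) / ((1 + w) + ?b * (1 - w))"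
    using nonzero by (intro arg_cong2[of _ _ _ _ "(/)"]) (simp_all add: field_simps)
  also have "\<dots> = (((1 + w) - ?b * (1 - w)) / (1 - w)) / (((1 + w) + ?b * (1 - w)) / (1 - w))"
    using nonzero by simp
  also have "\<dots> = (cayley w - ?b) / (cayley w + ?b)"
    using nonzero by (simp add: cayley_def diff_divide_distrib add_divide_distrib)
  finally show ?thesis .
qed

lemma sector_cayley_factor_bound:
  assumes b_bounds: "b > 0" "b \<le> cmod W" "cmod W \<le> 2 * b" and sector: "0 < k" "k * cmod W \<le> Re W"
  shows "(cmod ((W - of_real b) / (W + of_real b)))\<^sup>2 \<le> 1 - 8 / 9 * k"
proof -
  define u where "u = cmod W"
  define D where "D = (cmod (W + of_real b))\<^sup>2"
  have "0 < k * cmod W"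
    using sector b_bounds by (intro mult_pos_pos) auto
  then have "0 < Re (W + of_real b)"
    using sector b_bounds by simp
  then have D_pos: "D > 0"
    unfolding D_def by (auto simp: complex_eq_iff)
  have diff: "D - (cmod (W - of_real b))\<^sup>2 = 4 * b * Re W"
    unfolding cmod_power2 D_def by (simp add: power2_eq_square algebra_simps)
  have "D \<le> (u + b)\<^sup>2"
    using norm_triangle_ineq[of W "of_real b"] b_bounds unfolding D_def by (intro power_mono) (auto simp: u_def)
  moreover have "8 * (u + b)\<^sup>2 \<le> 36 * (b * u)"
  proof -
    have "0 \<le> (2 * u - b) * (2 * b - u)" using b_bounds by (intro mult_nonneg_nonneg) (auto simp: u_def)
    then show ?thesis by (simp add: power2_eq_square algebra_simps)
  qed
  ultimately have "8 * D \<le> 36 * (b * u)" by linarith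
  then have "k * (8 * D) \<le> k * (36 * (b * u))" using sector by (intro mult_left_mono) auto
  also have "\<dots> \<le> 36 * (b * Re W)" using sector b_bounds by (simp add: u_def mult.left_commute)
  finally have "(cmod (W - of_real b))\<^sup>2 \<le> (1 - 8 / 9 * k) * D"
    using diff by (simp add: algebra_simps)
  then show ?thesis
    using D_pos by (simp add: norm_divide power_divide pos_divide_le_eq D_def)
qed

definition dyadic_zero :: "nat \<Rightarrow> nat \<Rightarrow> complex" where
  "dyadic_zero p k = of_real ((2 ^ k / 2 ^ p - 1) / (2 ^ k / 2 ^ p + 1))"

definition dyadic_zeros :: "nat \<Rightarrow> complex list" where
  "dyadic_zeros p = concat (map (\<lambda>k. replicate p (dyadic_zero p k)) [0..<2 * p + 1])"

lemma length_dyadic_zeros: "length (dyadic_zeros p) = (2 * p + 1) * p"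
  by (simp add: dyadic_zeros_def length_concat comp_def sum_list_triv)

lemma dyadic_zero_in_disk: "cmod (dyadic_zero p k) < 1"
proof -
  define b :: real where "b = 2 ^ k / 2 ^ p"
  have "0 < b" by (simp add: b_def)
  then have "\<bar>(b - 1) / (b + 1)\<bar> < 1"
    by (auto simp: abs_less_iff field_simps)
  then show ?thesis
    unfolding dyadic_zero_def norm_of_real b_def .
qed

lemma dyadic_zeros_in_disk: "\<forall>a\<in>set (dyadic_zeros p). cmod a < 1"
  by (auto simp: dyadic_zeros_def dyadic_zero_in_disk simp del: upt_Suc)

lemma exists_dyadic_scale:
  fixes x :: real
  assumes "1 \<le> x" "x \<le> 2 ^ Suc m"
  shows "\<exists>k\<le>m. 2 ^ k \<le> x \<and> x \<le> 2 * 2 ^ k"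
  using assms
proof (induction m)
  case (Suc m)
  show ?case
  proof (cases "x \<le> 2 ^ Suc m")
    case True
    with Suc show ?thesis using le_SucI by blast
  next
    case False
    with Suc.prems show ?thesis by (intro exI[of _ "Suc m"]) auto
  qed
qed auto

lemma blaschke_dyadic_zeros_le_factor:
  assumes w_disk: "cmod w < 1" and k_le: "k \<le> 2 * p"
  shows "cmod (blaschke (dyadic_zeros p) w) \<le> cmod (Moebius_function 0 (dyadic_zero p k) w) ^ p"
proof -
  define F where "F j = Moebius_function 0 (dyadic_zero p j) w" for j
  have F_le: "cmod (F j) \<le> 1" for j
    unfolding F_def by (intro less_imp_le Moebius_function_norm_lt_1 dyadic_zero_in_disk w_disk)
  have "blaschke (concat (map (\<lambda>j. replicate p (dyadic_zero p j)) [0..<m])) w = (\<Prod>j<m. F j ^ p)" for m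
    by (induction m) (simp_all add: blaschke_def F_def prod_list_replicate)
  then have "cmod (blaschke (dyadic_zeros p) w) = (\<Prod>j<2 * p + 1. cmod (F j) ^ p)"
    unfolding dyadic_zeros_def by (simp only: prod_norm[symmetric] norm_power)
  also have "\<dots> = cmod (F k) ^ p * (\<Prod>j\<in>{..<2 * p + 1} - {k}. cmod (F j) ^ p)"
    using k_le by (intro prod.remove) auto
  also have "\<dots> \<le> cmod (F k) ^ p * 1"
    by (intro mult_left_mono prod_le_1) (auto intro: power_le_one F_le)
  finally show ?thesis
    by (simp add: F_def)
qed

lemma blaschke_dyadic_zeros_le:
  assumes w_disk: "cmod w < 1" and sector: "0 < \<kappa>" "\<kappa> * cmod (cayley w) \<le> Re (cayley w)"
    and cayley_bounds: "1 / 2 ^ p \<le> cmod (cayley w)" "cmod (cayley w) \<le> 2 ^ p"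
  shows "(cmod (blaschke (dyadic_zeros p) w))\<^sup>2 \<le> (1 - 8 / 9 * \<kappa>) ^ p"
proof -
  have "\<exists>k\<le>2 * p. 2 ^ k \<le> cmod (cayley w) * 2 ^ p \<and> cmod (cayley w) * 2 ^ p \<le> 2 * 2 ^ k"
  proof (rule exists_dyadic_scale)
    show "1 \<le> cmod (cayley w) * 2 ^ p" using cayley_bounds by (simp add: field_simps)
    have "cmod (cayley w) * 2 ^ p \<le> 2 ^ p * 2 ^ p" using cayley_bounds by simp
    also have "\<dots> = 2 ^ (2 * p)" by (simp only: mult_2 power_add)
    also have "\<dots> \<le> 2 ^ Suc (2 * p)" by simp
    finally show "cmod (cayley w) * 2 ^ p \<le> 2 ^ Suc (2 * p)" .
  qed
  then obtain k where k_bounds: "k \<le> 2 * p" "2 ^ k / 2 ^ p \<le> cmod (cayley w)" "cmod (cayley w) \<le> 2 * (2 ^ k / 2 ^ p)"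
    by (auto simp: field_simps)
  let ?F = "Moebius_function 0 (dyadic_zero p k) w"
  have "?F = (cayley w - of_real (2 ^ k / 2 ^ p)) / (cayley w + of_real (2 ^ k / 2 ^ p))"
    unfolding dyadic_zero_def by (rule Moebius_function_cayley_inverse[OF _ w_disk]) simp
  then have factor_le: "(cmod ?F)\<^sup>2 \<le> 1 - 8 / 9 * \<kappa>"
    using sector_cayley_factor_bound[OF _ k_bounds(2,3) sector] by simp
  have "(cmod (blaschke (dyadic_zeros p) w))\<^sup>2 \<le> (cmod ?F ^ p)\<^sup>2"
    by (intro power_mono blaschke_dyadic_zeros_le_factor w_disk k_bounds) simp
  also have "\<dots> = ((cmod ?F)\<^sup>2) ^ p"
    by (simp add: mult.commute flip: power_mult)
  also have "\<dots> \<le> (1 - 8 / 9 * \<kappa>) ^ p"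
    by (intro power_mono factor_le) simp
  finally show ?thesis .
qed

section \<open>The subcritical case\<close>

definition decay_rate :: "real \<Rightarrow> real" where
  "decay_rate \<tau> = max (1 - 8 / 9 * cos (pi * \<tau> / 2)) (2 powr (- ((1 - \<tau>) / (2 * \<tau>))))"

context
  fixes \<tau> :: real
  assumes \<tau>_bounds: "0 < \<tau>" "\<tau> < 1"
begin

text \<open>The exponent \<open>(1 + \<tau>) / 2\<close> lies strictly between \<open>\<tau>\<close> and \<open>1\<close>: the singularity is integrable, and the gap
  to \<open>\<tau>\<close> turns smallness of \<open>s\<close> into decay.\<close>

lemma h2_compose_lens:
  assumes N_ge_1: "N \<ge> 1" and G_holomorphic: "G holomorphic_on ball 0 1"
    and bound: "\<And>z s. cmod z < 1 \<Longrightarrow> 0 < s \<Longrightarrow> s \<le> 1 \<Longrightarrow> s \<le> cmod (1 - z\<^sup>2) \<Longrightarrow>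
      (cmod (G (lens \<tau> z)))\<^sup>2 \<le> B * s powr (- ((1 + \<tau>) / 2))"
    and F_eq: "\<And>z. z \<in> polydisk N \<Longrightarrow> F z = G (lens \<tau> (z 0))"
  shows "F \<in> H2 N" and "(h2_norm N F)\<^sup>2 \<le> B * (2 / (1 - \<tau>))"
proof -
  let ?h = "\<lambda>z. G (lens \<tau> z)"
  have h_holomorphic: "?h holomorphic_on ball 0 1"
    by (rule holomorphic_compose_lens[OF \<tau>_bounds G_holomorphic])
  have "((\<lambda>s. s powr (- ((1 + \<tau>) / 2))) has_integral (2 / (1 - \<tau>))) {0..1}"
    using has_integral_powr_from_0[of "- ((1 + \<tau>) / 2)" 1] \<tau>_bounds by (simp add: field_simps)
  note taylor = taylor_ell2_if_bounded_by_boundary_distance[OF h_holomorphic has_integral_mult_right[OF this, of B] bound]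
  have h_ell2: "taylor ?h \<in> ell2" "ell2_sqnorm (taylor ?h) \<le> B * (2 / (1 - \<tau>))"
    by (rule taylor; assumption)+
  have "F z = power_series (taylor ?h) (z 0)" if "z \<in> polydisk N" for z
    using that N_ge_1 by (simp add: F_eq power_series_taylor[OF h_holomorphic] polydisk_def)
  note embedding = h2_first_variable[where F = F, OF N_ge_1 h_ell2(1) this]
  show "F \<in> H2 N" and "(h2_norm N F)\<^sup>2 \<le> B * (2 / (1 - \<tau>))"
    using embedding h_ell2(2) by simp_all
qed

lemma powr_neg_le_split:
  assumes "0 < s" "s \<le> \<epsilon>"
  shows "s powr (- \<tau>) \<le> \<epsilon> powr ((1 - \<tau>) / 2) * s powr (- ((1 + \<tau>) / 2))"
proof -
  have "s powr (- \<tau>) = s powr ((1 - \<tau>) / 2) * s powr (- ((1 + \<tau>) / 2))"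
    by (simp add: powr_add[symmetric] field_simps)
  also have "\<dots> \<le> \<epsilon> powr ((1 - \<tau>) / 2) * s powr (- ((1 + \<tau>) / 2))"
    using assms \<tau>_bounds by (intro mult_right_mono powr_mono2) auto
  finally show ?thesis .
qed

lemma growth_compose_lens:
  assumes growth: "\<And>w. cmod w < 1 \<Longrightarrow> (cmod (G w))\<^sup>2 \<le> A / (1 - (cmod w)\<^sup>2)"
    and z_disk: "cmod z < 1" and s_bounds: "0 < s" "s \<le> cmod (1 - z\<^sup>2)"
  shows "(cmod (G (lens \<tau> z)))\<^sup>2 \<le> A / lens_gap \<tau> * s powr (- \<tau>)"
proof -
  have "0 \<le> A"
    using growth[of 0] by (simp add: order_trans[OF zero_le_power2])
  have gap: "0 < lens_gap \<tau> * s powr \<tau>" "lens_gap \<tau> * s powr \<tau> \<le> 1 - (cmod (lens \<tau> z))\<^sup>2"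
    using lens_gap_pos[OF \<tau>_bounds] lens_gap_le[OF \<tau>_bounds z_disk s_bounds] s_bounds by simp_all
  have denominators: "0 < (1 - (cmod (lens \<tau> z))\<^sup>2) * (lens_gap \<tau> * s powr \<tau>)"
    by (intro mult_pos_pos[OF less_le_trans[OF gap] gap(1)])
  have "(cmod (G (lens \<tau> z)))\<^sup>2 \<le> A / (1 - (cmod (lens \<tau> z))\<^sup>2)"
    by (rule growth[OF lens_in_disk[OF \<tau>_bounds z_disk]])
  also have "\<dots> \<le> A / (lens_gap \<tau> * s powr \<tau>)"
    using gap(2) \<open>0 \<le> A\<close> by (intro divide_left_mono denominators)
  finally show ?thesis
    by (simp add: powr_minus_divide)
qed

lemma h2_compose_lens_split:
  assumes N_ge_1: "N \<ge> 1" and G_holomorphic: "G holomorphic_on ball 0 1"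
    and growth: "\<And>w. cmod w < 1 \<Longrightarrow> (cmod (G w))\<^sup>2 \<le> A / (1 - (cmod w)\<^sup>2)"
    and \<delta>_nonneg: "0 \<le> \<delta>" and \<epsilon>_pos: "0 < \<epsilon>"
    and bound: "\<And>z s. cmod z < 1 \<Longrightarrow> \<epsilon> < s \<Longrightarrow> s \<le> 1 \<Longrightarrow> s \<le> cmod (1 - z\<^sup>2) \<Longrightarrow>
      (cmod (G (lens \<tau> z)))\<^sup>2 \<le> \<delta> * s powr (- ((1 + \<tau>) / 2))"
    and F_eq: "\<And>z. z \<in> polydisk N \<Longrightarrow> F z = G (lens \<tau> (z 0))"
  shows "F \<in> H2 N"
    and "(h2_norm N F)\<^sup>2 \<le> (A / lens_gap \<tau> * \<epsilon> powr ((1 - \<tau>) / 2) + \<delta>) * (2 / (1 - \<tau>))"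
proof -
  let ?K = "A / lens_gap \<tau>"
  have "0 \<le> A"
    using growth[of 0] by (simp add: order_trans[OF zero_le_power2])
  then have K_nonneg: "0 \<le> ?K"
    using lens_gap_pos[OF \<tau>_bounds] by simp
  have split: "(cmod (G (lens \<tau> z)))\<^sup>2 \<le> (?K * \<epsilon> powr ((1 - \<tau>) / 2) + \<delta>) * s powr (- ((1 + \<tau>) / 2))"
    if z_disk: "cmod z < 1" and s_bounds: "0 < s" "s \<le> 1" "s \<le> cmod (1 - z\<^sup>2)" for z s
  proof (cases "s \<le> \<epsilon>")
    case True
    have "(cmod (G (lens \<tau> z)))\<^sup>2 \<le> ?K * s powr (- \<tau>)"
      by (rule growth_compose_lens[OF growth z_disk s_bounds(1,3)])
    also have "\<dots> \<le> ?K * (\<epsilon> powr ((1 - \<tau>) / 2) * s powr (- ((1 + \<tau>) / 2)))"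
      using K_nonneg s_bounds True by (intro mult_left_mono powr_neg_le_split) auto
    also have "\<dots> \<le> (?K * \<epsilon> powr ((1 - \<tau>) / 2) + \<delta>) * s powr (- ((1 + \<tau>) / 2))"
      using \<delta>_nonneg by (simp add: distrib_right mult.assoc)
    finally show ?thesis .
  next
    case False
    have "(cmod (G (lens \<tau> z)))\<^sup>2 \<le> \<delta> * s powr (- ((1 + \<tau>) / 2))"
      using False s_bounds by (intro bound z_disk) auto
    also have "\<dots> \<le> (?K * \<epsilon> powr ((1 - \<tau>) / 2) + \<delta>) * s powr (- ((1 + \<tau>) / 2))"
      using mult_nonneg_nonneg[OF K_nonneg, of "\<epsilon> powr ((1 - \<tau>) / 2)"] by (intro mult_right_mono) auto
    finally show ?thesis .
  qed
  show "F \<in> H2 N"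
    by (rule h2_compose_lens(1)[where F = F and G = G, OF N_ge_1 G_holomorphic split F_eq])
  show "(h2_norm N F)\<^sup>2 \<le> (?K * \<epsilon> powr ((1 - \<tau>) / 2) + \<delta>) * (2 / (1 - \<tau>))"
    by (rule h2_compose_lens(2)[where F = F and G = G, OF N_ge_1 G_holomorphic split F_eq])
qed

lemma blaschke_dyadic_zeros_lens_le:
  assumes z_disk: "cmod z < 1" and s_bounds: "4 * 2 powr (- (real p / \<tau>)) < s" "s \<le> cmod (1 - z\<^sup>2)"
  shows "(cmod (blaschke (dyadic_zeros p) (lens \<tau> z)))\<^sup>2 \<le> (1 - 8 / 9 * cos (pi * \<tau> / 2)) ^ p"
proof (rule blaschke_dyadic_zeros_le[OF lens_in_disk[OF \<tau>_bounds z_disk] cos_half_pi_mult_pos[OF \<tau>_bounds]])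
  show "cos (pi * \<tau> / 2) * cmod (cayley (lens \<tau> z)) \<le> Re (cayley (lens \<tau> z))"
    unfolding cayley_lens[OF \<tau>_bounds z_disk] by (rule Re_powr_right_half_plane_ge[OF cayley_Re_pos[OF z_disk] \<tau>_bounds])
  have s_pos: "0 < s"
    using s_bounds(1) by (rule order.strict_trans1[rotated]) simp
  have "(2 powr (- (real p / \<tau>))) powr \<tau> = 2 powr (- real p)"
    unfolding powr_powr using \<tau>_bounds by simp
  then have "1 / 2 ^ p = (2 powr (- (real p / \<tau>))) powr \<tau>"
    by (simp add: powr_minus_divide powr_realpow)
  also have "\<dots> \<le> (s / 4) powr \<tau>"
    using s_bounds \<tau>_bounds by (intro powr_mono2) auto
  finally have scale: "1 / 2 ^ p \<le> (s / 4) powr \<tau>" .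
  with cmod_cayley_lens_ge(1)[OF \<tau>_bounds z_disk s_pos s_bounds(2)] show cayley_ge: "1 / 2 ^ p \<le> cmod (cayley (lens \<tau> z))"
    by linarith
  have "0 < cmod (cayley (lens \<tau> z))"
    by (rule less_le_trans[OF _ cayley_ge]) simp
  moreover have "1 / 2 ^ p \<le> 1 / cmod (cayley (lens \<tau> z))"
    using scale cmod_cayley_lens_ge(2)[OF \<tau>_bounds z_disk s_pos s_bounds(2)] by linarith
  ultimately show "cmod (cayley (lens \<tau> z)) \<le> 2 ^ p"
    by (simp add: field_simps)
qed

lemma decay_rate: "0 < decay_rate \<tau>" "decay_rate \<tau> < 1"
proof -
  have "2 powr (- ((1 - \<tau>) / (2 * \<tau>))) < 2 powr (0::real)"
    using \<tau>_bounds by (intro powr_less_mono) auto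
  then show "0 < decay_rate \<tau>" "decay_rate \<tau> < 1"
    using cos_half_pi_mult_pos[OF \<tau>_bounds] by (auto simp: decay_rate_def less_max_iff_disj)
qed

lemma dyadic_threshold_powr_le: "(4 * 2 powr (- (real p / \<tau>))) powr ((1 - \<tau>) / 2) \<le> 2 * decay_rate \<tau> ^ p"
proof -
  have "(4 * 2 powr (- (real p / \<tau>))) powr ((1 - \<tau>) / 2) = 4 powr ((1 - \<tau>) / 2) * 2 powr (- ((1 - \<tau>) / (2 * \<tau>)) * real p)"
    by (simp add: powr_mult powr_powr mult_ac)
  also have "\<dots> = 4 powr ((1 - \<tau>) / 2) * (2 powr (- ((1 - \<tau>) / (2 * \<tau>)))) ^ p"
    by (simp only: powr_powr[symmetric]) (simp add: powr_realpow)
  also have "\<dots> \<le> 4 powr (1 / 2) * decay_rate \<tau> ^ p"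
    using \<tau>_bounds by (intro mult_mono powr_mono power_mono) (auto simp: decay_rate_def)
  finally show ?thesis
    by (simp add: powr_half_sqrt)
qed

lemma blaschke_multiple_compose_lens:
  assumes N_ge_1: "N \<ge> 1" and d_ell2: "d \<in> ell2" "ell2_sqnorm d \<le> A"
    and F_eq: "\<And>z. z \<in> polydisk N \<Longrightarrow> F z = blaschke (dyadic_zeros p) (lens \<tau> (z 0)) * power_series d (lens \<tau> (z 0))"
  shows "F \<in> H2 N" and "(h2_norm N F)\<^sup>2 \<le> 6 * A / (lens_gap \<tau> * (1 - \<tau>)) * decay_rate \<tau> ^ p"
proof -
  let ?zs = "dyadic_zeros p" and ?q = "1 - 8 / 9 * cos (pi * \<tau> / 2)" and ?\<epsilon> = "4 * 2 powr (- (real p / \<tau>))"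
  let ?G = "\<lambda>w. blaschke ?zs w * power_series d w" and ?K = "A / lens_gap \<tau>"
  note zs = dyadic_zeros_in_disk[of p] and rest = power_series_growth[OF d_ell2]
  have K_nonneg: "0 \<le> ?K"
    using ell2_sqnorm_nonneg[OF d_ell2(1)] d_ell2(2) lens_gap_pos[OF \<tau>_bounds] by simp
  have "0 \<le> ?q"
    using cos_le_one[of "pi * \<tau> / 2"] by linarith
  then have q_bounds: "0 \<le> ?q" "?q \<le> decay_rate \<tau>"
    by (simp_all add: decay_rate_def)
  have G_holomorphic: "?G holomorphic_on ball 0 1"
    by (intro holomorphic_intros blaschke_holomorphic holomorphic_on_power_series zs d_ell2)
  have growth: "(cmod (?G w))\<^sup>2 \<le> A / (1 - (cmod w)\<^sup>2)" if w_disk: "cmod w < 1" for w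
    using mult_mono[OF power_le_one[OF norm_ge_zero blaschke_le_1[OF zs w_disk], of 2] rest[OF w_disk]]
    by (simp add: norm_mult power_mult_distrib)
  have middle: "(cmod (?G (lens \<tau> z)))\<^sup>2 \<le> ?K * ?q ^ p * s powr (- ((1 + \<tau>) / 2))"
    if z_disk: "cmod z < 1" and s_bounds: "?\<epsilon> < s" "s \<le> 1" "s \<le> cmod (1 - z\<^sup>2)" for z s
  proof -
    have s_pos: "0 < s"
      using s_bounds(1) by (rule order.strict_trans1[rotated]) simp
    have "(cmod (?G (lens \<tau> z)))\<^sup>2 \<le> ?q ^ p * (?K * s powr (- \<tau>))"
      unfolding norm_mult power_mult_distrib
      by (intro mult_mono blaschke_dyadic_zeros_lens_le[OF z_disk s_bounds(1,3)]
          growth_compose_lens[OF rest z_disk s_pos s_bounds(3)])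
         (use q_bounds in auto)
    also have "\<dots> \<le> ?q ^ p * (?K * s powr (- ((1 + \<tau>) / 2)))"
      using K_nonneg q_bounds \<tau>_bounds s_pos s_bounds(2) by (intro mult_left_mono powr_mono') auto
    finally show ?thesis
      by (simp add: mult_ac)
  qed
  have "0 \<le> ?K * ?q ^ p" "0 < ?\<epsilon>"
    using mult_nonneg_nonneg[OF K_nonneg zero_le_power[OF q_bounds(1)]] by simp_all
  note split = h2_compose_lens_split[where F = F and G = ?G and \<epsilon> = ?\<epsilon>, OF N_ge_1 G_holomorphic growth this middle F_eq]
  show "F \<in> H2 N"
    by (rule split)
  have "(h2_norm N F)\<^sup>2 \<le> (?K * ?\<epsilon> powr ((1 - \<tau>) / 2) + ?K * ?q ^ p) * (2 / (1 - \<tau>))"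
    by (rule split)
  also have "\<dots> \<le> (?K * (2 * decay_rate \<tau> ^ p) + ?K * decay_rate \<tau> ^ p) * (2 / (1 - \<tau>))"
    using K_nonneg q_bounds \<tau>_bounds
    by (intro mult_right_mono add_mono mult_left_mono power_mono dyadic_threshold_powr_le) auto
  also have "\<dots> = 6 * A / (lens_gap \<tau> * (1 - \<tau>)) * decay_rate \<tau> ^ p"
    using \<tau>_bounds lens_gap_pos[OF \<tau>_bounds] by (simp add: field_simps)
  finally show "(h2_norm N F)\<^sup>2 \<le> 6 * A / (lens_gap \<tau> * (1 - \<tau>)) * decay_rate \<tau> ^ p" .
qed

lemma lens_image_subset_compact:
  assumes \<epsilon>_pos: "0 < \<epsilon>"
  obtains K where "compact K" "K \<subseteq> ball 0 1"
    "\<And>z s. cmod z < 1 \<Longrightarrow> \<epsilon> < s \<Longrightarrow> s \<le> cmod (1 - z\<^sup>2) \<Longrightarrow> lens \<tau> z \<in> K"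
proof
  define K where "K = cball (0::complex) (sqrt (1 - lens_gap \<tau> * \<epsilon> powr \<tau>))"
  show "compact K"
    by (simp add: K_def)
  have "sqrt (1 - lens_gap \<tau> * \<epsilon> powr \<tau>) < 1"
    using lens_gap_pos[OF \<tau>_bounds] \<epsilon>_pos by simp
  then show "K \<subseteq> ball 0 1"
    unfolding K_def by (simp only: cball_subset_ball_iff) simp
  fix z :: complex and s :: real assume z_disk: "cmod z < 1" and s_bounds: "\<epsilon> < s" "s \<le> cmod (1 - z\<^sup>2)"
  have "lens_gap \<tau> * \<epsilon> powr \<tau> \<le> lens_gap \<tau> * s powr \<tau>"
    using s_bounds lens_gap_pos[OF \<tau>_bounds] \<epsilon>_pos \<tau>_bounds by (intro mult_left_mono powr_mono2) auto
  also have "\<dots> \<le> 1 - (cmod (lens \<tau> z))\<^sup>2"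
    using z_disk s_bounds \<epsilon>_pos by (intro lens_gap_le[OF \<tau>_bounds]) auto
  finally show "lens \<tau> z \<in> K"
    unfolding K_def by (auto intro!: real_le_rsqrt)
qed

lemma h2_norm_compose_lens_diff_le:
  assumes N_ge_1: "N \<ge> 1" and c_ell2: "c \<in> ell2" "ell2_sqnorm c \<le> A" and d_ell2: "d \<in> ell2" "ell2_sqnorm d \<le> A"
    and \<delta>_nonneg: "0 \<le> \<delta>" and \<epsilon>_pos: "0 < \<epsilon>"
    and close: "\<And>z s. cmod z < 1 \<Longrightarrow> \<epsilon> < s \<Longrightarrow> s \<le> cmod (1 - z\<^sup>2) \<Longrightarrow>
      (dist (power_series c (lens \<tau> z)) (power_series d (lens \<tau> z)))\<^sup>2 \<le> \<delta>"
    and F_eq: "\<And>z. z \<in> polydisk N \<Longrightarrow> F z = power_series c (lens \<tau> (z 0)) - power_series d (lens \<tau> (z 0))"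
  shows "(h2_norm N F)\<^sup>2 \<le> (4 * A / lens_gap \<tau> * \<epsilon> powr ((1 - \<tau>) / 2) + \<delta>) * (2 / (1 - \<tau>))"
proof (rule h2_compose_lens_split(2)[where F = F and G = "\<lambda>w. power_series c w - power_series d w",
      OF N_ge_1 _ _ \<delta>_nonneg \<epsilon>_pos _ F_eq])
  show "(\<lambda>w. power_series c w - power_series d w) holomorphic_on ball 0 1"
    by (intro holomorphic_intros holomorphic_on_power_series c_ell2 d_ell2)
  show "(cmod (power_series c w - power_series d w))\<^sup>2 \<le> 4 * A / (1 - (cmod w)\<^sup>2)" if w_disk: "cmod w < 1" for w
    using cmod_diff_squared_le[of "power_series c w" "power_series d w"]
      power_series_growth[OF c_ell2 w_disk] power_series_growth[OF d_ell2 w_disk] by simp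
  fix z s assume z_disk: "cmod z < 1" and s_bounds: "\<epsilon> < s" "s \<le> 1" "s \<le> cmod (1 - z\<^sup>2)"
  have "(cmod (power_series c (lens \<tau> z) - power_series d (lens \<tau> z)))\<^sup>2 \<le> \<delta> * 1"
    using close[OF z_disk s_bounds(1,3)] by (simp add: dist_norm)
  also have "\<dots> \<le> \<delta> * s powr (- ((1 + \<tau>) / 2))"
    using \<delta>_nonneg s_bounds \<epsilon>_pos \<tau>_bounds powr_mono'[of "- ((1 + \<tau>) / 2)" 0 s] by (intro mult_left_mono) auto
  finally show "(cmod (power_series c (lens \<tau> z) - power_series d (lens \<tau> z)))\<^sup>2 \<le> \<delta> * s powr (- ((1 + \<tau>) / 2))" .
qed

end

lemma locally_uniform_convergent_subsequence:
  fixes c :: "nat \<Rightarrow> nat \<Rightarrow> complex"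
  assumes c_ell2: "\<And>k. c k \<in> ell2" and c_sqnorm: "\<And>k. ell2_sqnorm (c k) \<le> A"
  obtains g r where "strict_mono r"
    "\<And>K. compact K \<Longrightarrow> K \<subseteq> ball 0 1 \<Longrightarrow> uniform_limit K (\<lambda>k. power_series (c (r k))) g sequentially"
proof -
  obtain g r where r_mono: "strict_mono (r :: nat \<Rightarrow> nat)"
    and uniform: "\<And>K. compact K \<Longrightarrow> K \<subseteq> ball 0 1 \<Longrightarrow> uniform_limit K ((\<lambda>k. power_series (c k)) \<circ> r) g sequentially"
  proof (rule Montel[of "ball 0 1" "range (\<lambda>k. power_series (c k))" "\<lambda>k. power_series (c k)"])
    show "h holomorphic_on ball 0 1" if "h \<in> range (\<lambda>k. power_series (c k))" for h
      using that holomorphic_on_power_series[OF c_ell2] by auto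
    fix K :: "complex set" assume K_compact: "compact K" "K \<subseteq> ball 0 1"
    let ?b = "\<lambda>w. sqrt (A / (1 - (cmod w)\<^sup>2))"
    have "continuous_on K ?b"
    proof (intro continuous_intros ballI)
      fix w assume "w \<in> K"
      then show "1 - (cmod w)\<^sup>2 \<noteq> 0"
        using K_compact(2) abs_square_less_1[of "cmod w"] by auto
    qed
    then have "bounded (?b ` K)"
      using K_compact(1) compact_continuous_image compact_imp_bounded by blast
    then obtain B where root_bound: "\<And>w. w \<in> K \<Longrightarrow> \<bar>?b w\<bar> \<le> B"
      unfolding bounded_iff by auto
    have "cmod (power_series (c k) w) \<le> B" if w_in_K: "w \<in> K" for k w
    proof -
      have "cmod w < 1"
        using w_in_K K_compact(2) by auto
      then have "cmod (power_series (c k) w) \<le> ?b w"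
        by (intro real_le_rsqrt power_series_growth c_ell2 c_sqnorm)
      with root_bound[OF w_in_K] show ?thesis by linarith
    qed
    then show "\<exists>B. \<forall>h\<in>range (\<lambda>k. power_series (c k)). \<forall>w\<in>K. cmod (h w) \<le> B" by auto
  qed auto
  show ?thesis
    by (rule that[OF r_mono]) (use uniform in \<open>simp add: comp_def\<close>)
qed

lemma exists_pos_mult_powr_less:
  fixes A e \<eta> :: real
  assumes "0 < e" "0 < \<eta>"
  shows "\<exists>s>0. A * s powr \<eta> < e"
proof -
  have "((\<lambda>s. A * s powr \<eta>) \<longlongrightarrow> A * 0) (at_right 0)"
    using tendsto_powr'[of "\<lambda>s::real. s" 0 "at_right 0" "\<lambda>_. \<eta>" \<eta>] assms(2)
    by (intro tendsto_mult_left) (simp add: eventually_at_filter)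
  then have "\<forall>\<^sub>F s in at_right 0. A * s powr \<eta> < e"
    by (rule order_tendstoD) (use assms in simp)
  moreover have "\<forall>\<^sub>F s in at_right (0::real). 0 < s"
    by (rule eventually_at_right_less)
  ultimately have "\<forall>\<^sub>F s in at_right (0::real). 0 < s \<and> A * s powr \<eta> < e"
    by (simp add: eventually_conj)
  from eventually_happens'[OF trivial_limit_at_right_real this] show ?thesis .
qed

lemma compose_lens_Cauchy_subsequence:
  fixes c :: "nat \<Rightarrow> nat \<Rightarrow> complex" and F :: "nat \<Rightarrow> (nat \<Rightarrow> complex) \<Rightarrow> complex"
  assumes N_ge_1: "N \<ge> 1" and \<tau>_bounds: "0 < \<tau>" "\<tau> < 1"
    and c_ell2: "\<And>k. c k \<in> ell2" and c_sqnorm: "\<And>k. ell2_sqnorm (c k) \<le> A"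
    and F_eq: "\<And>k z. z \<in> polydisk N \<Longrightarrow> F k z = power_series (c k) (lens \<tau> (z 0))"
  shows "\<exists>r::nat\<Rightarrow>nat. strict_mono r \<and> (\<forall>e>0. \<exists>M. \<forall>m\<ge>M. \<forall>n\<ge>M. h2_norm N (\<lambda>z. F (r m) z - F (r n) z) < e)"
proof -
  obtain g r where r_mono: "strict_mono r"
    and uniform: "\<And>K. compact K \<Longrightarrow> K \<subseteq> ball 0 1 \<Longrightarrow> uniform_limit K (\<lambda>k. power_series (c (r k))) g sequentially"
    by (rule locally_uniform_convergent_subsequence[of c A, OF c_ell2 c_sqnorm]) blast
  have "\<exists>M. \<forall>m\<ge>M. \<forall>n\<ge>M. h2_norm N (\<lambda>z. F (r m) z - F (r n) z) < e" if e_pos: "0 < e" for e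
  proof -
    define \<delta> where "\<delta> = e\<^sup>2 * (1 - \<tau>) / 4"
    have \<delta>_pos: "0 < \<delta>"
      using e_pos \<tau>_bounds by (simp add: \<delta>_def)
    obtain \<epsilon> where \<epsilon>_bounds: "0 < \<epsilon>" "4 * A / lens_gap \<tau> * \<epsilon> powr ((1 - \<tau>) / 2) < \<delta>"
      using exists_pos_mult_powr_less[OF \<delta>_pos, of "(1 - \<tau>) / 2" "4 * A / lens_gap \<tau>"] \<tau>_bounds by auto
    obtain K where "compact K" "K \<subseteq> ball 0 1"
      and lens_in_K: "\<And>z s. cmod z < 1 \<Longrightarrow> \<epsilon> < s \<Longrightarrow> s \<le> cmod (1 - z\<^sup>2) \<Longrightarrow> lens \<tau> z \<in> K"
      using lens_image_subset_compact[OF \<tau>_bounds \<epsilon>_bounds(1)] by metis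
    then have "uniform_limit K (\<lambda>k. power_series (c (r k))) g sequentially"
      by (intro uniform)
    moreover have "0 < sqrt \<delta> / 2"
      using \<delta>_pos by simp
    ultimately obtain M where Cauchy: "\<And>m w. m \<ge> M \<Longrightarrow> w \<in> K \<Longrightarrow> dist (power_series (c (r m)) w) (g w) < sqrt \<delta> / 2"
      unfolding uniform_limit_sequentially_iff by blast
    have "h2_norm N (\<lambda>z. F (r m) z - F (r n) z) < e" if mn_ge: "m \<ge> M" "n \<ge> M" for m n
    proof (rule power2_less_imp_less)
      have close: "(dist (power_series (c (r m)) (lens \<tau> z)) (power_series (c (r n)) (lens \<tau> z)))\<^sup>2 \<le> \<delta>"
        if z_disk: "cmod z < 1" and s_bounds: "\<epsilon> < s" "s \<le> cmod (1 - z\<^sup>2)" for z s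
      proof -
        have "dist (power_series (c (r m)) (lens \<tau> z)) (power_series (c (r n)) (lens \<tau> z)) < sqrt \<delta>"
          using Cauchy[OF mn_ge(1) lens_in_K[OF z_disk s_bounds]] Cauchy[OF mn_ge(2) lens_in_K[OF z_disk s_bounds]]
          by (rule dist_triangle_half_l)
        then show ?thesis
          using \<delta>_pos by (intro sqrt_ge_absD) simp
      qed
      have "(h2_norm N (\<lambda>z. F (r m) z - F (r n) z))\<^sup>2
          \<le> (4 * A / lens_gap \<tau> * \<epsilon> powr ((1 - \<tau>) / 2) + \<delta>) * (2 / (1 - \<tau>))"
        by (rule h2_norm_compose_lens_diff_le[OF \<tau>_bounds N_ge_1 c_ell2 c_sqnorm c_ell2 c_sqnorm
            less_imp_le[OF \<delta>_pos] \<epsilon>_bounds(1) close])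
           (simp_all add: F_eq)
      also have "\<dots> < (\<delta> + \<delta>) * (2 / (1 - \<tau>))"
        using \<epsilon>_bounds \<tau>_bounds by (intro mult_strict_right_mono add_strict_right_mono) auto
      also have "\<dots> = e\<^sup>2"
        using \<tau>_bounds by (simp add: \<delta>_def field_simps)
      finally show "(h2_norm N (\<lambda>z. F (r m) z - F (r n) z))\<^sup>2 < e\<^sup>2" .
    qed (use e_pos in simp)
    then show ?thesis by blast
  qed
  with r_mono show ?thesis by blast
qed

lemma exp_sqrt_decay_if_geometric_decay:
  fixes a :: "nat \<Rightarrow> real"
  assumes C_pos: "0 < C" and q_bounds: "0 < q" "q < 1"
    and bound: "\<And>p n. (2 * p + 1) * p < n \<Longrightarrow> a n \<le> C * q ^ p"
  shows "\<exists>d>0. \<exists>K>0. \<forall>n\<ge>1. a n \<le> K * exp (- d * sqrt (real n))"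
proof (intro exI conjI allI impI)
  define l where "l = - ln q"
  show l_pos: "0 < l / 2" and "0 < C * exp l"
    using q_bounds C_pos by (simp_all add: l_def)
  fix n :: nat assume n_ge_1: "n \<ge> 1"
  define p where "p = nat \<lfloor>sqrt (real n) / 2\<rfloor>"
  have p_bounds: "real p \<le> sqrt (real n) / 2" "sqrt (real n) / 2 \<le> real p + 1"
    unfolding p_def by (auto simp: of_nat_nat) linarith+
  have "(2 * p + 1) * p < n"
  proof (cases "p = 0")
    case False
    have "(2 * real p)\<^sup>2 \<le> (sqrt (real n))\<^sup>2" using p_bounds by (intro power_mono) auto
    then have "real (4 * p * p) \<le> real n" by (simp add: power2_eq_square)
    then have "4 * p * p \<le> n" by (simp only: of_nat_le_iff)
    moreover have "(2 * p + 1) * p < 4 * p * p" using False by simp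
    ultimately show ?thesis by linarith
  qed (use n_ge_1 in simp)
  then have "a n \<le> C * q ^ p"
    by (rule bound)
  also have "q ^ p = exp (- l * real p)"
    using q_bounds exp_of_nat_mult[of p "ln q"] by (simp add: l_def mult.commute)
  also have "C * exp (- l * real p) \<le> C * exp (l + - (l / 2) * sqrt (real n))"
    using C_pos l_pos p_bounds(2) mult_left_mono[of "sqrt (real n) / 2" "real p + 1" l]
    by (intro mult_left_mono) (auto simp: algebra_simps)
  finally show "a n \<le> C * exp l * exp (- (l / 2) * sqrt (real n))"
    by (simp only: exp_add mult.assoc)
qed

definition error_const :: "nat \<Rightarrow> real \<Rightarrow> real" where
  "error_const N \<tau> = 6 * critical_const N / (lens_gap \<tau> * (1 - \<tau>))"

definition interpolant :: "nat \<Rightarrow> real \<Rightarrow> nat \<Rightarrow> ((nat \<Rightarrow> complex) \<Rightarrow> complex) \<Rightarrow> (nat \<Rightarrow> complex) \<Rightarrow> complex" where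
  "interpolant N \<tau> p f z = (\<Sum>k<(2 * p + 1) * p.
     tm_coeff (dyadic_zeros p) (critical_coeffs N f) k * tm_basis (dyadic_zeros p) k (lens \<tau> (z 0)))"

context
  fixes N :: nat and \<tau> \<theta> :: real
  assumes N_ge_2: "N \<ge> 2" and \<tau>_bounds: "0 < \<tau>" "\<tau> < 1" and \<theta>_eq: "\<theta> = \<tau> / real N"
begin

lemma comp_op_lens_diag_factorization:
  assumes f_H2: "f \<in> H2 N" and z_polydisk: "z \<in> polydisk N"
  shows "comp_op (lens_diag \<theta>) f z = power_series (critical_coeffs N f) (lens \<tau> (z 0))"
proof -
  have z0_disk: "cmod (z 0) < 1"
    using z_polydisk N_ge_2 by (simp add: polydisk_def)
  have "lens \<theta> (z 0) = lens (1 / real N) (lens \<tau> (z 0))"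
    using lens_lens[OF \<tau>_bounds z0_disk, of "1 / real N"] by (simp add: \<theta>_eq)
  then show ?thesis
    by (simp add: comp_op_lens_diag power_series_critical_coeffs[OF N_ge_2 f_H2 lens_in_disk[OF \<tau>_bounds z0_disk]])
qed

lemma error_const_pos: "0 < error_const N \<tau>"
  using critical_const_pos[OF N_ge_2] lens_gap_pos[OF \<tau>_bounds] \<tau>_bounds by (simp add: error_const_def)

lemma interpolant_error:
  assumes f_H2: "f \<in> H2 N"
  shows "(\<lambda>z. comp_op (lens_diag \<theta>) f z - interpolant N \<tau> p f z) \<in> H2 N"
    and "(h2_norm N (\<lambda>z. comp_op (lens_diag \<theta>) f z - interpolant N \<tau> p f z))\<^sup>2
      \<le> error_const N \<tau> * decay_rate \<tau> ^ p * (h2_norm N f)\<^sup>2"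
proof -
  let ?E = "\<lambda>z. comp_op (lens_diag \<theta>) f z - interpolant N \<tau> p f z"
  let ?zs = "dyadic_zeros p" and ?c = "critical_coeffs N f"
  note zs = dyadic_zeros_in_disk[of p] and c = critical_coeffs_ell2[OF N_ge_2 f_H2]
  have d_ell2: "fold blaschke_quot ?zs ?c \<in> ell2"
      "ell2_sqnorm (fold blaschke_quot ?zs ?c) \<le> critical_const N * (h2_norm N f)\<^sup>2"
    using fold_blaschke_quot_ell2[OF zs c(1)] c(2) by auto
  have error_eq: "?E z = blaschke ?zs (lens \<tau> (z 0)) * power_series (fold blaschke_quot ?zs ?c) (lens \<tau> (z 0))"
    if z_polydisk: "z \<in> polydisk N" for z
  proof -
    have "cmod (lens \<tau> (z 0)) < 1"
      using z_polydisk N_ge_2 by (intro lens_in_disk[OF \<tau>_bounds]) (simp add: polydisk_def)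
    from takenaka_malmquist_decomposition[OF zs c(1) this] show ?thesis
      by (simp add: interpolant_def comp_op_lens_diag_factorization[OF f_H2 z_polydisk] length_dyadic_zeros)
  qed
  have "N \<ge> 1"
    using N_ge_2 by simp
  note error = blaschke_multiple_compose_lens[where F = ?E, OF \<tau>_bounds this d_ell2 error_eq]
  show "?E \<in> H2 N"
    by (rule error)
  show "(h2_norm N ?E)\<^sup>2 \<le> error_const N \<tau> * decay_rate \<tau> ^ p * (h2_norm N f)\<^sup>2"
    using error(2) by (simp add: error_const_def mult_ac)
qed

theorem comp_op_lens_diag_bounded_subcritical: "bounded_on_H2 N (comp_op (lens_diag \<theta>))"
  using interpolant_error[of _ 0] by (intro bounded_on_H2_if_sq_bound) (simp_all add: interpolant_def)

lemma interpolant_bounded: "bounded_on_H2 N (interpolant N \<tau> p)"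
proof -
  have "bounded_on_H2 N (\<lambda>f z. comp_op (lens_diag \<theta>) f z - interpolant N \<tau> p f z)"
    by (rule bounded_on_H2_if_sq_bound; rule interpolant_error)
  from bounded_on_H2_diff[OF comp_op_lens_diag_bounded_subcritical this] show ?thesis
    by simp
qed

lemma interpolant_linear: "linear_on_H2 N (interpolant N \<tau> p)"
  unfolding linear_on_H2_def
proof (intro conjI ballI allI)
  show "interpolant N \<tau> p f \<in> H2 N" if "f \<in> H2 N" for f
    using interpolant_bounded that unfolding bounded_on_H2_def by blast
  fix f g a b z assume f_H2: "f \<in> H2 N" and g_H2: "g \<in> H2 N"
  have "tm_coeff (dyadic_zeros p) (critical_coeffs N (\<lambda>w. a * f w + b * g w)) k =
      a * tm_coeff (dyadic_zeros p) (critical_coeffs N f) k + b * tm_coeff (dyadic_zeros p) (critical_coeffs N g) k"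
    if "k < (2 * p + 1) * p" for k
    unfolding critical_coeffs_linear[OF N_ge_2 f_H2 g_H2] using that
    by (intro tm_coeff_linear dyadic_zeros_in_disk critical_coeffs_ell2[OF N_ge_2] f_H2 g_H2)
       (simp add: length_dyadic_zeros)
  then show "interpolant N \<tau> p (\<lambda>w. a * f w + b * g w) z = a * interpolant N \<tau> p f z + b * interpolant N \<tau> p g z"
    by (simp add: interpolant_def distrib_right sum.distrib sum_distrib_left mult.assoc)
qed

lemma interpolant_rank:
  assumes rank_bound: "(2 * p + 1) * p < n"
  shows "rank_less N (interpolant N \<tau> p) n"
  unfolding rank_less_def
proof (intro exI conjI allI impI ballI)
  show "(2 * p + 1) * p < n" by (rule rank_bound)
  show "interpolant N \<tau> p f z = (\<Sum>k<(2 * p + 1) * p.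
      tm_coeff (dyadic_zeros p) (critical_coeffs N f) k * tm_basis (dyadic_zeros p) k (lens \<tau> (z 0)))" for f z
    by (rule interpolant_def)
  fix k assume "k < (2 * p + 1) * p"
  then have k_index: "k < length (dyadic_zeros p)"
    by (simp add: length_dyadic_zeros)
  show "(\<lambda>z. tm_basis (dyadic_zeros p) k (lens \<tau> (z 0))) \<in> H2 N"
  proof (rule h2_compose_lens_split(1)[where \<epsilon> = 1 and \<delta> = 0, OF \<tau>_bounds _
        tm_basis_holomorphic[OF dyadic_zeros_in_disk k_index]])
    fix w :: complex assume w_disk: "cmod w < 1"
    have "(cmod (tm_basis (dyadic_zeros p) k w))\<^sup>2 \<le> 2\<^sup>2"
      using tm_basis_le_2[OF dyadic_zeros_in_disk k_index w_disk] by (intro power_mono) auto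
    also have "\<dots> \<le> 4 / (1 - (cmod w)\<^sup>2)"
      using w_disk by (simp add: pos_le_divide_eq abs_square_less_1)
    finally show "(cmod (tm_basis (dyadic_zeros p) k w))\<^sup>2 \<le> 4 / (1 - (cmod w)\<^sup>2)" .
  qed (use N_ge_2 in \<open>auto simp: less_imp_le\<close>)
qed

theorem approx_num_subcritical:
  "\<exists>d>0. \<exists>K>0. \<forall>n\<ge>1. approx_num N (comp_op (lens_diag \<theta>)) n \<le> K * exp (- d * sqrt (real n))"
proof (rule exp_sqrt_decay_if_geometric_decay)
  show "0 < sqrt (error_const N \<tau>)" "0 < sqrt (decay_rate \<tau>)" "sqrt (decay_rate \<tau>) < 1"
    using error_const_pos decay_rate[OF \<tau>_bounds] by simp_all
  fix p n :: nat assume rank_bound: "(2 * p + 1) * p < n"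
  show "approx_num N (comp_op (lens_diag \<theta>)) n \<le> sqrt (error_const N \<tau>) * sqrt (decay_rate \<tau>) ^ p"
  proof (rule approx_num_le[OF comp_op_lens_diag_bounded_subcritical interpolant_linear interpolant_bounded
        interpolant_rank[OF rank_bound]])
    fix f assume f_unit_ball: "f \<in> H2 N" "h2_norm N f \<le> 1"
    let ?error = "\<lambda>z. comp_op (lens_diag \<theta>) f z - interpolant N \<tau> p f z"
    have "(h2_norm N ?error)\<^sup>2 \<le> error_const N \<tau> * decay_rate \<tau> ^ p * (h2_norm N f)\<^sup>2"
      by (rule interpolant_error(2)[OF f_unit_ball(1)])
    also have "\<dots> \<le> error_const N \<tau> * decay_rate \<tau> ^ p * 1"
      using error_const_pos decay_rate[OF \<tau>_bounds] f_unit_ball h2_norm_nonneg[of N f]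
      by (intro mult_left_mono power_le_one) auto
    finally have "h2_norm N ?error \<le> sqrt (error_const N \<tau> * decay_rate \<tau> ^ p)"
      by (intro real_le_rsqrt) simp
    then show "h2_norm N ?error \<le> sqrt (error_const N \<tau>) * sqrt (decay_rate \<tau>) ^ p"
      by (simp add: real_sqrt_mult real_sqrt_power)
  qed
qed

theorem comp_op_lens_diag_compact_subcritical: "compact_on_H2 N (comp_op (lens_diag \<theta>))"
  unfolding compact_on_H2_def
proof (intro conjI ballI allI impI)
  let ?T = "comp_op (lens_diag \<theta>)"
  show "?T f \<in> H2 N" if "f \<in> H2 N" for f
    using comp_op_lens_diag_bounded_subcritical that unfolding bounded_on_H2_def by blast
  fix u :: "nat \<Rightarrow> (nat \<Rightarrow> complex) \<Rightarrow> complex"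
  assume "\<forall>k. u k \<in> H2 N \<and> h2_norm N (u k) \<le> 1"
  then have u_unit_ball: "u k \<in> H2 N" "h2_norm N (u k) \<le> 1" for k
    by auto
  have sqnorm_le: "ell2_sqnorm (critical_coeffs N (u k)) \<le> critical_const N" for k
  proof -
    have "critical_const N * (h2_norm N (u k))\<^sup>2 \<le> critical_const N * 1"
      using critical_const_pos[OF N_ge_2] u_unit_ball(2)[of k] h2_norm_nonneg[of N "u k"]
      by (intro mult_left_mono power_le_one) auto
    with critical_coeffs_ell2(2)[OF N_ge_2 u_unit_ball(1)[of k]] show ?thesis by simp
  qed
  show "\<exists>r::nat\<Rightarrow>nat. strict_mono r \<and> (\<forall>e>0. \<exists>M. \<forall>m\<ge>M. \<forall>n\<ge>M.
      h2_norm N (\<lambda>z. ?T (u (r m)) z - ?T (u (r n)) z) < e)"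
    by (rule compose_lens_Cauchy_subsequence[where F = "\<lambda>k. ?T (u k)" and c = "\<lambda>k. critical_coeffs N (u k)",
          OF _ \<tau>_bounds critical_coeffs_ell2(1)[OF N_ge_2 u_unit_ball(1)] sqnorm_le
          comp_op_lens_diag_factorization[OF u_unit_ball(1)]])
       (use N_ge_2 in simp)
qed

end

theorem theorem2p4:
  fixes N :: nat and \<theta> :: real
  assumes "N \<ge> 2" and "0 < \<theta>" and "\<theta> < 1"
  shows "(\<theta> > 1 / real N \<longrightarrow> \<not> bounded_on_H2 N (comp_op (lens_diag \<theta>))) \<and>
         (\<theta> = 1 / real N \<longrightarrow> bounded_on_H2 N (comp_op (lens_diag \<theta>)) \<and>
                              \<not> compact_on_H2 N (comp_op (lens_diag \<theta>))) \<and>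
         (\<theta> < 1 / real N \<longrightarrow> compact_on_H2 N (comp_op (lens_diag \<theta>)) \<and>
            (\<exists>d>0. \<exists>K>0. \<forall>n\<ge>1.
               approx_num N (comp_op (lens_diag \<theta>)) n \<le> K * exp (- d * sqrt (real n))))"
proof (intro conjI impI)
  show "\<not> bounded_on_H2 N (comp_op (lens_diag \<theta>))" if "\<theta> > 1 / real N"
    using assms that by (intro comp_op_lens_diag_unbounded_supercritical) auto
  show "bounded_on_H2 N (comp_op (lens_diag \<theta>))" if "\<theta> = 1 / real N"
    using comp_op_lens_diag_bounded_critical[OF assms(1)] that by simp
  show "\<not> compact_on_H2 N (comp_op (lens_diag \<theta>))" if "\<theta> = 1 / real N"
    using comp_op_lens_diag_noncompact_critical[OF assms(1)] that by simp
next
  assume subcritical: "\<theta> < 1 / real N"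
  define \<tau> where "\<tau> = \<theta> * real N"
  have \<tau>_bounds: "0 < \<tau>" "\<tau> < 1" "\<theta> = \<tau> / real N"
    using assms subcritical by (auto simp: \<tau>_def field_simps)
  show "compact_on_H2 N (comp_op (lens_diag \<theta>))"
    using assms(1) \<tau>_bounds by (rule comp_op_lens_diag_compact_subcritical)
  show "\<exists>d>0. \<exists>K>0. \<forall>n\<ge>1. approx_num N (comp_op (lens_diag \<theta>)) n \<le> K * exp (- d * sqrt (real n))"
    using assms(1) \<tau>_bounds by (rule approx_num_subcritical)
qed

end
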